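(* Let $d\ge 1$ and $n\ge d$ be integers, let $X_1,\dots,X_n$ be i.i.d. random elements of a measurable space $\mathcal{X}$, and let $\psi:\mathcal{X}^d\to\mathbb{R}$ be a measurable symmetric function with $\mathbb{E}\,\psi(X_1,\dots,X_d)=0$. Let $\psi_k$, $U_k$, $W_k$ ($k=1,\dots,d$) be defined from $\psi$ and $X_1,\dots,X_n$ as in the context, and assume non-degeneracy: $\mathbb{P}[\psi_1(X_1)=0]<1$. Let $W=(W_1,\dots,W_d)^t$ and $\Sigma=\mathbb{E}(WW^t)$, and let $Z$ be a standard $d$-dimensional normal random vector. If $\rho:=\mathbb{E}\,\psi(X_1,\dots,X_d)^4<\infty$, then for every three times differentiable function $h:\mathbb{R}^d\to\mathbb{R}$, $$\bigl|\mathbb{E}h(W)-\mathbb{E}h(\Sigma^{1/2}Z)\bigr|\le n^{-1/2}\left(4\rho^{1/2}d^6|h|_2+\rho^{3/4}d^7|h|_3\right).$$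
   Context: For $k=1,\dots,d$, $\psi_k:\mathcal{X}^k\to\mathbb{R}$ is the function given by $\psi_k(X_1,\dots,X_k)=\mathbb{E}\bigl(\psi(X_1,\dots,X_d)\mid X_1,\dots,X_k\bigr)$ (so $\psi_d=\psi$; here, if $n<\infty$ is the sample size, $d\le n$). For a subset $\alpha=\{i_1,\dots,i_k\}\subset\{1,\dots,n\}$ of size $k$, write $\psi_k(\alpha)=\psi_k(X_{i_1},\dots,X_{i_k})$. Define $$U_k=\sum_{\alpha\subset\{1,\dots,n\},\,|\alpha|=k}\psi_k(\alpha),\qquad W_k=n^{1/2}\binom{n}{k}^{-1}U_k .$$ For a symmetric non-negative definite matrix $\Sigma$, $\Sigma^{1/2}$ is its unique symmetric non-negative definite square root. For a sufficiently differentiable $h:\mathbb{R}^d\to\mathbb{R}$, $|h|_2=\sup_{i,j}\sup_{x}\left|\frac{\partial^2 h}{\partial x_i\partial x_j}(x)\right|$ and $|h|_3=\sup_{i,j,k}\sup_x\left|\frac{\partial^3 h}{\partial x_i\partial x_j\partial x_k}(x)\right|$ (values in $[0,\infty]$; the bound is vacuous if the right-hand side is infinite). *)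

theory Defs
  imports "HOL-Probability.Probability"
begin

text \<open>
  Samples and arguments are numbered from 0: \<open>X 0, \<dots>, X (n - 1)\<close> is the sample, and a point of the
  \<open>k\<close>-fold product of the sample space \<open>S\<close> is an element of \<open>space (PiM {..<k} (\<lambda>_. S))\<close>.
\<close>

definition first_obs :: "(nat \<Rightarrow> 'w \<Rightarrow> 'a) \<Rightarrow> nat \<Rightarrow> 'w \<Rightarrow> nat \<Rightarrow> 'a" where
  "first_obs X k \<omega> = (\<lambda>i\<in>{..<k}. X i \<omega>)"

definition subset_obs :: "(nat \<Rightarrow> 'w \<Rightarrow> 'a) \<Rightarrow> nat set \<Rightarrow> 'w \<Rightarrow> nat \<Rightarrow> 'a" where
  "subset_obs X \<alpha> \<omega> = (\<lambda>i\<in>{..<card \<alpha>}. X (sorted_list_of_set \<alpha> ! i) \<omega>)"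

definition symmetric_on :: "'a measure \<Rightarrow> nat \<Rightarrow> ((nat \<Rightarrow> 'a) \<Rightarrow> real) \<Rightarrow> bool" where
  "symmetric_on S d \<psi> \<longleftrightarrow>
     (\<forall>p. p permutes {..<d} \<longrightarrow>
        (\<forall>x\<in>space (PiM {..<d} (\<lambda>_. S)). \<psi> (\<lambda>i. x (p i)) = \<psi> x))"

text \<open>
  \<open>f\<close> is a version of \<open>\<psi>\<^sub>k\<close>: a measurable function of \<open>k\<close> arguments such that \<open>f\<close> of the first \<open>k\<close>
  observations is the conditional expectation of \<open>\<psi>\<close> of the first \<open>d\<close> observations given the
  first \<open>k\<close>. This determines \<open>f\<close> only up to null sets of the law of the first \<open>k\<close> observations.
\<close>

definition is_projection ::
    "'w measure \<Rightarrow> 'a measure \<Rightarrow> (nat \<Rightarrow> 'w \<Rightarrow> 'a) \<Rightarrow> nat \<Rightarrow> ((nat \<Rightarrow> 'a) \<Rightarrow> real) \<Rightarrow>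
     nat \<Rightarrow> ((nat \<Rightarrow> 'a) \<Rightarrow> real) \<Rightarrow> bool" where
  "is_projection M S X d \<psi> k f \<longleftrightarrow>
     f \<in> borel_measurable (PiM {..<k} (\<lambda>_. S)) \<and>
     (AE \<omega> in M. f (first_obs X k \<omega>) =
        real_cond_exp M (vimage_algebra (space M) (first_obs X k) (PiM {..<k} (\<lambda>_. S)))
          (\<lambda>\<omega>. \<psi> (first_obs X d \<omega>)) \<omega>)"

definition U_stat ::
    "(nat \<Rightarrow> 'w \<Rightarrow> 'a) \<Rightarrow> nat \<Rightarrow> (nat \<Rightarrow> (nat \<Rightarrow> 'a) \<Rightarrow> real) \<Rightarrow> nat \<Rightarrow> 'w \<Rightarrow> real" where
  "U_stat X n \<psi>s k \<omega> = (\<Sum>\<alpha> | \<alpha> \<subseteq> {..<n} \<and> card \<alpha> = k. \<psi>s k (subset_obs X \<alpha> \<omega>))"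

definition W_stat ::
    "(nat \<Rightarrow> 'w \<Rightarrow> 'a) \<Rightarrow> nat \<Rightarrow> (nat \<Rightarrow> (nat \<Rightarrow> 'a) \<Rightarrow> real) \<Rightarrow> nat \<Rightarrow> 'w \<Rightarrow> real" where
  "W_stat X n \<psi>s k \<omega> = sqrt (real n) * inverse (real (n choose k)) * U_stat X n \<psi>s k \<omega>"

definition second_moment_matrix :: "'w measure \<Rightarrow> ('w \<Rightarrow> real ^ 'd) \<Rightarrow> real ^ 'd ^ 'd" where
  "second_moment_matrix M W = (\<chi> i j. integral\<^sup>L M (\<lambda>\<omega>. W \<omega> $ i * W \<omega> $ j))"

definition nonneg_definite :: "real ^ 'd ^ 'd \<Rightarrow> bool" where
  "nonneg_definite A \<longleftrightarrow> transpose A = A \<and> (\<forall>x. 0 \<le> x \<bullet> (A *v x))"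

definition matrix_sqrt :: "real ^ 'd ^ 'd \<Rightarrow> real ^ 'd ^ 'd" where
  "matrix_sqrt A = (THE B. nonneg_definite B \<and> B ** B = A)"

definition standard_normal_vector :: "'v measure \<Rightarrow> ('v \<Rightarrow> real ^ 'd) \<Rightarrow> bool" where
  "standard_normal_vector N Z \<longleftrightarrow>
     prob_space N \<and>
     prob_space.indep_vars N (\<lambda>_. borel) (\<lambda>i \<omega>. Z \<omega> $ i) UNIV \<and>
     (\<forall>i. distributed N lborel (\<lambda>\<omega>. Z \<omega> $ i) std_normal_density)"

definition partial_deriv :: "'d::finite \<Rightarrow> (real ^ 'd \<Rightarrow> real) \<Rightarrow> real ^ 'd \<Rightarrow> real" where
  "partial_deriv i h x = deriv (\<lambda>t. h (x + t *\<^sub>R axis i 1)) 0"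

text \<open>
  \<open>k\<close>-fold total (Frechet) differentiability: in finite dimension the derivative of \<open>h\<close> is
  itself differentiable iff all partial derivatives of \<open>h\<close> are.
\<close>

primrec times_differentiable :: "nat \<Rightarrow> (real ^ 'd::finite \<Rightarrow> real) \<Rightarrow> bool" where
  "times_differentiable 0 h \<longleftrightarrow> True"
| "times_differentiable (Suc k) h \<longleftrightarrow>
     (\<forall>x. h differentiable (at x)) \<and> (\<forall>i. times_differentiable k (partial_deriv i h))"

definition sup_deriv2 :: "(real ^ 'd::finite \<Rightarrow> real) \<Rightarrow> ennreal" where
  "sup_deriv2 h = (SUP i. SUP j. SUP x. ennreal \<bar>partial_deriv i (partial_deriv j h) x\<bar>)"

definition sup_deriv3 :: "(real ^ 'd::finite \<Rightarrow> real) \<Rightarrow> ennreal" where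
  "sup_deriv3 h =
     (SUP i. SUP j. SUP k. SUP x.
        ennreal \<bar>partial_deriv i (partial_deriv j (partial_deriv k h)) x\<bar>)"

end

theory Submission imports Defs begin

text \<open>
  No Stein equation is needed. Write \<open>W\<^sub>k = k W\<^sub>1 + R\<^sub>k\<close>. Since
  \<open>E \<psi>\<^sub>k(\<alpha>) \<psi>\<^sub>l(\<beta>)\<close> depends only on \<open>|\<alpha> \<inter> \<beta>|\<close> and equals its linear value
  \<open>|\<alpha> \<inter> \<beta>| E \<psi>\<^sub>1\<^sup>2\<close> whenever \<open>|\<alpha> \<inter> \<beta>| \<le> 1\<close>, both \<open>E R\<^sub>k\<^sup>2\<close> and the entries of
  \<open>\<Sigma> - (k l E \<psi>\<^sub>1\<^sup>2)\<^sub>k\<^sub>l\<close> are of order \<open>1/n\<close>.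

  Hence \<open>W\<close> can be replaced by \<open>(k W\<^sub>1)\<^sub>k\<close>: the first-order term \<open>\<nabla>h(0) \<bullet> R\<close> has mean zero,
  and the rest is controlled by \<open>|h|\<^sub>2 E (|W\<^sub>1| + |R|)|R| = O(1 / sqrt n)\<close>. The vector \<open>(k W\<^sub>1)\<^sub>k\<close> is a
  sum of \<open>n\<close> independent vectors, and \<open>matrix_sqrt \<Sigma> Z\<close> is in law a sum of \<open>n\<close> independent copies of
  \<open>matrix_sqrt \<Sigma> Z / sqrt n\<close>, so the two are compared by exchanging summands one by one; the covariances of
  the summands need not match exactly, the mismatch again being of order \<open>1/n\<close> in total.
\<close>

section \<open>Square roots of nonnegative definite matrices\<close>

text \<open>The bound contains no \<open>|h|_1\<close>, so no expansion may leave a first-order term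
  with a random coefficient: this forces the gradient to be frozen at the origin in the
  linearization and the exchanged summands to be centred. Bounded second derivatives still let
  \<open>h\<close> grow quadratically, so integrability is managed on functions of quadratic growth
  and laws with finite second moment. \<open>\<Sigma>\<close> may be singular (for an additive
  kernel \<open>W_k = k W_1\<close> and it has rank one), so the Gaussian enters only as the law of
  a linear image, never through a density or an inverse. The rate of the covariance defects is a
  count: a pair \<alpha>, \<beta> deviates from its linear value only if it shares at least two
  points, the average of \<open>card (\<alpha> \<inter> \<beta>) choose 2\<close> is
  \<open>(k choose 2) (l choose 2) / (n choose 2)\<close>, at most of order
  \<open>d^4 / n^2\<close>, and the normalisation of the statistics contributes a factor
  \<open>n\<close>. With \<rho> scaled out, the linearization costs
  \<open>d^5 / sqrt n + d^6 / n\<close> times \<open>|h|_2\<close>; the exchange costs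
  \<open>d^6 / (2 n)\<close> times \<open>|h|_2\<close> and \<open>d^6 / (2 sqrt n)\<close> times
  \<open>|h|_3\<close>.\<close>

lemma selfadjoint_eigenvector:
  fixes f :: "'a::euclidean_space \<Rightarrow> 'a"
  assumes f: "linear f" and sa: "\<And>x y. f x \<bullet> y = x \<bullet> f y"
    and V: "subspace V" "\<And>x. x \<in> V \<Longrightarrow> f x \<in> V" "V \<noteq> {0}"
  shows "\<exists>u c. u \<in> V \<and> norm u = 1 \<and> f u = c *\<^sub>R u"
proof -
  interpret f: linear f by fact
  \<comment> \<open>The eigenvector will be a maximiser of the quadratic form
    \<open>x \<bullet> f x\<close> on the unit sphere of \<open>V\<close>, which is compact because
    a subspace is closed.\<close>
  let ?K = "sphere 0 1 \<inter> V"
  have K: "compact ?K" using closed_subspace[OF V(1)] by (simp add: compact_Int_closed)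
  obtain x where x: "x \<in> V" "x \<noteq> 0" using V subspace_0[OF V(1)] by blast
  then have "x /\<^sub>R norm x \<in> ?K" using V(1) by (simp add: subspace_scale)
  then have ne: "?K \<noteq> {}" by blast
  have "continuous_on ?K (\<lambda>x. x \<bullet> f x)"
    using f by (intro continuous_on_inner continuous_on_id linear_continuous_on)
      (simp add: linear_conv_bounded_linear)
  from continuous_attains_sup[OF K ne this]
  obtain u where u: "u \<in> ?K" and max: "\<And>x. x \<in> ?K \<Longrightarrow> x \<bullet> f x \<le> u \<bullet> f u"
    by blast
  define c where "c = u \<bullet> f u"
  have norm_u: "norm u = 1" and uV: "u \<in> V" using u by auto
  then have uu: "u \<bullet> u = 1" by (simp add: norm_eq_1)
  have quad: "x \<bullet> f x \<le> c * (x \<bullet> x)" if "x \<in> V" for x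
  proof (cases "x = 0")
    case False
    then have "(x /\<^sub>R norm x) \<bullet> f (x /\<^sub>R norm x) \<le> c"
      unfolding c_def using that V(1) by (intro max) (simp add: subspace_scale)
    moreover have "(x /\<^sub>R norm x) \<bullet> f (x /\<^sub>R norm x) = (x \<bullet> f x) / (norm x)\<^sup>2"
      by (simp add: f.scaleR divide_inverse power2_eq_square mult_ac)
    ultimately have "x \<bullet> f x \<le> c * (norm x)\<^sup>2" using False by (simp add: divide_le_eq mult.commute)
    then show ?thesis by (simp add: power2_norm_eq_inner)
  qed simp
  \<comment> \<open>First-order optimality: the quadratic polynomial in \<open>t\<close> is maximal at \<open>t = 0\<close>.\<close>
  have orth: "f u \<bullet> w = c * (u \<bullet> w)" if w: "w \<in> V" for w
  proof (rule ccontr)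
    define b where "b = f u \<bullet> w - c * (u \<bullet> w)"
    define a where "a = c * (w \<bullet> w) - w \<bullet> f w"
    assume "f u \<bullet> w \<noteq> c * (u \<bullet> w)"
    then have "b \<noteq> 0" by (simp add: b_def)
    have a0: "0 \<le> a" using quad[OF w] by (simp add: a_def)
    have ineq: "2 * t * b \<le> t\<^sup>2 * a" for t
    proof -
      have "(u + t *\<^sub>R w) \<bullet> f (u + t *\<^sub>R w) \<le> c * ((u + t *\<^sub>R w) \<bullet> (u + t *\<^sub>R w))"
        using V(1) uV w by (intro quad) (simp add: subspace_add subspace_scale)
      moreover have "u \<bullet> f w = f u \<bullet> w" using sa by simp
      moreover have "w \<bullet> f u = f u \<bullet> w" by (simp add: inner_commute)
      moreover have "w \<bullet> u = u \<bullet> w" by (simp add: inner_commute)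
      ultimately show ?thesis
        using uu by (simp add: f.add f.scaleR c_def[symmetric]
            a_def b_def power2_eq_square algebra_simps)
    qed
    \<comment> \<open>The \<open>+ 1\<close> keeps the quotient meaningful for \<open>a = 0\<close>.
      At \<open>t = s\<close> the inequality reads \<open>2 s^2 (a + 1) \<le> s^2 a\<close>, which
      is impossible unless \<open>s = 0\<close>.\<close>
    define s where "s = b / (a + 1)"
    have b: "b = s * (a + 1)" using a0 by (simp add: s_def)
    then have "s \<noteq> 0" using \<open>b \<noteq> 0\<close> by auto
    have "s\<^sup>2 * (a + 2) \<le> 0"
      using ineq[of s] unfolding b by (simp add: power2_eq_square algebra_simps)
    then show False using \<open>s \<noteq> 0\<close> a0 by (simp add: mult_le_0_iff)
  qed
  have "f u - c *\<^sub>R u \<in> V" using V uV by (simp add: subspace_diff subspace_scale)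
  from orth[OF this] have "(f u - c *\<^sub>R u) \<bullet> (f u - c *\<^sub>R u) = 0"
    by (simp add: inner_diff_left)
  then have "f u = c *\<^sub>R u" by simp
  with uV norm_u show ?thesis by blast
qed

theorem selfadjoint_spectral:
  fixes f :: "'a::euclidean_space \<Rightarrow> 'a"
  assumes f: "linear f" and sa: "\<And>x y. f x \<bullet> y = x \<bullet> f y"
  shows "\<exists>B c. finite B \<and> pairwise orthogonal B \<and> (\<forall>u\<in>B. norm u = 1 \<and> f u = c u *\<^sub>R u) \<and>
    (\<forall>x. x = (\<Sum>u\<in>B. (u \<bullet> x) *\<^sub>R u))"
proof -
  have "\<exists>B c. finite B \<and> pairwise orthogonal B \<and> (\<forall>u\<in>B. norm u = 1 \<and> f u = c u *\<^sub>R u) \<and>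
    (\<forall>x\<in>V. x = (\<Sum>u\<in>B. (u \<bullet> x) *\<^sub>R u)) \<and> B \<subseteq> V"
    if "subspace V" "\<And>x. x \<in> V \<Longrightarrow> f x \<in> V" for V
    using that
  proof (induction "dim V" arbitrary: V rule: less_induct)
    case less
    show ?case
    proof (cases "V = {0}")
      case True
      then show ?thesis by (intro exI[of _ "{}"]) auto
    next
      case False
      then obtain u c where u: "u \<in> V" "norm u = 1" "f u = c *\<^sub>R u"
        using selfadjoint_eigenvector[OF f sa less.prems] by blast
      then have uu: "u \<bullet> u = 1" by (simp add: norm_eq_1)
      \<comment> \<open>Invariance of the complement is where self-adjointness enters:
        \<open>u \<bullet> f x = f u \<bullet> x = c (u \<bullet> x) = 0\<close>.\<close>
      define V' where "V' = {x \<in> V. u \<bullet> x = 0}"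
      have sub: "subspace V'"
        using less.prems(1) by (auto simp: V'_def subspace_def inner_add_right)
      have inv: "f x \<in> V'" if "x \<in> V'" for x
        using that less.prems(2) sa[of u x] u by (simp add: V'_def)
      have "u \<notin> V'" using uu by (simp add: V'_def)
      then have "V' \<subset> V" using u(1) unfolding V'_def by blast
      then have "dim V' < dim V"
        using sub less.prems(1) by (intro dim_psubset) (simp add: span_eq_iff[THEN iffD2])
      from less.hyps[OF this sub inv] obtain B c' where
        B: "finite B" "pairwise orthogonal B" "\<And>w. w \<in> B \<Longrightarrow> norm w = 1 \<and> f w = c' w *\<^sub>R w"
          "\<And>x. x \<in> V' \<Longrightarrow> x = (\<Sum>u\<in>B. (u \<bullet> x) *\<^sub>R u)" "B \<subseteq> V'" by blast
      have uB: "u \<notin> B" using B(5) uu by (auto simp: V'_def)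
      have Bu: "w \<bullet> u = 0" if "w \<in> B" for w using that B(5) by (auto simp: V'_def inner_commute)
      show ?thesis
      proof (intro exI[of _ "insert u B"] exI[of _ "c'(u := c)"] conjI ballI)
        show "pairwise orthogonal (insert u B)"
          using B(2) Bu by (auto simp: pairwise_insert orthogonal_def inner_commute)
        show "insert u B \<subseteq> V" using B(5) u(1) by (auto simp: V'_def)
        show "norm w = 1" if "w \<in> insert u B" for w using that B u by auto
        show "f w = (c'(u := c)) w *\<^sub>R w" if "w \<in> insert u B" for w
          using that B u uB by auto
        fix x assume x: "x \<in> V"
        then have "x - (u \<bullet> x) *\<^sub>R u \<in> V'"
          using less.prems(1) u(1) uu by (simp add: V'_def subspace_diff subspace_scale inner_diff_right)
        then have "x - (u \<bullet> x) *\<^sub>R u = (\<Sum>w\<in>B. (w \<bullet> (x - (u \<bullet> x) *\<^sub>R u)) *\<^sub>R w)" by (rule B(4))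
        also have "\<dots> = (\<Sum>w\<in>B. (w \<bullet> x) *\<^sub>R w)"
          by (intro sum.cong) (simp_all add: inner_diff_right Bu)
        finally have "(\<Sum>w\<in>B. (w \<bullet> x) *\<^sub>R w) = x - (u \<bullet> x) *\<^sub>R u" by (rule sym)
        then show "x = (\<Sum>w\<in>insert u B. (w \<bullet> x) *\<^sub>R w)"
          using B(1) uB by simp
      qed (use B in auto)
    qed
  qed
  from this[of UNIV] show ?thesis by auto
qed

section \<open>Existence and uniqueness of the nonnegative definite square root\<close>

lemma nonneg_definite_selfadjoint:
  assumes "nonneg_definite A" shows "(A *v x) \<bullet> y = x \<bullet> (A *v y)"
proof -
  have "A *v x = x v* A" using assms transpose_matrix_vector[of A x] by (simp add: nonneg_definite_def)
  then show ?thesis by (simp add: dot_lmul_matrix)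
qed

lemma nonneg_definite_sqrt_exists:
  fixes A :: "real ^ 'd ^ 'd"
  assumes A: "nonneg_definite A"
  shows "\<exists>B. nonneg_definite B \<and> B ** B = A"
proof -
  obtain E c where E: "finite E" "pairwise orthogonal E"
    and ev: "\<And>u. u \<in> E \<Longrightarrow> norm u = 1 \<and> A *v u = c u *\<^sub>R u"
    and exp: "\<And>x. x = (\<Sum>u\<in>E. (u \<bullet> x) *\<^sub>R u)"
    using selfadjoint_spectral[OF matrix_vector_mul_linear nonneg_definite_selfadjoint[OF A]] by blast
  have c0: "0 \<le> c u" if "u \<in> E" for u
  proof -
    have "0 \<le> u \<bullet> (A *v u)" using A by (simp add: nonneg_definite_def)
    then show ?thesis using ev[OF that] by (simp add: norm_eq_1)
  qed
  \<comment> \<open>Spectral calculus: \<open>g\<close> has the same eigenvectors, with the square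
    roots of the eigenvalues; \<open>c0\<close> is what makes squaring these return
    \<open>c u\<close>.\<close>
  define g where "g x = (\<Sum>u\<in>E. (sqrt (c u) * (u \<bullet> x)) *\<^sub>R u)" for x
  have lin: "linear g"
    by (rule linearI) (simp_all add: g_def algebra_simps sum.distrib scaleR_sum_right)
  define B where "B = matrix g"
  have Bg: "B *v x = g x" for x unfolding B_def using lin by (simp add: linear_matrix_vector_mul_eq matrix_works)
  have gu: "g u = sqrt (c u) *\<^sub>R u" if u: "u \<in> E" for u
  proof -
    have "g u = (\<Sum>w\<in>E. if w = u then sqrt (c u) *\<^sub>R u else 0)"
      unfolding g_def using u E(2) ev[OF u]
      by (intro sum.cong) (auto simp: pairwise_def orthogonal_def norm_eq_1)
    then show ?thesis using E(1) u by simp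
  qed
  have gg: "g (g x) = A *v x" for x
  proof -
    have "g (g x) = (\<Sum>u\<in>E. (sqrt (c u) * (u \<bullet> x)) *\<^sub>R g u)"
      unfolding g_def[of x] by (simp add: linear_sum[OF lin] linear_scale[OF lin])
    also have "\<dots> = (\<Sum>u\<in>E. (u \<bullet> x) *\<^sub>R (A *v u))"
    proof (rule sum.cong[OF refl])
      fix u assume u: "u \<in> E"
      have "sqrt (c u) * (u \<bullet> x) * sqrt (c u) = (u \<bullet> x) * (sqrt (c u) * sqrt (c u))"
        by (simp only: mult_ac)
      then show "(sqrt (c u) * (u \<bullet> x)) *\<^sub>R g u = (u \<bullet> x) *\<^sub>R (A *v u)"
        using gu[OF u] ev[OF u] c0[OF u] by simp
    qed
    also have "\<dots> = A *v (\<Sum>u\<in>E. (u \<bullet> x) *\<^sub>R u)"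
      by (simp only: linear_sum[OF matrix_vector_mul_linear] linear_scale[OF matrix_vector_mul_linear])
    also have "\<dots> = A *v x" by (rule arg_cong[OF exp[symmetric]])
    finally show ?thesis .
  qed
  have sym: "g x \<bullet> y = x \<bullet> g y" for x y
    by (simp add: g_def inner_sum_left inner_sum_right inner_commute[of x] mult_ac)
  have "transpose B = B"
  proof -
    have "transpose B *v x = B *v x" for x
    proof (rule vector_eq_ldot[THEN iffD1], rule allI)
      fix y
      show "y \<bullet> (transpose B *v x) = y \<bullet> (B *v x)"
        using dot_lmul_matrix[of x B y] sym[of x y] by (simp add: Bg inner_commute[of y])
    qed
    then show ?thesis by (simp add: matrix_eq)
  qed
  moreover have "0 \<le> x \<bullet> (B *v x)" for x
    unfolding Bg g_def inner_sum_right using c0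
    by (auto intro!: sum_nonneg simp: inner_commute[of x] mult.assoc)
  moreover have "B ** B = A"
    by (simp add: matrix_eq matrix_vector_mul_assoc[symmetric] Bg gg)
  ultimately show ?thesis by (auto simp: nonneg_definite_def)
qed

text \<open>Diagonalising the difference \<open>B - C\<close> avoids a simultaneous diagonalisation.
  For a unit eigenvector \<open>u\<close> with eigenvalue \<open>c\<close>, equal squares give
  \<open>|B u| = |C u|\<close>, that is \<open>(B - C) u \<bullet> (B + C) u = 0\<close>, hence
  \<open>c (u \<bullet> B u + u \<bullet> C u) = 0\<close>. If \<open>c\<close> were nonzero, both
  nonnegative forms would vanish at \<open>u\<close>, and then so would
  \<open>c = u \<bullet> (B - C) u\<close>.\<close>

lemma nonneg_definite_sqrt_unique:
  fixes B C :: "real ^ 'd ^ 'd"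
  assumes B: "nonneg_definite B" and C: "nonneg_definite C" and eq: "B ** B = C ** C"
  shows "B = C"
proof -
  note saB = nonneg_definite_selfadjoint[OF B] and saC = nonneg_definite_selfadjoint[OF C]
  have "\<exists>E c. finite E \<and> pairwise orthogonal E \<and> (\<forall>u\<in>E. norm u = 1 \<and> (B - C) *v u = c u *\<^sub>R u) \<and>
    (\<forall>x. x = (\<Sum>u\<in>E. (u \<bullet> x) *\<^sub>R u))"
    by (rule selfadjoint_spectral[OF matrix_vector_mul_linear])
      (simp add: matrix_vector_mult_diff_rdistrib inner_diff_left inner_diff_right saB saC)
  then obtain E c where E: "finite E"
    and ev: "\<And>u. u \<in> E \<Longrightarrow> norm u = 1 \<and> (B - C) *v u = c u *\<^sub>R u"
    and exp: "\<And>x. x = (\<Sum>u\<in>E. (u \<bullet> x) *\<^sub>R u)" by blast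
  have "c u = 0" if u: "u \<in> E" for u
  proof (rule ccontr)
    assume c: "c u \<noteq> 0"
    have uu: "u \<bullet> u = 1" using ev[OF u] by (simp add: norm_eq_1)
    have BC: "B *v u - C *v u = c u *\<^sub>R u"
      using ev[OF u] by (simp add: matrix_vector_mult_diff_rdistrib)
    have "(B *v u) \<bullet> (B *v u) = (C *v u) \<bullet> (C *v u)"
      unfolding saB saC matrix_vector_mul_assoc eq ..
    then have "(B *v u - C *v u) \<bullet> (B *v u + C *v u) = 0"
      by (simp add: inner_diff_left inner_add_right inner_commute[of "C *v u" "B *v u"])
    then have "c u * (u \<bullet> (B *v u) + u \<bullet> (C *v u)) = 0"
      by (simp add: BC inner_add_right algebra_simps)
    moreover have "0 \<le> u \<bullet> (B *v u)" "0 \<le> u \<bullet> (C *v u)"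
      using B C by (auto simp: nonneg_definite_def)
    ultimately have "u \<bullet> (B *v u) = 0" "u \<bullet> (C *v u) = 0" using c by auto
    then have "u \<bullet> (B *v u - C *v u) = 0" by (simp add: inner_diff_right)
    then show False using BC c uu by simp
  qed
  then have ev0: "(B - C) *v u = 0" if "u \<in> E" for u using ev that by simp
  have "(B - C) *v x = 0" for x
  proof -
    have "(B - C) *v x = (B - C) *v (\<Sum>u\<in>E. (u \<bullet> x) *\<^sub>R u)" by (rule arg_cong[OF exp])
    also have "\<dots> = (\<Sum>u\<in>E. (u \<bullet> x) *\<^sub>R ((B - C) *v u))"
      by (simp only: linear_sum[OF matrix_vector_mul_linear] linear_scale[OF matrix_vector_mul_linear])
    also have "\<dots> = 0" by (simp add: ev0)
    finally show ?thesis .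
  qed
  then show ?thesis by (simp add: matrix_eq matrix_vector_mult_diff_rdistrib)
qed

lemma matrix_sqrt_works:
  assumes "nonneg_definite A"
  shows "nonneg_definite (matrix_sqrt A)" "matrix_sqrt A ** matrix_sqrt A = A"
proof -
  have "\<exists>!B. nonneg_definite B \<and> B ** B = A"
    using nonneg_definite_sqrt_exists[OF assms] nonneg_definite_sqrt_unique by metis
  then have "nonneg_definite (matrix_sqrt A) \<and> matrix_sqrt A ** matrix_sqrt A = A"
    unfolding matrix_sqrt_def by (rule theI')
  then show "nonneg_definite (matrix_sqrt A)" "matrix_sqrt A ** matrix_sqrt A = A" by auto
qed

section \<open>Taylor expansion\<close>

text \<open>This norm is dual to the entrywise suprema \<open>|h|_2\<close> and
  \<open>|h|_3\<close>: a derivative of order m with entries bounded by L costs exactly L times the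
  m-th power of \<open>l1\<close>, with no dimensional factor.\<close>

abbreviation l1 :: "real ^ 'd::finite \<Rightarrow> real" where
  "l1 y \<equiv> (\<Sum>i\<in>UNIV. \<bar>y $ i\<bar>)"

text \<open>\<open>partial_deriv\<close> is built on the total operator \<open>deriv\<close>, which
  says nothing at points of non-differentiability. Total differentiability identifies it with the
  Frechet derivative on the axes, and linearity then yields every direction.\<close>

lemma has_real_derivative_along_line:
  fixes f :: "real ^ 'd::finite \<Rightarrow> real"
  assumes "f differentiable (at (x + t *\<^sub>R y))"
  shows "((\<lambda>t. f (x + t *\<^sub>R y)) has_real_derivative
    (\<Sum>i\<in>UNIV. partial_deriv i f (x + t *\<^sub>R y) * y $ i)) (at t)"
proof -
  let ?p = "x + t *\<^sub>R y"
  obtain D where D: "(f has_derivative D) (at ?p)"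
    using assms by (auto simp: differentiable_def)
  interpret D: bounded_linear D using D by (rule has_derivative_bounded_linear)
  have line: "((\<lambda>s. f (p + s *\<^sub>R z)) has_real_derivative D z) (at s)"
    if "p + s *\<^sub>R z = ?p" for p z s
  proof -
    have "((\<lambda>s. p + s *\<^sub>R z) has_derivative (\<lambda>s. s *\<^sub>R z)) (at s)"
      by (auto intro!: derivative_eq_intros)
    moreover have "(f has_derivative D) (at (p + s *\<^sub>R z))" using D that by simp
    ultimately have "((\<lambda>s. f (p + s *\<^sub>R z)) has_derivative (\<lambda>s. D (s *\<^sub>R z))) (at s)"
      by (rule has_derivative_compose[where g = f])
    then show ?thesis
      by (simp add: has_field_derivative_def D.scaleR mult_commute_abs)
  qed
  have "partial_deriv i f ?p = D (axis i 1)" for i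
    unfolding partial_deriv_def by (rule DERIV_imp_deriv, rule line) simp
  moreover have "D y = (\<Sum>i\<in>UNIV. D (axis i 1) * y $ i)"
  proof -
    have "D y = D (\<Sum>i\<in>UNIV. (y $ i) *\<^sub>R axis i 1)"
      using basis_expansion[of y] by (simp add: scalar_mult_eq_scaleR)
    also have "\<dots> = (\<Sum>i\<in>UNIV. D (axis i 1) * y $ i)"
      by (simp add: D.sum D.scaleR mult.commute)
    finally show ?thesis .
  qed
  ultimately show ?thesis using line[of x t y] by simp
qed

lemma times_differentiable_3_differentiable:
  assumes "times_differentiable 3 h"
  shows "h differentiable (at x)" "partial_deriv i h differentiable (at x)"
    "partial_deriv i (partial_deriv j h) differentiable (at x)"
  using assms by (auto simp: numeral_3_eq_3)

lemma abs_sum_mult_le: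
  fixes y :: "real ^ 'd::finite"
  assumes "\<And>i. \<bar>a i\<bar> \<le> B"
  shows "\<bar>\<Sum>i\<in>UNIV. a i * y $ i\<bar> \<le> B * l1 y"
  unfolding sum_distrib_left
  by (rule order_trans[OF sum_abs]) (auto intro!: sum_mono mult_right_mono assms simp: abs_mult)

lemma taylor3:
  fixes h :: "real ^ 'd::finite \<Rightarrow> real"
  assumes h: "times_differentiable 3 h"
    and L3: "\<And>i j k x. \<bar>partial_deriv i (partial_deriv j (partial_deriv k h)) x\<bar> \<le> L3"
  shows "\<bar>h (x + y) - (h x + (\<Sum>k\<in>UNIV. partial_deriv k h x * y $ k) +
    (\<Sum>k\<in>UNIV. \<Sum>j\<in>UNIV. partial_deriv j (partial_deriv k h) x * (y $ j * y $ k)) / 2)\<bar>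
    \<le> L3 / 6 * l1 y ^ 3"
proof -
  define g0 where "g0 t = h (x + t *\<^sub>R y)" for t
  define g1 where "g1 t = (\<Sum>k\<in>UNIV. partial_deriv k h (x + t *\<^sub>R y) * y $ k)" for t
  define g2 where "g2 t = (\<Sum>k\<in>UNIV. (\<Sum>j\<in>UNIV. partial_deriv j (partial_deriv k h) (x + t *\<^sub>R y) * y $ j) * y $ k)" for t
  define g3 where "g3 t = (\<Sum>k\<in>UNIV. (\<Sum>j\<in>UNIV. (\<Sum>i\<in>UNIV. partial_deriv i (partial_deriv j (partial_deriv k h)) (x + t *\<^sub>R y) * y $ i) * y $ j) * y $ k)" for t
  note diff = times_differentiable_3_differentiable[OF h]
  have 0: "(g0 has_real_derivative g1 t) (at t)" for t
    unfolding g0_def g1_def by (rule has_real_derivative_along_line[OF diff(1)])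
  have 1: "(g1 has_real_derivative g2 t) (at t)" for t
    unfolding g1_def g2_def
    by (intro DERIV_sum DERIV_cmult_right has_real_derivative_along_line diff)
  have 2: "(g2 has_real_derivative g3 t) (at t)" for t
    unfolding g2_def g3_def
    by (intro DERIV_sum DERIV_cmult_right has_real_derivative_along_line diff)
  define dg where "dg m = (if m = 0 then g0 else if m = 1 then g1 else if m = 2 then g2 else g3)" for m :: nat
  have "\<exists>t>0. t < 1 \<and> g0 1 = (\<Sum>m<3. dg m 0 / fact m * 1 ^ m) + dg 3 t / fact 3 * 1 ^ 3"
  proof (rule Maclaurin)
    show "\<forall>m t. m < 3 \<and> 0 \<le> t \<and> t \<le> 1 \<longrightarrow> DERIV (dg m) t :> dg (Suc m) t"
      using 0 1 2 by (auto simp: dg_def less_Suc_eq numeral_3_eq_3)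
  qed (auto simp: dg_def)
  then obtain t where t: "g0 1 = g0 0 + g1 0 + g2 0 / 2 + g3 t / 6"
    by (auto simp: dg_def numeral_3_eq_3 fact_numeral)
  have g3: "\<bar>g3 t\<bar> \<le> (L3 * l1 y * l1 y) * l1 y"
    unfolding g3_def by (intro abs_sum_mult_le L3)
  have "g2 0 = (\<Sum>k\<in>UNIV. \<Sum>j\<in>UNIV. partial_deriv j (partial_deriv k h) x * (y $ j * y $ k))"
    by (simp add: g2_def sum_distrib_right mult.assoc)
  moreover have "g1 0 = (\<Sum>k\<in>UNIV. partial_deriv k h x * y $ k)" by (simp add: g1_def)
  ultimately have eq: "h (x + y) - (h x + (\<Sum>k\<in>UNIV. partial_deriv k h x * y $ k) +
    (\<Sum>k\<in>UNIV. \<Sum>j\<in>UNIV. partial_deriv j (partial_deriv k h) x * (y $ j * y $ k)) / 2) = g3 t / 6"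
    using t by (simp add: g0_def)
  show ?thesis unfolding eq using g3 by (simp add: power3_eq_cube mult.assoc)
qed

text \<open>Two applications of the mean value theorem. Taking the gradient at 0 instead of at
  \<open>x\<close> makes the linear term a fixed functional of \<open>y\<close>, so it integrates to
  zero for centred \<open>y\<close> even when \<open>x\<close> and \<open>y\<close> are dependent;
  the price is the extra factor \<open>l1 x\<close>.\<close>

lemma taylor1:
  fixes h :: "real ^ 'd::finite \<Rightarrow> real"
  assumes h: "times_differentiable 3 h"
    and L2: "\<And>i j x. \<bar>partial_deriv i (partial_deriv j h) x\<bar> \<le> L2"
  shows "\<bar>h (x + y) - h x - (\<Sum>k\<in>UNIV. partial_deriv k h 0 * y $ k)\<bar>
    \<le> L2 * (l1 x + l1 y) * l1 y"
proof -
  note diff = times_differentiable_3_differentiable[OF h]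
  have L2_0: "0 \<le> L2" using L2[of undefined undefined 0] by linarith
  have grad: "\<bar>partial_deriv k h z - partial_deriv k h 0\<bar> \<le> L2 * l1 z" for k z
  proof -
    obtain t :: real where "partial_deriv k h (0 + 1 *\<^sub>R z) - partial_deriv k h (0 + 0 *\<^sub>R z)
      = (1 - 0) * (\<Sum>j\<in>UNIV. partial_deriv j (partial_deriv k h) (0 + t *\<^sub>R z) * z $ j)"
      using MVT2[of 0 1 "\<lambda>t. partial_deriv k h (0 + t *\<^sub>R z)"
        "\<lambda>t. \<Sum>j\<in>UNIV. partial_deriv j (partial_deriv k h) (0 + t *\<^sub>R z) * z $ j"]
        has_real_derivative_along_line[OF diff(2)] by fastforce
    then show ?thesis by (simp add: abs_sum_mult_le L2)
  qed
  obtain t :: real where t: "0 < t" "t < 1" "h (x + 1 *\<^sub>R y) - h (x + 0 *\<^sub>R y)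
      = (1 - 0) * (\<Sum>j\<in>UNIV. partial_deriv j h (x + t *\<^sub>R y) * y $ j)"
    using MVT2[of 0 1 "\<lambda>t. h (x + t *\<^sub>R y)"
        "\<lambda>t. \<Sum>j\<in>UNIV. partial_deriv j h (x + t *\<^sub>R y) * y $ j"]
        has_real_derivative_along_line[OF diff(1)] by fastforce
  have "l1 (x + t *\<^sub>R y) \<le> l1 x + l1 y"
    unfolding sum.distrib[symmetric]
  proof (rule sum_mono)
    fix i
    have "\<bar>t * y $ i\<bar> \<le> \<bar>y $ i\<bar>" using t by (simp add: abs_mult mult_left_le_one_le)
    then show "\<bar>(x + t *\<^sub>R y) $ i\<bar> \<le> \<bar>x $ i\<bar> + \<bar>y $ i\<bar>" by simp
  qed
  then have "\<bar>partial_deriv k h (x + t *\<^sub>R y) - partial_deriv k h 0\<bar> \<le> L2 * (l1 x + l1 y)" for k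
    by (rule order_trans[OF grad mult_left_mono[OF _ L2_0]])
  then have "\<bar>\<Sum>k\<in>UNIV. (partial_deriv k h (x + t *\<^sub>R y) - partial_deriv k h 0) * y $ k\<bar>
    \<le> L2 * (l1 x + l1 y) * l1 y" by (rule abs_sum_mult_le)
  then show ?thesis using t by (simp add: left_diff_distrib sum_subtractf)
qed

text \<open>The class contains every \<open>h\<close> with bounded second partial derivatives, is
  integrable against every law with a second moment, and is preserved by convolution with such
  laws.\<close>

definition quadratic_growth :: "('a::{real_normed_vector} \<Rightarrow> real) \<Rightarrow> bool" where
  "quadratic_growth f \<longleftrightarrow> f \<in> borel_measurable borel \<and> (\<exists>C\<ge>0. \<forall>x. \<bar>f x\<bar> \<le> C * (1 + norm x ^ 2))"

lemma quadratic_growth_bounded_deriv2: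
  fixes h :: "real ^ 'd::finite \<Rightarrow> real"
  assumes h: "times_differentiable 3 h"
    and L2: "\<And>i j x. \<bar>partial_deriv i (partial_deriv j h) x\<bar> \<le> L2"
  shows "quadratic_growth h"
  unfolding quadratic_growth_def
proof (intro conjI exI allI)
  show "h \<in> borel_measurable borel"
    by (intro borel_measurable_continuous_onI differentiable_imp_continuous_on)
      (simp add: differentiable_on_def times_differentiable_3_differentiable(1)[OF h])
  have L2_0: "0 \<le> L2" using L2[of undefined undefined 0] by linarith
  let ?d = "real CARD('d)"
  define G where "G = (\<Sum>k\<in>UNIV. \<bar>partial_deriv k h 0\<bar>)"
  have G: "\<bar>partial_deriv k h 0\<bar> \<le> G" for k unfolding G_def by (rule member_le_sum) auto
  then have G0: "0 \<le> G" by (meson abs_ge_zero order_trans)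
  show "0 \<le> \<bar>h 0\<bar> + G * ?d + L2 * ?d\<^sup>2" using G0 L2_0 by simp
  fix x :: "real ^ 'd"
  have l1: "l1 x \<le> ?d * norm x"
    using sum_mono[of UNIV "\<lambda>i. \<bar>x $ i\<bar>" "\<lambda>i. norm x"] by (simp add: component_le_norm_cart)
  have l1_0: "0 \<le> l1 x" by (simp add: sum_nonneg)
  have "\<bar>h x - h 0 - (\<Sum>k\<in>UNIV. partial_deriv k h 0 * x $ k)\<bar> \<le> L2 * l1 x * l1 x"
    using taylor1[OF h L2, of 0 x] by simp
  moreover have "\<bar>\<Sum>k\<in>UNIV. partial_deriv k h 0 * x $ k\<bar> \<le> G * l1 x"
    by (rule abs_sum_mult_le[OF G])
  ultimately have "\<bar>h x\<bar> \<le> \<bar>h 0\<bar> + G * l1 x + L2 * (l1 x * l1 x)" by (simp add: mult.assoc)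
  also have "\<dots> \<le> \<bar>h 0\<bar> + G * (?d * norm x) + L2 * ((?d * norm x) * (?d * norm x))"
    by (intro add_mono mult_left_mono mult_mono l1 G0 L2_0 l1_0) auto
  also have "\<dots> = \<bar>h 0\<bar> + G * ?d * norm x + L2 * ?d\<^sup>2 * norm x ^ 2"
    by (simp add: power2_eq_square mult_ac)
  also have "\<dots> \<le> \<bar>h 0\<bar> * (1 + norm x ^ 2) + G * ?d * (1 + norm x ^ 2) + L2 * ?d\<^sup>2 * (1 + norm x ^ 2)"
  proof (intro add_mono mult_left_mono)
    have "0 \<le> (norm x - 1)^2" by simp
    then have "2 * norm x \<le> 1 + norm x ^ 2" unfolding power2_diff by simp
    then show "norm x \<le> 1 + norm x ^ 2" using norm_ge_zero[of x] by linarith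
  qed (use G0 L2_0 in \<open>simp_all add: mult_left_le\<close>, simp add: distrib_left)
  also have "\<dots> = (\<bar>h 0\<bar> + G * ?d + L2 * ?d\<^sup>2) * (1 + norm x ^ 2)" by (simp add: algebra_simps)
  finally show "\<bar>h x\<bar> \<le> (\<bar>h 0\<bar> + G * ?d + L2 * ?d\<^sup>2) * (1 + norm x ^ 2)" .
qed

section \<open>Lindeberg replacement\<close>

lemma norm_add_sq_le: "norm (x + y) ^ 2 \<le> 2 * norm x ^ 2 + 2 * norm (y::'a::real_normed_vector) ^ 2"
proof -
  have "norm (x + y) ^ 2 \<le> (norm x + norm y) ^ 2" by (intro power_mono norm_triangle_ineq) auto
  also have "\<dots> \<le> 2 * norm x ^ 2 + 2 * norm y ^ 2"
    using sum_squares_bound[of "norm x" "norm y"] by (simp add: power2_sum)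
  finally show ?thesis .
qed

lemma quadratic_growth_shift:
  fixes f :: "'a::euclidean_space \<Rightarrow> real"
  assumes "quadratic_growth f"
  shows "quadratic_growth (\<lambda>y. f (x + y))"
proof -
  obtain C where [measurable]: "f \<in> borel_measurable borel" and C: "0 \<le> C" "\<And>x. \<bar>f x\<bar> \<le> C * (1 + norm x ^ 2)"
    using assms by (auto simp: quadratic_growth_def)
  have "\<bar>f (x + y)\<bar> \<le> C * (2 + 2 * norm x ^ 2) * (1 + norm y ^ 2)" for y
  proof -
    have "1 + norm (x + y) ^ 2 \<le> (2 + 2 * norm x ^ 2) * (1 + norm y ^ 2)"
    proof -
      have "(2 + 2 * norm x ^ 2) * (1 + norm y ^ 2) = 2 + 2 * norm x ^ 2 + 2 * norm y ^ 2 + 2 * (norm x ^ 2 * norm y ^ 2)"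
        by (simp add: algebra_simps)
      moreover have "0 \<le> norm x ^ 2 * norm y ^ 2" by simp
      ultimately show ?thesis using norm_add_sq_le[of x y] by linarith
    qed
    then show ?thesis using C(2)[of "x + y"] C(1)
      by (smt (verit) mult.assoc mult_left_mono)
  qed
  moreover have "(\<lambda>y. f (x + y)) \<in> borel_measurable borel" by measurable
  ultimately show ?thesis using C(1)
    unfolding quadratic_growth_def by (intro conjI exI[of _ "C * (2 + 2 * norm x ^ 2)"]) auto
qed

lemma (in prob_space) quadratic_growth_integrable:
  fixes f :: "'b::euclidean_space \<Rightarrow> real"
  assumes "quadratic_growth f" and [measurable]: "Y \<in> borel_measurable M"
    and Y: "integrable M (\<lambda>\<omega>. norm (Y \<omega>) ^ 2)"
  shows "integrable M (\<lambda>\<omega>. f (Y \<omega>))"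
proof -
  obtain C where [measurable]: "f \<in> borel_measurable borel" and C: "0 \<le> C" "\<And>x. \<bar>f x\<bar> \<le> C * (1 + norm x ^ 2)"
    using assms(1) by (auto simp: quadratic_growth_def)
  show ?thesis
    by (rule Bochner_Integration.integrable_bound[where f = "\<lambda>\<omega>. C * (1 + norm (Y \<omega>) ^ 2)"])
      (use Y C in \<open>auto intro: order_trans[OF C(2)]\<close>)
qed

text \<open>This is \<open>E f (x + Y)\<close> for \<open>Y\<close> of law \<mu>. Since iterates of
  it represent sums of independent variables, the exchange of summands becomes an identity between
  operators and needs no joint probability space for the two families.\<close>

definition conv_op :: "'a::euclidean_space measure \<Rightarrow> ('a \<Rightarrow> real) \<Rightarrow> 'a \<Rightarrow> real" where
  "conv_op \<mu> f x = integral\<^sup>L \<mu> (\<lambda>y. f (x + y))"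

locale square_integrable_law = prob_space \<mu> for \<mu> :: "'a::euclidean_space measure" +
  assumes sets_eq [measurable_cong, simp]: "sets \<mu> = sets borel"
    and sq_integrable: "integrable \<mu> (\<lambda>y. norm y ^ 2)"
begin

lemma integrable_shift:
  assumes "quadratic_growth f"
  shows "integrable \<mu> (\<lambda>y. f (x + y))"
  by (rule quadratic_growth_integrable[OF quadratic_growth_shift[OF assms], of "\<lambda>y. y"])
    (simp_all add: sq_integrable)

lemma quadratic_growth_conv_op:
  assumes f: "quadratic_growth f"
  shows "quadratic_growth (conv_op \<mu> f)"
proof -
  obtain C where [measurable]: "f \<in> borel_measurable borel" and C: "0 \<le> C" "\<And>x. \<bar>f x\<bar> \<le> C * (1 + norm x ^ 2)"
    using f by (auto simp: quadratic_growth_def)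
  define m where "m = integral\<^sup>L \<mu> (\<lambda>y. norm y ^ 2)"
  have m0: "0 \<le> m" unfolding m_def by (rule integral_nonneg_AE) simp
  have "\<bar>conv_op \<mu> f x\<bar> \<le> C * (2 + 2 * m) * (1 + norm x ^ 2)" for x
  proof -
    have "\<bar>conv_op \<mu> f x\<bar> \<le> integral\<^sup>L \<mu> (\<lambda>y. \<bar>f (x + y)\<bar>)"
      unfolding conv_op_def by (rule integral_abs_bound)
    also have "\<dots> \<le> integral\<^sup>L \<mu> (\<lambda>y. C * (1 + (2 * norm x ^ 2 + 2 * norm y ^ 2)))"
    proof (rule integral_mono)
      fix y
      show "\<bar>f (x + y)\<bar> \<le> C * (1 + (2 * norm x ^ 2 + 2 * norm y ^ 2))"
        by (rule order_trans[OF C(2)]) (intro mult_left_mono add_left_mono norm_add_sq_le C(1))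
    qed (use integrable_shift[OF f] sq_integrable in auto)
    also have "\<dots> = C * (1 + (2 * norm x ^ 2 + 2 * m))"
      using sq_integrable by (simp add: m_def prob_space)
    also have "\<dots> \<le> C * ((2 + 2 * m) * (1 + norm x ^ 2))"
      using m0 C(1) by (intro mult_left_mono) (simp_all add: algebra_simps)
    finally show ?thesis by (simp add: mult.assoc)
  qed
  moreover have "conv_op \<mu> f \<in> borel_measurable borel"
    unfolding conv_op_def[abs_def] by measurable
  ultimately show ?thesis using C(1) m0
    unfolding quadratic_growth_def by (intro conjI exI[of _ "C * (2 + 2 * m)"]) auto
qed

lemma quadratic_growth_conv_op_funpow:
  "quadratic_growth f \<Longrightarrow> quadratic_growth ((conv_op \<mu> ^^ m) f)"
  by (induction m) (auto intro: quadratic_growth_conv_op)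

text \<open>Averaging is a contraction for the supremum distance. The statement is about differences
  because \<open>f\<close> and \<open>g\<close> themselves are unbounded.\<close>

lemma conv_op_diff_le:
  assumes f: "quadratic_growth f" and g: "quadratic_growth g" and le: "\<And>x. \<bar>f x - g x\<bar> \<le> e"
  shows "\<bar>conv_op \<mu> f x - conv_op \<mu> g x\<bar> \<le> e"
proof -
  have "conv_op \<mu> f x - conv_op \<mu> g x = integral\<^sup>L \<mu> (\<lambda>y. f (x + y) - g (x + y))"
    unfolding conv_op_def using integrable_shift[OF f] integrable_shift[OF g] by simp
  also have "\<bar>\<dots>\<bar> \<le> integral\<^sup>L \<mu> (\<lambda>y. \<bar>f (x + y) - g (x + y)\<bar>)" by (rule integral_abs_bound)
  also have "\<dots> \<le> integral\<^sup>L \<mu> (\<lambda>y. e)"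
    by (rule integral_mono) (use integrable_shift[OF f] integrable_shift[OF g] le in auto)
  finally show ?thesis by (simp add: prob_space)
qed

end

lemma (in prob_space) square_integrable_law_distr:
  fixes Y :: "'a \<Rightarrow> 'b::euclidean_space"
  assumes [measurable]: "Y \<in> borel_measurable M" and "integrable M (\<lambda>\<omega>. norm (Y \<omega>) ^ 2)"
  shows "square_integrable_law (distr M borel Y)"
  using assms prob_space_distr[OF assms(1)]
  by (simp add: square_integrable_law_def square_integrable_law_axioms_def integrable_distr_eq)

text \<open>Fubini; its integrability condition follows from the second moments of the two
  marginals, since the square of a sum is at most twice the sum of the squares.\<close>

lemma conv_op_conv_op:
  assumes "square_integrable_law \<mu>" "square_integrable_law \<nu>" and f: "quadratic_growth f"
  shows "integrable (\<mu> \<Otimes>\<^sub>M \<nu>) (\<lambda>p. f (x + fst p + snd p))"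
    and "conv_op \<mu> (conv_op \<nu> f) x = integral\<^sup>L (\<mu> \<Otimes>\<^sub>M \<nu>) (\<lambda>p. f (x + fst p + snd p))"
proof -
  interpret mu: square_integrable_law \<mu> by fact
  interpret nu: square_integrable_law \<nu> by fact
  interpret P: pair_prob_space \<mu> \<nu> ..
  have fst: "integrable (\<mu> \<Otimes>\<^sub>M \<nu>) (\<lambda>p. norm (fst p) ^ 2)"
    using integrable_distr[OF measurable_fst, of \<mu> \<nu> "\<lambda>y. norm y ^ 2"]
    by (simp add: nu.distr_pair_fst mu.sq_integrable)
  have snd: "integrable (\<mu> \<Otimes>\<^sub>M \<nu>) (\<lambda>p. norm (snd p) ^ 2)"
  proof -
    interpret Q: pair_sigma_finite \<nu> \<mu> ..
    have "integrable (\<nu> \<Otimes>\<^sub>M \<mu>) (\<lambda>p. norm (fst p) ^ 2)"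
      using integrable_distr[OF measurable_fst, of \<nu> \<mu> "\<lambda>y. norm y ^ 2"]
      by (simp add: mu.distr_pair_fst nu.sq_integrable)
    from Q.integrable_product_swap[OF this] show ?thesis by (simp add: case_prod_beta')
  qed
  have "integrable (\<mu> \<Otimes>\<^sub>M \<nu>) (\<lambda>p. norm (fst p + snd p) ^ 2)"
    by (rule Bochner_Integration.integrable_bound[where f = "\<lambda>p. 2 * norm (fst p) ^ 2 + 2 * norm (snd p) ^ 2"])
      (use fst snd norm_add_sq_le in auto)
  then have "integrable (\<mu> \<Otimes>\<^sub>M \<nu>) (\<lambda>p. f (x + (fst p + snd p)))"
    by (intro P.quadratic_growth_integrable[OF quadratic_growth_shift[OF f]]) auto
  then show int: "integrable (\<mu> \<Otimes>\<^sub>M \<nu>) (\<lambda>p. f (x + fst p + snd p))" by (simp add: add.assoc)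
  show "conv_op \<mu> (conv_op \<nu> f) x = integral\<^sup>L (\<mu> \<Otimes>\<^sub>M \<nu>) (\<lambda>p. f (x + fst p + snd p))"
    unfolding conv_op_def using P.integral_fst'[OF int] by simp
qed

lemma conv_op_commute:
  assumes mu: "square_integrable_law \<mu>" and nu: "square_integrable_law \<nu>" and f: "quadratic_growth f"
  shows "conv_op \<mu> (conv_op \<nu> f) = conv_op \<nu> (conv_op \<mu> f)"
proof
  fix x
  interpret mu: square_integrable_law \<mu> by fact
  interpret nu: square_integrable_law \<nu> by fact
  interpret P: pair_sigma_finite \<mu> \<nu> ..
  have [measurable]: "f \<in> borel_measurable borel" using f by (simp add: quadratic_growth_def)
  have "conv_op \<mu> (conv_op \<nu> f) x = integral\<^sup>L (\<mu> \<Otimes>\<^sub>M \<nu>) (\<lambda>p. f (x + fst p + snd p))"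
    by (rule conv_op_conv_op(2)[OF mu nu f])
  also have "\<dots> = integral\<^sup>L (\<nu> \<Otimes>\<^sub>M \<mu>) (\<lambda>(y, z). f (x + fst (z, y) + snd (z, y)))"
    by (rule P.integral_product_swap[symmetric]) measurable
  also have "\<dots> = integral\<^sup>L (\<nu> \<Otimes>\<^sub>M \<mu>) (\<lambda>p. f (x + fst p + snd p))"
    by (simp add: case_prod_beta' ac_simps)
  also have "\<dots> = conv_op \<nu> (conv_op \<mu> f) x"
    by (rule conv_op_conv_op(2)[OF nu mu f, symmetric])
  finally show "conv_op \<mu> (conv_op \<nu> f) x = conv_op \<nu> (conv_op \<mu> f) x" .
qed

lemma conv_op_funpow_commute:
  assumes mu: "square_integrable_law \<mu>" and nu: "square_integrable_law \<nu>" and f: "quadratic_growth f"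
  shows "(conv_op \<nu> ^^ m) (conv_op \<mu> f) = conv_op \<mu> ((conv_op \<nu> ^^ m) f)"
  by (induction m)
    (simp_all add: conv_op_commute[OF mu nu] square_integrable_law.quadratic_growth_conv_op_funpow[OF nu f])

lemma conv_op_funpow_diff_le:
  assumes nu: "square_integrable_law \<nu>" and f: "quadratic_growth f" and g: "quadratic_growth g"
    and le: "\<And>x. \<bar>f x - g x\<bar> \<le> e"
  shows "\<bar>(conv_op \<nu> ^^ m) f x - (conv_op \<nu> ^^ m) g x\<bar> \<le> e"
  by (induction m arbitrary: x)
    (simp_all add: le square_integrable_law.conv_op_diff_le[OF nu] square_integrable_law.quadratic_growth_conv_op_funpow[OF nu] f g)

text \<open>Telescoping with \<open>P = conv_op \<mu>\<close>, \<open>Q = conv_op \<nu>\<close>: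
  \<open>P^(m+1) - Q^(m+1) = P (P^m - Q^m) + Q^m (P - Q)\<close>, where commutation of
  \<open>P\<close> and \<open>Q\<close> is needed to write \<open>P Q^m\<close> as
  \<open>Q^m P\<close>. Contraction reduces each of the m + 1 differences to the one-step
  bound.\<close>

lemma conv_op_lindeberg:
  assumes mu: "square_integrable_law \<mu>" and nu: "square_integrable_law \<nu>" and f: "quadratic_growth f"
    and le: "\<And>x. \<bar>conv_op \<mu> f x - conv_op \<nu> f x\<bar> \<le> e"
  shows "\<bar>(conv_op \<mu> ^^ m) f x - (conv_op \<nu> ^^ m) f x\<bar> \<le> m * e"
proof (induction m arbitrary: x)
  case (Suc m)
  note qmu = square_integrable_law.quadratic_growth_conv_op_funpow[OF mu f]
    and qnu = square_integrable_law.quadratic_growth_conv_op_funpow[OF nu f]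
  have "\<bar>conv_op \<mu> ((conv_op \<mu> ^^ m) f) x - conv_op \<mu> ((conv_op \<nu> ^^ m) f) x\<bar> \<le> m * e"
    by (rule square_integrable_law.conv_op_diff_le[OF mu qmu qnu Suc.IH])
  moreover have "\<bar>(conv_op \<nu> ^^ m) (conv_op \<mu> f) x - (conv_op \<nu> ^^ m) (conv_op \<nu> f) x\<bar> \<le> e"
    by (intro conv_op_funpow_diff_le nu le square_integrable_law.quadratic_growth_conv_op f mu)
  moreover have "(conv_op \<nu> ^^ m) (conv_op \<nu> f) = conv_op \<nu> ((conv_op \<nu> ^^ m) f)"
    by (rule conv_op_funpow_commute[OF nu nu f])
  ultimately show ?case
    unfolding conv_op_funpow_commute[OF mu nu f] by (simp add: algebra_simps)
qed simp

text \<open>A partial sum and the next summand are functions of disjoint blocks of an independent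
  family, so their joint law is a product and the summands can be integrated out one at a
  time.\<close>

lemma (in prob_space) sum_conv_op:
  fixes \<xi> :: "nat \<Rightarrow> 'a \<Rightarrow> 'b::euclidean_space"
  assumes ind: "indep_vars (\<lambda>_. borel) \<xi> {..<n}"
    and distr: "\<And>i. i < n \<Longrightarrow> distr M borel (\<xi> i) = \<mu>"
    and mu: "square_integrable_law \<mu>" and f: "quadratic_growth f" and m: "m \<le> n"
  shows "integral\<^sup>L M (\<lambda>\<omega>. f (x + (\<Sum>i<m. \<xi> i \<omega>))) = (conv_op \<mu> ^^ m) f x"
    and "integrable M (\<lambda>\<omega>. norm (\<Sum>i<m. \<xi> i \<omega>) ^ 2)"
proof -
  have [measurable]: "\<xi> i \<in> borel_measurable M" if "i < n" for i
    using ind that by (auto simp: indep_vars_def)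
  have sq: "integrable M (\<lambda>\<omega>. norm (\<xi> i \<omega>) ^ 2)" if "i < n" for i
    using square_integrable_law.sq_integrable[OF mu] that unfolding distr[OF that, symmetric]
    by (simp add: integrable_distr_eq)
  have sqs: "integrable M (\<lambda>\<omega>. norm (\<Sum>i<m. \<xi> i \<omega>) ^ 2)" if "m \<le> n" for m
    using that
  proof (induction m)
    case (Suc m)
    then have [measurable]: "(\<lambda>\<omega>. \<Sum>i<m. \<xi> i \<omega>) \<in> borel_measurable M" "\<xi> m \<in> borel_measurable M"
      by (auto intro!: borel_measurable_sum)
    show ?case
      by (rule Bochner_Integration.integrable_bound[where
            f = "\<lambda>\<omega>. 2 * norm (\<Sum>i<m. \<xi> i \<omega>) ^ 2 + 2 * norm (\<xi> m \<omega>) ^ 2"])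
        (use Suc sq[of m] in \<open>auto intro!: norm_add_sq_le\<close>)
  qed simp
  then show "integrable M (\<lambda>\<omega>. norm (\<Sum>i<m. \<xi> i \<omega>) ^ 2)" using m .
  show "integral\<^sup>L M (\<lambda>\<omega>. f (x + (\<Sum>i<m. \<xi> i \<omega>))) = (conv_op \<mu> ^^ m) f x"
    using m f
  \<comment> \<open>The last summand is absorbed into the test function: the induction hypothesis is
    used for \<open>conv_op \<mu> f\<close> in place of \<open>f\<close>.\<close>
  proof (induction m arbitrary: f)
    case 0
    then show ?case by (simp add: prob_space)
  next
    case (Suc m)
    let ?S = "\<lambda>\<omega>. \<Sum>i<m. \<xi> i \<omega>"
    have [measurable]: "f \<in> borel_measurable borel" using Suc.prems by (simp add: quadratic_growth_def)
    have meas [measurable]: "?S \<in> borel_measurable M" "\<xi> m \<in> borel_measurable M"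
      using Suc.prems by (auto intro!: borel_measurable_sum)
    have "indep_var borel ((\<lambda>g. \<Sum>i<m. g i) \<circ> (\<lambda>\<omega>. restrict (\<lambda>i. \<xi> i \<omega>) {..<m}))
        borel ((\<lambda>g. g m) \<circ> (\<lambda>\<omega>. restrict (\<lambda>i. \<xi> i \<omega>) {m}))"
      by (rule indep_var_compose[OF indep_var_restrict[OF ind]]) (use Suc.prems in auto)
    then have iv: "indep_var borel ?S borel (\<xi> m)" by (simp add: comp_def)
    let ?\<sigma> = "distr M borel ?S"
    have sigma: "square_integrable_law ?\<sigma>"
      using Suc.prems by (intro square_integrable_law_distr meas sqs) simp
    have pair: "?\<sigma> \<Otimes>\<^sub>M \<mu> = distr M (borel \<Otimes>\<^sub>M borel) (\<lambda>\<omega>. (?S \<omega>, \<xi> m \<omega>))"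
      using iv distr[of m] Suc.prems unfolding indep_var_distribution_eq by simp
    have "integral\<^sup>L M (\<lambda>\<omega>. f (x + (\<Sum>i<Suc m. \<xi> i \<omega>)))
      = integral\<^sup>L (?\<sigma> \<Otimes>\<^sub>M \<mu>) (\<lambda>p. f (x + fst p + snd p))"
    proof -
      have [measurable]: "(\<lambda>p. f (x + fst p + snd p)) \<in> borel_measurable (borel \<Otimes>\<^sub>M borel)" by measurable
      show ?thesis unfolding pair
        by (subst integral_distr[where N = "borel \<Otimes>\<^sub>M borel" and f = "\<lambda>p. f (x + fst p + snd p)"])
          (simp_all add: add.assoc)
    qed
    also have "\<dots> = conv_op ?\<sigma> (conv_op \<mu> f) x"
      by (rule conv_op_conv_op(2)[OF sigma mu Suc.prems(2), symmetric])
    also have "\<dots> = integral\<^sup>L M (\<lambda>\<omega>. conv_op \<mu> f (x + ?S \<omega>))"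
      using square_integrable_law.quadratic_growth_conv_op[OF mu Suc.prems(2)]
    proof -
      have "(\<lambda>y. conv_op \<mu> f (x + y)) \<in> borel_measurable borel"
        using quadratic_growth_shift[OF square_integrable_law.quadratic_growth_conv_op[OF mu Suc.prems(2)]]
        by (simp add: quadratic_growth_def)
      from integral_distr[OF meas(1) this] show ?thesis by (simp add: conv_op_def[of ?\<sigma>])
    qed
    also have "\<dots> = (conv_op \<mu> ^^ m) (conv_op \<mu> f) x"
      using Suc.prems by (intro Suc.IH square_integrable_law.quadratic_growth_conv_op[OF mu]) auto
    finally show ?case by (simp add: funpow_swap1)
  qed
qed

text \<open>Centring removes the gradient. The second moments are left explicit, so that two laws
  with slightly different covariances can be compared afterwards.\<close>

lemma (in prob_space) taylor3_expectation:
  fixes h :: "real ^ 'd::finite \<Rightarrow> real" and Y :: "'a \<Rightarrow> real ^ 'd"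
  assumes h: "times_differentiable 3 h"
    and L3: "\<And>i j k x. \<bar>partial_deriv i (partial_deriv j (partial_deriv k h)) x\<bar> \<le> L3"
    and Y1: "\<And>i. integrable M (\<lambda>\<omega>. Y \<omega> $ i)" "\<And>i. integral\<^sup>L M (\<lambda>\<omega>. Y \<omega> $ i) = 0"
    and Y2: "\<And>i j. integrable M (\<lambda>\<omega>. Y \<omega> $ i * Y \<omega> $ j)"
    and Y3: "integrable M (\<lambda>\<omega>. l1 (Y \<omega>) ^ 3)"
    and hY: "integrable M (\<lambda>\<omega>. h (x + Y \<omega>))"
  shows "\<bar>integral\<^sup>L M (\<lambda>\<omega>. h (x + Y \<omega>)) - (h x + (\<Sum>k\<in>UNIV. \<Sum>j\<in>UNIV.
    partial_deriv j (partial_deriv k h) x * integral\<^sup>L M (\<lambda>\<omega>. Y \<omega> $ j * Y \<omega> $ k)) / 2)\<bar>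
    \<le> L3 / 6 * integral\<^sup>L M (\<lambda>\<omega>. l1 (Y \<omega>) ^ 3)"
proof -
  let ?T = "\<lambda>\<omega>. h x + (\<Sum>k\<in>UNIV. partial_deriv k h x * Y \<omega> $ k) +
    (\<Sum>k\<in>UNIV. \<Sum>j\<in>UNIV. partial_deriv j (partial_deriv k h) x * (Y \<omega> $ j * Y \<omega> $ k)) / 2"
  have T1: "integrable M (\<lambda>\<omega>. \<Sum>k\<in>UNIV. partial_deriv k h x * Y \<omega> $ k)"
    by (rule Bochner_Integration.integrable_sum, rule integrable_mult_right, rule Y1)
  have T2: "integrable M (\<lambda>\<omega>. \<Sum>k\<in>UNIV. \<Sum>j\<in>UNIV. partial_deriv j (partial_deriv k h) x * (Y \<omega> $ j * Y \<omega> $ k))"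
    by (rule Bochner_Integration.integrable_sum, rule Bochner_Integration.integrable_sum,
      rule integrable_mult_right, rule Y2)
  have T: "integrable M ?T"
    using T1 T2 by simp
  have "integral\<^sup>L M (\<lambda>\<omega>. \<Sum>k\<in>UNIV. partial_deriv k h x * Y \<omega> $ k) = 0"
    using Y1 by simp
  moreover have "integral\<^sup>L M (\<lambda>\<omega>. \<Sum>k\<in>UNIV. \<Sum>j\<in>UNIV. partial_deriv j (partial_deriv k h) x * (Y \<omega> $ j * Y \<omega> $ k))
    = (\<Sum>k\<in>UNIV. \<Sum>j\<in>UNIV. partial_deriv j (partial_deriv k h) x * integral\<^sup>L M (\<lambda>\<omega>. Y \<omega> $ j * Y \<omega> $ k))"
    using Y2 by simp
  ultimately have E: "integral\<^sup>L M ?T = h x + (\<Sum>k\<in>UNIV. \<Sum>j\<in>UNIV.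
    partial_deriv j (partial_deriv k h) x * integral\<^sup>L M (\<lambda>\<omega>. Y \<omega> $ j * Y \<omega> $ k)) / 2"
    using T1 T2 by (simp add: prob_space)
  have "\<bar>integral\<^sup>L M (\<lambda>\<omega>. h (x + Y \<omega>)) - integral\<^sup>L M ?T\<bar>
      = \<bar>integral\<^sup>L M (\<lambda>\<omega>. h (x + Y \<omega>) - ?T \<omega>)\<bar>"
    by (simp only: Bochner_Integration.integral_diff[OF hY T])
  also have "\<dots> \<le> integral\<^sup>L M (\<lambda>\<omega>. \<bar>h (x + Y \<omega>) - ?T \<omega>\<bar>)" by (rule integral_abs_bound)
  also have "\<dots> \<le> integral\<^sup>L M (\<lambda>\<omega>. L3 / 6 * l1 (Y \<omega>) ^ 3)"
  proof (rule integral_mono)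
    show "integrable M (\<lambda>\<omega>. \<bar>h (x + Y \<omega>) - ?T \<omega>\<bar>)"
      by (rule integrable_abs[OF Bochner_Integration.integrable_diff[OF hY T]])
    show "integrable M (\<lambda>\<omega>. L3 / 6 * l1 (Y \<omega>) ^ 3)"
      by (rule integrable_mult_right) (rule Y3)
    show "\<bar>h (x + Y \<omega>) - ?T \<omega>\<bar> \<le> L3 / 6 * l1 (Y \<omega>) ^ 3" for \<omega> by (rule taylor3[OF h L3])
  qed
  also have "\<dots> = L3 / 6 * integral\<^sup>L M (\<lambda>\<omega>. l1 (Y \<omega>) ^ 3)" by (rule integral_mult_right_zero)
  finally show ?thesis by (simp only: E)
qed

section \<open>Gaussian vectors\<close>

lemma borel_measurable_vec_iff:
  fixes f :: "'a \<Rightarrow> real ^ 'd::finite"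
  shows "f \<in> borel_measurable M \<longleftrightarrow> (\<forall>i. (\<lambda>x. f x $ i) \<in> borel_measurable M)"
  by (subst borel_measurable_euclidean_space) (auto simp: Basis_vec_def inner_axis)

lemma prob_space_std_normal: "prob_space (density lborel std_normal_density)"
  by (rule prob_space_normal_density) simp

lemma (in prob_space) indep_vars_normal_sum_moments:
  fixes Z :: "'i \<Rightarrow> 'a \<Rightarrow> real"
  assumes I: "finite I" and ind: "indep_vars (\<lambda>_. borel) Z I"
    and Z: "\<And>i. i \<in> I \<Longrightarrow> distributed M lborel (Z i) std_normal_density"
  shows "integrable M (\<lambda>\<omega>. (\<Sum>i\<in>I. a i * Z i \<omega>) ^ 4)"
    and "integral\<^sup>L M (\<lambda>\<omega>. (\<Sum>i\<in>I. a i * Z i \<omega>) ^ 4) = 3 * (\<Sum>i\<in>I. (a i)\<^sup>2)\<^sup>2"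
proof -
  \<comment> \<open>Zero coefficients must be dropped, since a normal density requires a positive
    standard deviation; if nothing remains, the sum is identically zero. Otherwise it is centred
    normal with variance \<open>s^2\<close> and fourth moment \<open>3 s^4\<close>.\<close>
  define J where "J = {i \<in> I. a i \<noteq> 0}"
  define s where "s = sqrt (\<Sum>i\<in>J. (a i)\<^sup>2)"
  define Y where "Y = (\<lambda>\<omega>. \<Sum>i\<in>J. a i * Z i \<omega>)"
  have Y: "(\<Sum>i\<in>I. a i * Z i \<omega>) = Y \<omega>" for \<omega>
    unfolding J_def Y_def by (rule sum.mono_neutral_right) (use I in auto)
  have s: "(\<Sum>i\<in>I. (a i)\<^sup>2) = s\<^sup>2"
    unfolding s_def J_def
    by (subst real_sqrt_pow2) (auto intro!: sum_nonneg sum.mono_neutral_right I)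
  have "integrable M (\<lambda>\<omega>. Y \<omega> ^ 4) \<and> integral\<^sup>L M (\<lambda>\<omega>. Y \<omega> ^ 4) = 3 * s ^ 4"
  proof (cases "J = {}")
    case True
    then show ?thesis by (simp add: Y_def s_def)
  next
    case False
    have J: "finite J" "J \<subseteq> I" using I by (auto simp: J_def)
    have "indep_vars (\<lambda>_. borel) (\<lambda>i \<omega>. a i * Z i \<omega>) J"
      by (rule indep_vars_compose2[OF indep_vars_subset[OF ind J(2)]]) auto
    moreover have "distributed M lborel (\<lambda>\<omega>. a i * Z i \<omega>) (normal_density 0 \<bar>a i\<bar>)" if "i \<in> J" for i
      using normal_density_affine[OF Z[of i], of "a i" 0] that J(2) by (auto simp: J_def)
    ultimately have "distributed M lborel Y (normal_density (\<Sum>i\<in>J. 0) (sqrt (\<Sum>i\<in>J. \<bar>a i\<bar>\<^sup>2)))"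
      unfolding Y_def by (intro sum_indep_normal) (use J False in \<open>auto simp: J_def\<close>)
    then have D: "distributed M lborel Y (normal_density 0 s)" by (simp add: s_def)
    have s0: "0 < s"
      unfolding s_def using J False by (auto intro!: sum_pos simp: J_def)
    have "integrable M (\<lambda>\<omega>. Y \<omega> ^ 4)"
      using integrable_normal_moment[OF s0, of 0 4]
      by (subst distributed_integrable[OF D, symmetric]) auto
    moreover have "integral\<^sup>L M (\<lambda>\<omega>. Y \<omega> ^ 4) = 3 * s ^ 4"
      using integral_normal_moment_even[OF s0, of 0 2]
      by (subst distributed_integral[OF D, symmetric]) (auto simp: fact_numeral field_simps)
    ultimately show ?thesis by simp
  qed
  then show "integrable M (\<lambda>\<omega>. (\<Sum>i\<in>I. a i * Z i \<omega>) ^ 4)"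
    "integral\<^sup>L M (\<lambda>\<omega>. (\<Sum>i\<in>I. a i * Z i \<omega>) ^ 4) = 3 * (\<Sum>i\<in>I. (a i)\<^sup>2)\<^sup>2"
    unfolding Y s by simp_all
qed

lemma (in prob_space) indep_vars_pair:
  assumes ind: "indep_vars N X I" and "i \<in> I" "j \<in> I" "i \<noteq> j"
  shows "indep_var (N i) (X i) (N j) (X j)"
proof -
  have "indep_var (N i) ((\<lambda>g. g i) \<circ> (\<lambda>\<omega>. restrict (\<lambda>i. X i \<omega>) {i}))
      (N j) ((\<lambda>g. g j) \<circ> (\<lambda>\<omega>. restrict (\<lambda>i. X i \<omega>) {j}))"
    by (rule indep_var_compose[OF indep_var_restrict[OF ind]]) (use assms in auto)
  then show ?thesis by (simp add: comp_def)
qed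

locale std_normal_vec =
  fixes N :: "'v measure" and Z :: "'v \<Rightarrow> real ^ 'd::finite"
  assumes std: "standard_normal_vector N Z"

sublocale std_normal_vec \<subseteq> prob_space N
  using std by (simp add: standard_normal_vector_def)

context std_normal_vec
begin

lemma indep: "indep_vars (\<lambda>_. borel) (\<lambda>i \<omega>. Z \<omega> $ i) UNIV"
  and distributed: "distributed N lborel (\<lambda>\<omega>. Z \<omega> $ i) std_normal_density"
  using std by (auto simp: standard_normal_vector_def)

lemma measurable_nth [measurable]: "(\<lambda>\<omega>. Z \<omega> $ i) \<in> borel_measurable N"
  using distributed_measurable[OF distributed] by simp

lemma measurable [measurable]: "Z \<in> borel_measurable N"
  by (simp add: borel_measurable_vec_iff)

lemma distr_nth: "distr N borel (\<lambda>\<omega>. Z \<omega> $ i) = density lborel std_normal_density"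
  unfolding distributed_distr_eq_density[OF distributed[of i], symmetric]
  by (rule distr_cong) simp_all

text \<open>The right-hand side does not mention \<open>N\<close> or \<open>Z\<close>: the
  definition of a standard normal vector fixes its law, so any realisation may replace any other
  inside an expectation.\<close>

lemma distr_eq: "distr N borel Z =
  distr (PiM UNIV (\<lambda>_::'d. density lborel std_normal_density)) borel (\<lambda>x. \<chi> i. x i)"
proof -
  have "distr N (PiM UNIV (\<lambda>_. borel)) (\<lambda>\<omega>. \<lambda>i\<in>UNIV. Z \<omega> $ i)
      = PiM UNIV (\<lambda>_::'d. density lborel std_normal_density)"
    using indep unfolding indep_vars_iff_distr_eq_PiM[OF UNIV_not_empty measurable_nth] by (simp add: distr_nth)
  then have "distr (PiM UNIV (\<lambda>_::'d. density lborel std_normal_density)) borel (\<lambda>x. \<chi> i. x i)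
    = distr (distr N (PiM UNIV (\<lambda>_. borel)) (\<lambda>\<omega>. \<lambda>i\<in>UNIV. Z \<omega> $ i)) borel (\<lambda>x. \<chi> i. x i)" by simp
  also have "\<dots> = distr N borel ((\<lambda>x. \<chi> i. x i) \<circ> (\<lambda>\<omega>. \<lambda>i\<in>UNIV. Z \<omega> $ i))"
    by (rule distr_distr) (auto simp: borel_measurable_vec_iff)
  also have "(\<lambda>x. \<chi> i. x i) \<circ> (\<lambda>\<omega>. \<lambda>i\<in>UNIV. Z \<omega> $ i) = Z" by (simp add: fun_eq_iff vec_eq_iff)
  finally show ?thesis by simp
qed

lemma integrable_nth: "integrable N (\<lambda>\<omega>. Z \<omega> $ i)" "integrable N (\<lambda>\<omega>. (Z \<omega> $ i)\<^sup>2)"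
  using integrable_std_normal_moment[of 1] integrable_std_normal_moment[of 2]
  by (auto simp: distributed_integrable[OF distributed[of i], of "\<lambda>x. x", symmetric]
      distributed_integrable[OF distributed[of i], of "\<lambda>x. x\<^sup>2", symmetric])

lemma expectation_nth: "expectation (\<lambda>\<omega>. Z \<omega> $ i) = 0"
  by (rule standard_normal_distributed_expectation[OF distributed])

lemma expectation_nth_mult:
  "integrable N (\<lambda>\<omega>. Z \<omega> $ i * Z \<omega> $ j)" (is ?A)
  "expectation (\<lambda>\<omega>. Z \<omega> $ i * Z \<omega> $ j) = (if i = j then 1 else 0)" (is ?B)
proof -
  have "?A \<and> ?B"
  proof (cases "i = j")
    case True
    have "expectation (\<lambda>\<omega>. (Z \<omega> $ i)\<^sup>2) = 1"
      using standard_normal_distributed_variance[OF distributed[of i]] by (simp add: expectation_nth)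
    with True show ?thesis using integrable_nth(2)[of i] by (simp add: power2_eq_square)
  next
    case False
    then have "indep_var borel (\<lambda>\<omega>. Z \<omega> $ i) borel (\<lambda>\<omega>. Z \<omega> $ j)"
      using indep_vars_pair[OF indep] by simp
    from indep_var_integrable[OF this integrable_nth(1) integrable_nth(1)]
      indep_var_lebesgue_integral[OF this integrable_nth(1) integrable_nth(1)] False
    show ?thesis by (simp add: expectation_nth)
  qed
  then show ?A ?B by auto
qed

lemma linear_moments:
  fixes A :: "real ^ 'd ^ 'e"
  shows "integrable N (\<lambda>\<omega>. (A *v Z \<omega>) $ i)" "expectation (\<lambda>\<omega>. (A *v Z \<omega>) $ i) = 0"
    "integrable N (\<lambda>\<omega>. (A *v Z \<omega>) $ i * (A *v Z \<omega>) $ j)"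
    "expectation (\<lambda>\<omega>. (A *v Z \<omega>) $ i * (A *v Z \<omega>) $ j) = (A ** transpose A) $ i $ j"
    "integrable N (\<lambda>\<omega>. ((A *v Z \<omega>) $ i) ^ 4)"
    "expectation (\<lambda>\<omega>. ((A *v Z \<omega>) $ i) ^ 4) = 3 * ((A ** transpose A) $ i $ i)\<^sup>2"
proof -
  have nth: "(A *v Z \<omega>) $ i = (\<Sum>k\<in>UNIV. A $ i $ k * Z \<omega> $ k)" for i \<omega>
    by (simp add: matrix_vector_mult_def)
  have AA: "(A ** transpose A) $ i $ j = (\<Sum>k\<in>UNIV. A $ i $ k * A $ j $ k)" for i j
    by (simp add: matrix_matrix_mult_def transpose_def)
  show "integrable N (\<lambda>\<omega>. (A *v Z \<omega>) $ i)" "expectation (\<lambda>\<omega>. (A *v Z \<omega>) $ i) = 0"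
    unfolding nth by (simp_all add: integrable_nth expectation_nth)
  have prod: "(A *v Z \<omega>) $ i * (A *v Z \<omega>) $ j
    = (\<Sum>k\<in>UNIV. \<Sum>l\<in>UNIV. (A $ i $ k * A $ j $ l) * (Z \<omega> $ k * Z \<omega> $ l))" for \<omega>
    unfolding nth sum_product by (simp add: mult_ac)
  show "integrable N (\<lambda>\<omega>. (A *v Z \<omega>) $ i * (A *v Z \<omega>) $ j)"
    unfolding prod by (simp add: expectation_nth_mult)
  show "expectation (\<lambda>\<omega>. (A *v Z \<omega>) $ i * (A *v Z \<omega>) $ j) = (A ** transpose A) $ i $ j"
    unfolding prod AA by (simp add: expectation_nth_mult if_distrib[of "\<lambda>x. _ * x"] cong: if_cong)
  show "integrable N (\<lambda>\<omega>. ((A *v Z \<omega>) $ i) ^ 4)"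
    "expectation (\<lambda>\<omega>. ((A *v Z \<omega>) $ i) ^ 4) = 3 * ((A ** transpose A) $ i $ i)\<^sup>2"
    using indep_vars_normal_sum_moments[OF finite indep distributed, of "\<lambda>k. A $ i $ k"]
    unfolding nth AA by (simp_all add: power2_eq_square)
qed

end

section \<open>Change of realisation and divisibility of the standard normal law\<close>

lemma standard_normal_vector_distr_unique:
  assumes "standard_normal_vector N Z" "standard_normal_vector N' Z'"
  shows "distr N borel Z = distr N' borel Z'"
  using std_normal_vec.distr_eq[unfolded std_normal_vec_def] assms by metis

lemma indep_vars_PiM_components:
  assumes I: "I \<noteq> {}" and M: "\<And>i. i \<in> I \<Longrightarrow> prob_space (M i)"
  shows "prob_space.indep_vars (PiM I M) M (\<lambda>i x. x i) I"
proof -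
  interpret prob_space "PiM I M" by (rule prob_space_PiM) (rule M)
  have "distr (PiM I M) (PiM I M) (\<lambda>x. restrict x I) = distr (PiM I M) (PiM I M) (\<lambda>x. x)"
    by (rule distr_cong) (auto simp: space_PiM PiE_restrict)
  also have "\<dots> = PiM I M" by simp
  also have "\<dots> = PiM I (\<lambda>i. distr (PiM I M) (M i) (\<lambda>x. x i))"
    by (rule PiM_cong) (simp_all add: distr_PiM_component M)
  finally show ?thesis
    by (subst indep_vars_iff_distr_eq_PiM'[OF I]) simp_all
qed

text \<open>All \<open>\<zeta> m\<close> live on one product of scalar normals indexed by pairs
  (coordinate, copy). Grouping the pairs by copy gives independence of the vectors; grouping them by
  coordinate gives independence of the coordinates of the normalised sum.\<close>

lemma standard_normal_vector_divisible:
  assumes n: "0 < n"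
  shows "\<exists>(\<Omega> :: ('d::finite \<times> nat \<Rightarrow> real) measure) (\<zeta> :: nat \<Rightarrow> ('d \<times> nat \<Rightarrow> real) \<Rightarrow> real ^ 'd).
    (\<forall>m<n. standard_normal_vector \<Omega> (\<zeta> m)) \<and> prob_space.indep_vars \<Omega> (\<lambda>_. borel) \<zeta> {..<n} \<and>
    standard_normal_vector \<Omega> (\<lambda>x. inverse (sqrt n) *\<^sub>R (\<Sum>m<n. \<zeta> m x))"
proof -
  let ?G = "density lborel std_normal_density"
  let ?I = "(UNIV :: 'd set) \<times> {..<n}"
  define \<Omega> where "\<Omega> = PiM ?I (\<lambda>_. ?G)"
  define \<zeta> where "\<zeta> = (\<lambda>(m::nat) x. \<chi> i::'d. (x (i, m) :: real))"
  interpret prob_space \<Omega> unfolding \<Omega>_def by (rule prob_space_PiM) (rule prob_space_std_normal)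
  have "indep_vars (\<lambda>_. ?G) (\<lambda>i x. x i) ?I"
    unfolding \<Omega>_def by (rule indep_vars_PiM_components) (use n prob_space_std_normal in auto)
  then have ind: "indep_vars (\<lambda>_. borel) (\<lambda>p x. x p) ?I"
    by (rule indep_vars_compose2[where Y = "\<lambda>_ x. x"]) simp
  have D: "distributed \<Omega> lborel (\<lambda>x. x p) std_normal_density" if "p \<in> ?I" for p
  proof -
    have "distr \<Omega> lborel (\<lambda>x. x p) = distr \<Omega> ?G (\<lambda>x. x p)" by (rule distr_cong) simp_all
    also have "\<dots> = ?G" unfolding \<Omega>_def
      by (rule distr_PiM_component) (use that prob_space_std_normal in auto)
    finally have "distr \<Omega> lborel (\<lambda>x. x p) = ?G" .
    moreover have "(\<lambda>x. x p) \<in> borel_measurable \<Omega>"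
      using ind that unfolding indep_vars_def by blast
    ultimately show ?thesis by (simp add: distributed_def)
  qed
  have 1: "standard_normal_vector \<Omega> (\<zeta> m)" if m: "m < n" for m
    unfolding standard_normal_vector_def
  proof (intro conjI allI)
    have "indep_vars (\<lambda>i. PiM {(i, m)} (\<lambda>_. borel)) (\<lambda>i x. restrict (\<lambda>p. x p) {(i, m)}) (UNIV :: 'd set)"
      by (rule indep_vars_restrict[OF ind]) (use m in \<open>auto simp: disjoint_family_on_def\<close>)
    from indep_vars_compose2[OF this, of "\<lambda>i g. g (i, m)" "\<lambda>_. borel"]
    show "indep_vars (\<lambda>_. borel) (\<lambda>i x. \<zeta> m x $ i) UNIV" by (simp add: \<zeta>_def)
    show "distributed \<Omega> lborel (\<lambda>x. \<zeta> m x $ i) std_normal_density" for i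
      using D m by (simp add: \<zeta>_def)
  qed unfold_locales
  have 2: "indep_vars (\<lambda>_. borel) \<zeta> {..<n}"
  proof -
    let ?K = "\<lambda>m. (UNIV :: 'd set) \<times> {m}"
    have "indep_vars (\<lambda>m. PiM (?K m) (\<lambda>_. borel)) (\<lambda>m x. restrict (\<lambda>p. x p) (?K m)) {..<n}"
      by (rule indep_vars_restrict[OF ind]) (auto simp: disjoint_family_on_def)
    moreover have "\<zeta> m \<in> borel_measurable (PiM (?K m) (\<lambda>_. borel))" for m
      unfolding \<zeta>_def by (subst borel_measurable_vec_iff) simp
    ultimately have "indep_vars (\<lambda>_. borel) (\<lambda>m x. \<zeta> m (restrict (\<lambda>p. x p) (?K m))) {..<n}"
      by (rule indep_vars_compose2)
    then show ?thesis by (simp add: \<zeta>_def)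
  qed
  have 3: "standard_normal_vector \<Omega> (\<lambda>x. inverse (sqrt n) *\<^sub>R (\<Sum>m<n. \<zeta> m x))"
    unfolding standard_normal_vector_def
  proof (intro conjI allI)
    let ?K = "\<lambda>i::'d. {i} \<times> {..<n}"
    have "indep_vars (\<lambda>i. PiM (?K i) (\<lambda>_. borel)) (\<lambda>i x. restrict (\<lambda>p. x p) (?K i)) UNIV"
      by (rule indep_vars_restrict[OF ind]) (auto simp: disjoint_family_on_def)
    from indep_vars_compose2[OF this, of "\<lambda>i g. inverse (sqrt n) * (\<Sum>m<n. g (i, m))" "\<lambda>_. borel"]
    show "indep_vars (\<lambda>_. borel) (\<lambda>i x. (inverse (sqrt n) *\<^sub>R (\<Sum>m<n. \<zeta> m x)) $ i) UNIV"
      by (simp add: \<zeta>_def)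
    fix i
    have ne: "{..<n} \<noteq> {}" using n by auto
    have "indep_vars (\<lambda>m. PiM {(i, m)} (\<lambda>_. borel)) (\<lambda>m x. restrict (\<lambda>p. x p) {(i, m)}) {..<n}"
      by (rule indep_vars_restrict[OF ind]) (auto simp: disjoint_family_on_def)
    from indep_vars_compose2[OF this, of "\<lambda>m g. g (i, m)" "\<lambda>_. borel"]
    have "indep_vars (\<lambda>_. borel) (\<lambda>m x. x (i, m)) {..<n}" by simp
    then have "distributed \<Omega> lborel (\<lambda>x. \<Sum>m<n. x (i, m)) (normal_density (\<Sum>m<n. 0) (sqrt (\<Sum>m<n. 1\<^sup>2)))"
      by (rule sum_indep_normal[OF finite_lessThan ne]) (use D in auto)
    then have "distributed \<Omega> lborel (\<lambda>x. \<Sum>m<n. x (i, m)) (normal_density 0 (sqrt n))" by simp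
    from normal_density_affine[OF this, of "inverse (sqrt n)" 0]
    show "distributed \<Omega> lborel (\<lambda>x. (inverse (sqrt n) *\<^sub>R (\<Sum>m<n. \<zeta> m x)) $ i) std_normal_density"
      using n by (simp add: \<zeta>_def)
  qed unfold_locales
  show ?thesis using 1 2 3 by blast
qed

text \<open>Puts the Gaussian expectation in the same form as that of a sum of n independent
  vectors, which is what the operator version of the exchange compares. \<open>Z\<close> itself is
  not divided; it is replaced in law by a normalised sum on another space.\<close>

lemma gaussian_conv_op_power:
  fixes Z :: "'v \<Rightarrow> real ^ 'd::finite" and A :: "real ^ 'd ^ 'e::finite"
  assumes Z: "standard_normal_vector N Z" and n: "0 < n" and f: "quadratic_growth f"
  defines "\<gamma> \<equiv> distr N borel (\<lambda>\<omega>. inverse (sqrt n) *\<^sub>R (A *v Z \<omega>))"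
  shows "square_integrable_law \<gamma>" "integral\<^sup>L N (\<lambda>\<omega>. f (A *v Z \<omega>)) = (conv_op \<gamma> ^^ n) f 0"
proof -
  have Az [measurable]: "(\<lambda>z. A *v z) \<in> borel_measurable borel"
    by (rule borel_measurable_continuous_onI) (rule matrix_vector_mult_linear_continuous_on)
  have [measurable]: "f \<in> borel_measurable borel" using f by (simp add: quadratic_growth_def)
  interpret Z: std_normal_vec N Z by unfold_locales (rule Z)
  have "integrable N (\<lambda>\<omega>. norm (A *v Z \<omega>) ^ 2)"
    unfolding power2_norm_eq_inner inner_vec_def by (simp add: Z.linear_moments)
  then show sq: "square_integrable_law \<gamma>"
    unfolding \<gamma>_def by (intro Z.square_integrable_law_distr) (simp_all add: power_mult_distrib)
  obtain \<Omega> :: "('d \<times> nat \<Rightarrow> real) measure" and \<zeta> :: "nat \<Rightarrow> ('d \<times> nat \<Rightarrow> real) \<Rightarrow> real ^ 'd"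
    where \<zeta>: "\<And>m. m < n \<Longrightarrow> standard_normal_vector \<Omega> (\<zeta> m)"
    and ind: "prob_space.indep_vars \<Omega> (\<lambda>_. borel) \<zeta> {..<n}"
    and sum: "standard_normal_vector \<Omega> (\<lambda>x. inverse (sqrt n) *\<^sub>R (\<Sum>m<n. \<zeta> m x))"
    using standard_normal_vector_divisible[OF n, where ?'d = 'd] by blast
  interpret S: std_normal_vec \<Omega> "\<lambda>x. inverse (sqrt n) *\<^sub>R (\<Sum>m<n. \<zeta> m x)" by unfold_locales (rule sum)
  define \<xi> where "\<xi> m x = inverse (sqrt n) *\<^sub>R (A *v \<zeta> m x)" for m x
  have \<xi>: "S.indep_vars (\<lambda>_. borel) \<xi> {..<n}"
    unfolding \<xi>_def by (rule S.indep_vars_compose2[OF ind]) measurable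
  have d: "distr \<Omega> borel (\<xi> m) = \<gamma>" if m: "m < n" for m
  proof -
    interpret zm: std_normal_vec \<Omega> "\<zeta> m" by unfold_locales (rule \<zeta>[OF m])
    have meas: "(\<lambda>z. inverse (sqrt n) *\<^sub>R (A *v z)) \<in> borel_measurable borel" by measurable
    have "distr \<Omega> borel (\<xi> m) = distr (distr \<Omega> borel (\<zeta> m)) borel (\<lambda>z. inverse (sqrt n) *\<^sub>R (A *v z))"
      unfolding \<xi>_def[abs_def] using distr_distr[OF meas zm.measurable] by (simp add: comp_def)
    also have "\<dots> = distr (distr N borel Z) borel (\<lambda>z. inverse (sqrt n) *\<^sub>R (A *v z))"
      by (simp add: standard_normal_vector_distr_unique[OF \<zeta>[OF m] Z])
    also have "\<dots> = \<gamma>"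
      unfolding \<gamma>_def using distr_distr[OF meas Z.measurable] by (simp add: comp_def)
    finally show ?thesis .
  qed
  have "integral\<^sup>L N (\<lambda>\<omega>. f (A *v Z \<omega>)) = integral\<^sup>L (distr N borel Z) (\<lambda>z. f (A *v z))"
    by (rule integral_distr[symmetric]) measurable
  also have "\<dots> = integral\<^sup>L (distr \<Omega> borel (\<lambda>x. inverse (sqrt n) *\<^sub>R (\<Sum>m<n. \<zeta> m x))) (\<lambda>z. f (A *v z))"
    by (simp add: standard_normal_vector_distr_unique[OF Z sum])
  also have "\<dots> = integral\<^sup>L \<Omega> (\<lambda>x. f (A *v (inverse (sqrt n) *\<^sub>R (\<Sum>m<n. \<zeta> m x))))"
    by (rule integral_distr) measurable
  also have "\<dots> = integral\<^sup>L \<Omega> (\<lambda>x. f (0 + (\<Sum>m<n. \<xi> m x)))"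
  proof -
    have "A *v (inverse (sqrt n) *\<^sub>R (\<Sum>m<n. \<zeta> m x)) = 0 + (\<Sum>m<n. \<xi> m x)" for x
      by (simp only: \<xi>_def linear_scale[OF matrix_vector_mul_linear] linear_sum[OF matrix_vector_mul_linear]
          scaleR_sum_right add_0)
    then show ?thesis by simp
  qed
  also have "\<dots> = (conv_op \<gamma> ^^ n) f 0"
    by (rule S.sum_conv_op(1)[OF \<xi> d sq f]) auto
  finally show "integral\<^sup>L N (\<lambda>\<omega>. f (A *v Z \<omega>)) = (conv_op \<gamma> ^^ n) f 0" .
qed

section \<open>Projections of a symmetric kernel\<close>

locale u_statistic = prob_space M for M :: "'w measure" +
  fixes S :: "'a measure" and X :: "nat \<Rightarrow> 'w \<Rightarrow> 'a" and n d :: nat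
    and \<psi> :: "(nat \<Rightarrow> 'a) \<Rightarrow> real" and \<psi>s :: "nat \<Rightarrow> (nat \<Rightarrow> 'a) \<Rightarrow> real"
  assumes d1: "1 \<le> d" and dn: "d \<le> n"
    and indep: "indep_vars (\<lambda>_. S) X {..<n}"
    and ident: "\<forall>i<n. \<forall>j<n. distr M S (X i) = distr M S (X j)"
    and psi_meas [measurable]: "\<psi> \<in> borel_measurable (PiM {..<d} (\<lambda>_. S))"
    and psi_sym: "symmetric_on S d \<psi>"
    and psi_int: "integrable M (\<lambda>\<omega>. \<psi> (first_obs X d \<omega>))"
    and psi_mean: "integral\<^sup>L M (\<lambda>\<omega>. \<psi> (first_obs X d \<omega>)) = 0"
    and psi_int4: "integrable M (\<lambda>\<omega>. \<psi> (first_obs X d \<omega>) ^ 4)"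
    and proj: "\<forall>k\<in>{1..d}. is_projection M S X d \<psi> k (\<psi>s k)"
begin

abbreviation "PS A \<equiv> PiM A (\<lambda>_::nat. S)"

text \<open>In contrast to \<open>subset_obs\<close>, the coordinates keep their original indices.
  Passing to a smaller index set is then a restriction and joining disjoint index sets is
  \<open>merge\<close>, so the calculus of product measures applies.\<close>

definition obs :: "nat set \<Rightarrow> 'w \<Rightarrow> nat \<Rightarrow> 'a" where
  "obs A \<omega> = (\<lambda>i\<in>A. X i \<omega>)"

definition T :: "nat set \<Rightarrow> 'w \<Rightarrow> real" where
  "T \<alpha> \<omega> = \<psi>s (card \<alpha>) (subset_obs X \<alpha> \<omega>)"

definition \<Psi> :: "nat set \<Rightarrow> 'w \<Rightarrow> real" where
  "\<Psi> \<delta> \<omega> = \<psi> (subset_obs X \<delta> \<omega>)"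

text \<open>Setting \<open>v 0 = 0\<close> makes \<open>T_covariance\<close> below hold for disjoint index sets as well.\<close>

definition v :: "nat \<Rightarrow> real" where
  "v k = (if k = 0 then 0 else expectation (\<lambda>\<omega>. (\<psi>s k (first_obs X k \<omega>))\<^sup>2))"

lemma n0: "0 < n" using d1 dn by simp

lemma measurable_X [measurable]: "i < n \<Longrightarrow> X i \<in> measurable M S"
  using indep by (simp add: indep_vars_def)

lemma measurable_obs [measurable]: "A \<subseteq> {..<n} \<Longrightarrow> obs A \<in> measurable M (PS A)"
  unfolding obs_def[abs_def] by (rule measurable_restrict) auto

lemma measurable_first_obs [measurable]: "k \<le> n \<Longrightarrow> first_obs X k \<in> measurable M (PS {..<k})"
  unfolding first_obs_def[abs_def] by (rule measurable_restrict) auto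

lemma psis_meas: "k \<in> {1..d} \<Longrightarrow> \<psi>s k \<in> borel_measurable (PS {..<k})"
  using proj by (simp add: is_projection_def)

section \<open>Exchangeability of the sample\<close>

lemma distr_reindexed_obs:
  assumes "inj_on \<pi> {..<k}" "\<pi> ` {..<k} \<subseteq> {..<n}"
  shows "distr M (PS {..<k}) (\<lambda>\<omega>. \<lambda>i\<in>{..<k}. X (\<pi> i) \<omega>) = PiM {..<k} (\<lambda>_. distr M S (X 0))"
proof -
  let ?P = "distr M S (X 0)"
  have ne: "{..<n} \<noteq> {}" using n0 by auto
  have P: "prob_space ?P" using n0 by (intro prob_space_distr) simp
  have "distr M (PS {..<n}) (\<lambda>\<omega>. \<lambda>i\<in>{..<n}. X i \<omega>) = PiM {..<n} (\<lambda>i. distr M S (X i))"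
    using indep by (subst (asm) indep_vars_iff_distr_eq_PiM'[OF ne]) auto
  also have "\<dots> = PiM {..<n} (\<lambda>_. ?P)"
    by (rule PiM_cong[OF refl]) (use ident n0 in blast)
  finally have joint: "distr M (PS {..<n}) (\<lambda>\<omega>. \<lambda>i\<in>{..<n}. X i \<omega>) = PiM {..<n} (\<lambda>_. ?P)" .
  have "PiM {..<k} (\<lambda>_. ?P) = distr (PiM {..<n} (\<lambda>_. ?P)) (PiM {..<k} (\<lambda>_. ?P)) (\<lambda>x. \<lambda>i\<in>{..<k}. x (\<pi> i))"
    by (rule distr_PiM_reindex[symmetric]) (use assms P in auto)
  also have "\<dots> = distr (PiM {..<n} (\<lambda>_. ?P)) (PS {..<k}) (\<lambda>x. \<lambda>i\<in>{..<k}. x (\<pi> i))"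
    by (rule distr_cong[OF refl sets_PiM_cong]) auto
  also have "\<dots> = distr (distr M (PS {..<n}) (\<lambda>\<omega>. \<lambda>i\<in>{..<n}. X i \<omega>)) (PS {..<k}) (\<lambda>x. \<lambda>i\<in>{..<k}. x (\<pi> i))"
    by (simp add: joint)
  also have "\<dots> = distr M (PS {..<k}) ((\<lambda>x. \<lambda>i\<in>{..<k}. x (\<pi> i)) \<circ> (\<lambda>\<omega>. \<lambda>i\<in>{..<n}. X i \<omega>))"
  proof (rule distr_distr)
    show "(\<lambda>x. \<lambda>i\<in>{..<k}. x (\<pi> i)) \<in> measurable (PS {..<n}) (PS {..<k})"
      using assms by (intro measurable_restrict measurable_component_singleton) auto
  qed (auto intro!: measurable_restrict)
  also have "\<dots> = distr M (PS {..<k}) (\<lambda>\<omega>. \<lambda>i\<in>{..<k}. X (\<pi> i) \<omega>)"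
    using assms by (intro distr_cong) (auto simp: fun_eq_iff restrict_def)
  finally show ?thesis by simp
qed

lemma reindexed_obs_transfer:
  fixes G :: "(nat \<Rightarrow> 'a) \<Rightarrow> real"
  assumes \<pi>: "inj_on \<pi> {..<k}" "\<pi> ` {..<k} \<subseteq> {..<n}" and k: "k \<le> n"
    and G: "G \<in> borel_measurable (PS {..<k})"
  shows "expectation (\<lambda>\<omega>. G (\<lambda>i\<in>{..<k}. X (\<pi> i) \<omega>)) = expectation (\<lambda>\<omega>. G (first_obs X k \<omega>))"
    and "integrable M (\<lambda>\<omega>. G (\<lambda>i\<in>{..<k}. X (\<pi> i) \<omega>)) \<longleftrightarrow> integrable M (\<lambda>\<omega>. G (first_obs X k \<omega>))"
proof -
  have m: "(\<lambda>\<omega>. \<lambda>i\<in>{..<k}. X (\<pi> i) \<omega>) \<in> measurable M (PS {..<k})"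
    using \<pi> by (intro measurable_restrict) auto
  have m': "first_obs X k \<in> measurable M (PS {..<k})" using k by simp
  have eq: "distr M (PS {..<k}) (\<lambda>\<omega>. \<lambda>i\<in>{..<k}. X (\<pi> i) \<omega>) = distr M (PS {..<k}) (first_obs X k)"
    unfolding distr_reindexed_obs[OF \<pi>] first_obs_def[abs_def]
    by (rule distr_reindexed_obs[symmetric]) (use k in auto)
  show "expectation (\<lambda>\<omega>. G (\<lambda>i\<in>{..<k}. X (\<pi> i) \<omega>)) = expectation (\<lambda>\<omega>. G (first_obs X k \<omega>))"
    using integral_distr[OF m G] integral_distr[OF m' G] eq by simp
  show "integrable M (\<lambda>\<omega>. G (\<lambda>i\<in>{..<k}. X (\<pi> i) \<omega>)) \<longleftrightarrow> integrable M (\<lambda>\<omega>. G (first_obs X k \<omega>))"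
    using integrable_distr_eq[OF m G] integrable_distr_eq[OF m' G] eq by simp
qed

lemma nth_sorted_list:
  assumes "finite \<alpha>"
  shows "bij_betw (\<lambda>i. sorted_list_of_set \<alpha> ! i) {..<card \<alpha>} \<alpha>"
  using assms bij_betw_nth[of "sorted_list_of_set \<alpha>"] by (simp add: atLeast0LessThan)

lemma subset_obs_transfer:
  fixes G :: "(nat \<Rightarrow> 'a) \<Rightarrow> real"
  assumes \<alpha>: "\<alpha> \<subseteq> {..<n}" and G: "G \<in> borel_measurable (PS {..<card \<alpha>})"
  shows "expectation (\<lambda>\<omega>. G (subset_obs X \<alpha> \<omega>)) = expectation (\<lambda>\<omega>. G (first_obs X (card \<alpha>) \<omega>))"
    and "integrable M (\<lambda>\<omega>. G (subset_obs X \<alpha> \<omega>)) \<longleftrightarrow> integrable M (\<lambda>\<omega>. G (first_obs X (card \<alpha>) \<omega>))"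
proof -
  have b: "bij_betw (\<lambda>i. sorted_list_of_set \<alpha> ! i) {..<card \<alpha>} \<alpha>"
    using \<alpha> by (intro nth_sorted_list) (rule finite_subset, auto)
  have "card \<alpha> \<le> n" using card_mono[OF _ \<alpha>] by simp
  then show "expectation (\<lambda>\<omega>. G (subset_obs X \<alpha> \<omega>)) = expectation (\<lambda>\<omega>. G (first_obs X (card \<alpha>) \<omega>))"
    "integrable M (\<lambda>\<omega>. G (subset_obs X \<alpha> \<omega>)) \<longleftrightarrow> integrable M (\<lambda>\<omega>. G (first_obs X (card \<alpha>) \<omega>))"
    unfolding subset_obs_def
    using reindexed_obs_transfer[OF bij_betw_imp_inj_on[OF b] _ _ G] bij_betw_imp_surj_on[OF b] \<alpha>
    by auto
qed

lemma subset_obs_eq: "finite \<alpha> \<Longrightarrow> subset_obs X \<alpha> \<omega> = (\<lambda>i\<in>{..<card \<alpha>}. obs \<alpha> \<omega> (sorted_list_of_set \<alpha> ! i))"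
  using bij_betw_imp_surj_on[OF nth_sorted_list[of \<alpha>]]
  by (auto simp: subset_obs_def obs_def fun_eq_iff restrict_def)

text \<open>\<open>T \<alpha>\<close> as a function on the product over \<alpha> itself, which
  exposes it as a measurable function of \<open>obs \<alpha>\<close> for independence and Fubini
  arguments.\<close>

definition t :: "nat set \<Rightarrow> (nat \<Rightarrow> 'a) \<Rightarrow> real" where
  "t \<alpha> x = \<psi>s (card \<alpha>) (\<lambda>i\<in>{..<card \<alpha>}. x (sorted_list_of_set \<alpha> ! i))"

lemma T_eq: "finite \<alpha> \<Longrightarrow> T \<alpha> \<omega> = t \<alpha> (obs \<alpha> \<omega>)"
  by (simp add: T_def t_def subset_obs_eq)

lemma t_meas:
  assumes "finite \<alpha>" "card \<alpha> \<in> {1..d}"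
  shows "t \<alpha> \<in> borel_measurable (PS \<alpha>)"
proof -
  have "(\<lambda>x. \<lambda>i\<in>{..<card \<alpha>}. x (sorted_list_of_set \<alpha> ! i)) \<in> measurable (PS \<alpha>) (PS {..<card \<alpha>})"
    using bij_betw_imp_surj_on[OF nth_sorted_list[OF assms(1)]]
    by (intro measurable_restrict measurable_component_singleton) auto
  from measurable_compose[OF this psis_meas[OF assms(2)]] show ?thesis by (simp add: t_def[abs_def])
qed

lemma T_meas [measurable]:
  assumes "\<alpha> \<subseteq> {..<n}" "card \<alpha> \<in> {1..d}"
  shows "T \<alpha> \<in> borel_measurable M"
proof -
  have fin: "finite \<alpha>" using assms by (meson finite_lessThan finite_subset)
  show ?thesis
    using measurable_compose[OF measurable_obs[OF assms(1)] t_meas[OF fin assms(2)]]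
    by (simp add: T_eq[OF fin, abs_def])
qed

section \<open>Conditional expectations: moments and integrals over events\<close>

abbreviation "F k \<equiv> vimage_algebra (space M) (first_obs X k) (PS {..<k})"

lemma subalgebra_F: "k \<le> n \<Longrightarrow> finite_measure_subalgebra M (F k)"
proof unfold_locales
  assume k: "k \<le> n"
  show "subalgebra M (F k)"
    unfolding subalgebra_def
    using sets_image_in_sets[OF _ measurable_first_obs[OF k]] by (simp add: sets_vimage_algebra)
qed

text \<open>Conditional Jensen for the fourth power: projecting does not increase the fourth moment,
  so \<rho> controls all the \<open>\<psi>s k\<close> at once. Each of them inherits the mean of the
  kernel.\<close>

lemma projection_moment:
  assumes k: "k \<in> {1..d}"
  shows "integrable M (\<lambda>\<omega>. \<psi>s k (first_obs X k \<omega>) ^ 4)"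
    and "expectation (\<lambda>\<omega>. \<psi>s k (first_obs X k \<omega>) ^ 4) \<le> expectation (\<lambda>\<omega>. \<psi> (first_obs X d \<omega>) ^ 4)"
    and "integrable M (\<lambda>\<omega>. \<psi>s k (first_obs X k \<omega>))"
    and "expectation (\<lambda>\<omega>. \<psi>s k (first_obs X k \<omega>)) = 0"
proof -
  have kn: "k \<le> n" using k dn by simp
  interpret Fk: finite_measure_subalgebra M "F k" by (rule subalgebra_F[OF kn])
  let ?E = "real_cond_exp M (F k) (\<lambda>\<omega>. \<psi> (first_obs X d \<omega>))"
  have [measurable]: "\<psi>s k \<in> borel_measurable (PS {..<k})" "first_obs X k \<in> measurable M (PS {..<k})"
    using psis_meas[OF k] kn by auto
  have eq: "AE \<omega> in M. \<psi>s k (first_obs X k \<omega>) = ?E \<omega>"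
    using proj k by (auto simp: is_projection_def)
  have cv: "convex_on UNIV (\<lambda>x::real. x ^ 4)" by (rule convex_power_even) simp
  have E4: "integrable M (\<lambda>\<omega>. ?E \<omega> ^ 4)"
    by (rule Fk.integrable_convex_cond_exp[OF psi_int _ _ psi_int4 cv, of 0 0]) auto
  have "AE \<omega> in M. ?E \<omega> ^ 4 \<le> real_cond_exp M (F k) (\<lambda>\<omega>. \<psi> (first_obs X d \<omega>) ^ 4) \<omega>"
    by (rule Fk.real_cond_exp_jensens_inequality(2)[OF psi_int _ _ psi_int4 cv, of 0 0]) auto
  then have "expectation (\<lambda>\<omega>. ?E \<omega> ^ 4) \<le> expectation (real_cond_exp M (F k) (\<lambda>\<omega>. \<psi> (first_obs X d \<omega>) ^ 4))"
    by (intro integral_mono_AE E4 Fk.real_cond_exp_int psi_int4)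
  also have "\<dots> = expectation (\<lambda>\<omega>. \<psi> (first_obs X d \<omega>) ^ 4)"
    by (rule Fk.real_cond_exp_int[OF psi_int4])
  finally have le: "expectation (\<lambda>\<omega>. ?E \<omega> ^ 4) \<le> expectation (\<lambda>\<omega>. \<psi> (first_obs X d \<omega>) ^ 4)" .
  have eq4: "AE \<omega> in M. \<psi>s k (first_obs X k \<omega>) ^ 4 = ?E \<omega> ^ 4" using eq by eventually_elim simp
  have "expectation (\<lambda>\<omega>. \<psi>s k (first_obs X k \<omega>) ^ 4) = expectation (\<lambda>\<omega>. ?E \<omega> ^ 4)"
    by (rule integral_cong_AE[OF _ _ eq4]) (use E4 in \<open>auto simp: borel_measurable_integrable\<close>)
  then show "expectation (\<lambda>\<omega>. \<psi>s k (first_obs X k \<omega>) ^ 4) \<le> expectation (\<lambda>\<omega>. \<psi> (first_obs X d \<omega>) ^ 4)"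
    using le by simp
  show "integrable M (\<lambda>\<omega>. \<psi>s k (first_obs X k \<omega>) ^ 4)"
    by (rule integrable_cong_AE_imp[OF E4]) (use eq4 in auto)
  have E1: "integrable M ?E" by (rule Fk.real_cond_exp_int[OF psi_int])
  show "integrable M (\<lambda>\<omega>. \<psi>s k (first_obs X k \<omega>))"
    by (rule integrable_cong_AE_imp[OF E1]) (use eq in auto)
  have "expectation (\<lambda>\<omega>. \<psi>s k (first_obs X k \<omega>)) = expectation ?E"
    by (rule integral_cong_AE[OF _ _ eq]) auto
  then show "expectation (\<lambda>\<omega>. \<psi>s k (first_obs X k \<omega>)) = 0"
    using Fk.real_cond_exp_int(2)[OF psi_int] psi_mean by simp
qed

lemma projection_int:
  assumes k: "k \<in> {1..d}" and C: "C \<in> sets (PS {..<k})"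
  shows "expectation (\<lambda>\<omega>. indicator C (first_obs X k \<omega>) * \<psi>s k (first_obs X k \<omega>))
    = expectation (\<lambda>\<omega>. indicator C (first_obs X k \<omega>) * \<psi> (first_obs X d \<omega>))"
proof -
  have kn: "k \<le> n" using k dn by simp
  interpret Fk: finite_measure_subalgebra M "F k" by (rule subalgebra_F[OF kn])
  let ?E = "real_cond_exp M (F k) (\<lambda>\<omega>. \<psi> (first_obs X d \<omega>))"
  have [measurable]: "\<psi>s k \<in> borel_measurable (PS {..<k})" "first_obs X k \<in> measurable M (PS {..<k})"
    using psis_meas[OF k] kn by auto
  have eq: "AE \<omega> in M. \<psi>s k (first_obs X k \<omega>) = ?E \<omega>"
    using proj k by (auto simp: is_projection_def)
  let ?A = "first_obs X k -` C \<inter> space M"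
  have A: "?A \<in> sets (F k)" by (rule in_vimage_algebra[OF C])
  have ind: "indicator C (first_obs X k \<omega>) = (indicator ?A \<omega> :: real)" if "\<omega> \<in> space M" for \<omega>
    using that by (simp add: indicator_def)
  have "expectation (\<lambda>\<omega>. indicator C (first_obs X k \<omega>) * \<psi>s k (first_obs X k \<omega>))
    = expectation (\<lambda>\<omega>. indicator ?A \<omega> * ?E \<omega>)"
    using eq C by (intro integral_cong_AE) (auto simp: ind elim!: eventually_mono dest: AE_mp)
  also have "\<dots> = expectation (\<lambda>\<omega>. indicator ?A \<omega> * \<psi> (first_obs X d \<omega>))"
    using Fk.real_cond_exp_intA[OF psi_int A] by (simp add: set_lebesgue_integral_def)
  also have "\<dots> = expectation (\<lambda>\<omega>. indicator C (first_obs X k \<omega>) * \<psi> (first_obs X d \<omega>))"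
    by (rule Bochner_Integration.integral_cong) (auto simp: ind)
  finally show ?thesis .
qed

abbreviation "\<rho> \<equiv> expectation (\<lambda>\<omega>. \<psi> (first_obs X d \<omega>) ^ 4)"

lemma T_moments:
  assumes \<alpha>: "\<alpha> \<subseteq> {..<n}" "card \<alpha> \<in> {1..d}"
  shows "integrable M (\<lambda>\<omega>. T \<alpha> \<omega> ^ 4)" "expectation (\<lambda>\<omega>. T \<alpha> \<omega> ^ 4) \<le> \<rho>"
    "integrable M (T \<alpha>)" "expectation (T \<alpha>) = 0"
    "integrable M (\<lambda>\<omega>. (T \<alpha> \<omega>)\<^sup>2)" "expectation (\<lambda>\<omega>. (T \<alpha> \<omega>)\<^sup>2) = v (card \<alpha>)"
proof -
  have [measurable]: "\<psi>s (card \<alpha>) \<in> borel_measurable (PS {..<card \<alpha>})" by (rule psis_meas[OF \<alpha>(2)])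
  note tr = subset_obs_transfer[OF \<alpha>(1)] and pm = projection_moment[OF \<alpha>(2)]
  show i4: "integrable M (\<lambda>\<omega>. T \<alpha> \<omega> ^ 4)"
    unfolding T_def using tr(2)[of "\<lambda>x. \<psi>s (card \<alpha>) x ^ 4"] pm by simp
  show "expectation (\<lambda>\<omega>. T \<alpha> \<omega> ^ 4) \<le> \<rho>"
    unfolding T_def using tr(1)[of "\<lambda>x. \<psi>s (card \<alpha>) x ^ 4"] pm by simp
  show "integrable M (T \<alpha>)"
    unfolding T_def[abs_def] using tr(2)[of "\<psi>s (card \<alpha>)"] pm by simp
  show "expectation (T \<alpha>) = 0"
    unfolding T_def[abs_def] using tr(1)[of "\<psi>s (card \<alpha>)"] pm by simp
  have [measurable]: "T \<alpha> \<in> borel_measurable M" by (rule T_meas[OF \<alpha>])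
  show "integrable M (\<lambda>\<omega>. (T \<alpha> \<omega>)\<^sup>2)"
  proof (rule Bochner_Integration.integrable_bound[of _ "\<lambda>\<omega>. 1 + T \<alpha> \<omega> ^ 4"])
    have "x\<^sup>2 \<le> 1 + x ^ 4" for x :: real
    proof -
      have "(x\<^sup>2 - 1)\<^sup>2 = x ^ 4 - 2 * x\<^sup>2 + 1" by (simp add: power2_diff)
      then show ?thesis using zero_le_power2[of "x\<^sup>2 - 1"] zero_le_power2[of x] by linarith
    qed
    then show "AE \<omega> in M. norm ((T \<alpha> \<omega>)\<^sup>2) \<le> norm (1 + T \<alpha> \<omega> ^ 4)" by simp
  qed (use i4 in auto)
  show "expectation (\<lambda>\<omega>. (T \<alpha> \<omega>)\<^sup>2) = v (card \<alpha>)"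
    unfolding T_def v_def using tr(1)[of "\<lambda>x. (\<psi>s (card \<alpha>) x)\<^sup>2"] \<alpha>(2) by simp
qed

lemma T_mult_integrable:
  assumes "\<alpha> \<subseteq> {..<n}" "card \<alpha> \<in> {1..d}" "\<beta> \<subseteq> {..<n}" "card \<beta> \<in> {1..d}"
  shows "integrable M (\<lambda>\<omega>. T \<alpha> \<omega> * T \<beta> \<omega>)"
proof (rule Bochner_Integration.integrable_bound[of _ "\<lambda>\<omega>. (T \<alpha> \<omega>)\<^sup>2 + (T \<beta> \<omega>)\<^sup>2"])
  have "\<bar>x * y\<bar> \<le> x\<^sup>2 + y\<^sup>2" for x y :: real
  proof -
    have "2 * \<bar>x * y\<bar> \<le> x\<^sup>2 + y\<^sup>2"
      using sum_squares_bound[of "\<bar>x\<bar>" "\<bar>y\<bar>"] by (simp add: abs_mult mult.assoc)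
    then show ?thesis using abs_ge_zero[of "x * y"] by linarith
  qed
  then show "AE \<omega> in M. norm (T \<alpha> \<omega> * T \<beta> \<omega>) \<le> norm ((T \<alpha> \<omega>)\<^sup>2 + (T \<beta> \<omega>)\<^sup>2)" by simp
qed (use assms T_moments in auto)

text \<open>\<open>T \<gamma>\<close> acts as the conditional mean of the kernel on any d-set
  \<delta> containing \<gamma>, although the assumption concerns only initial segments. Symmetry of
  \<psi> allows the points of \<gamma> to be listed first in \<delta>, and exchangeability then
  carries \<gamma> and \<delta> to the first k and the first d observations.\<close>

lemma T_projection_int:
  assumes \<gamma>: "\<gamma> \<subseteq> \<delta>" "card \<gamma> \<in> {1..d}" and \<delta>: "\<delta> \<subseteq> {..<n}" "card \<delta> = d"
    and C: "C \<in> sets (PS \<gamma>)"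
  shows "expectation (\<lambda>\<omega>. indicator C (obs \<gamma> \<omega>) * T \<gamma> \<omega>)
    = expectation (\<lambda>\<omega>. indicator C (obs \<gamma> \<omega>) * \<Psi> \<delta> \<omega>)"
proof -
  define k where "k = card \<gamma>"
  have k: "k \<in> {1..d}" and kd: "k \<le> d" using \<gamma>(2) by (auto simp: k_def)
  have fin: "finite \<delta>" "finite \<gamma>" using \<gamma>(1) \<delta>(1) by (meson finite_lessThan finite_subset)+
  define a where "a i = sorted_list_of_set \<gamma> ! i" for i
  define b where "b i = sorted_list_of_set \<delta> ! i" for i
  have a: "bij_betw a {..<k} \<gamma>" unfolding a_def k_def by (rule nth_sorted_list[OF fin(2)])
  have b: "bij_betw b {..<d} \<delta>" unfolding b_def \<delta>(2)[symmetric] by (rule nth_sorted_list[OF fin(1)])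
  have "card (\<delta> - \<gamma>) = card {k..<d}"
    using \<gamma>(1) \<delta>(2) fin by (simp add: card_Diff_subset k_def)
  then obtain e where e: "bij_betw e {k..<d} (\<delta> - \<gamma>)"
    using finite_same_card_bij[of "{k..<d}" "\<delta> - \<gamma>"] fin by auto
  \<comment> \<open>An enumeration of \<delta> that begins with \<gamma> in increasing order, as
    \<open>subset_obs X \<gamma>\<close> does, and continues arbitrarily.\<close>
  define \<pi> where "\<pi> i = (if i < k then a i else e i)" for i
  have "bij_betw \<pi> {..<k} \<gamma>" using a by (rule bij_betw_cong[THEN iffD1, rotated]) (simp add: \<pi>_def)
  moreover have "bij_betw \<pi> {k..<d} (\<delta> - \<gamma>)" using e by (rule bij_betw_cong[THEN iffD1, rotated]) (simp add: \<pi>_def)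
  ultimately have "bij_betw \<pi> ({..<k} \<union> {k..<d}) (\<gamma> \<union> (\<delta> - \<gamma>))" by (rule bij_betw_combine) auto
  moreover have "{..<k} \<union> {k..<d} = {..<d}" using kd by auto
  moreover have "\<gamma> \<union> (\<delta> - \<gamma>) = \<delta>" using \<gamma>(1) by auto
  ultimately have \<pi>: "bij_betw \<pi> {..<d} \<delta>" by simp
  \<comment> \<open>The permutation taking the increasing enumeration \<open>b\<close> of \<delta>
    to \<pi>; it is the identity outside \<open>{..<d}\<close>, as \<open>permutes\<close>
    demands.\<close>
  define p where "p i = (if i < d then inv_into {..<d} b (\<pi> i) else i)" for i
  have "bij_betw (inv_into {..<d} b \<circ> \<pi>) {..<d} {..<d}"
    by (rule bij_betw_trans[OF \<pi> bij_betw_inv_into[OF b]])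
  then have "bij_betw p {..<d} {..<d}"
    by (rule bij_betw_cong[THEN iffD1, rotated]) (simp add: p_def)
  then have perm: "p permutes {..<d}" by (rule bij_imp_permutes) (simp add: p_def)
  have bp: "b (p i) = \<pi> i" if "i < d" for i
    using that bij_betw_inv_into_right[OF b] bij_betw_apply[OF \<pi>, of i] by (simp add: p_def)
  have \<Psi>: "\<Psi> \<delta> \<omega> = \<psi> (\<lambda>i\<in>{..<d}. X (\<pi> i) \<omega>)" if \<omega>: "\<omega> \<in> space M" for \<omega>
  proof -
    let ?x = "subset_obs X \<delta> \<omega>"
    have "?x \<in> space (PS {..<d})"
      using measurable_space[OF measurable_X \<omega>] \<delta> bij_betw_apply[OF b]
      by (auto simp: subset_obs_def space_PiM b_def[symmetric])
    then have "\<psi> ?x = \<psi> (\<lambda>i. ?x (p i))"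
      using psi_sym perm by (simp add: symmetric_on_def)
    also have "(\<lambda>i. ?x (p i)) = (\<lambda>i\<in>{..<d}. X (\<pi> i) \<omega>)"
    proof
      fix i
      show "?x (p i) = (\<lambda>i\<in>{..<d}. X (\<pi> i) \<omega>) i"
      proof (cases "i < d")
        case True
        then have "p i < d" using permutes_in_image[OF perm, of i] by simp
        then show ?thesis using True bp[OF True] by (simp add: subset_obs_def \<delta>(2) b_def[symmetric])
      next
        \<comment> \<open>Here both sides are the arbitrary value of a restricted function outside
          its domain, because \<open>p\<close> fixes \<open>i\<close>.\<close>
        case False
        then show ?thesis by (simp add: subset_obs_def \<delta>(2) p_def)
      qed
    qed
    finally show ?thesis unfolding \<Psi>_def .
  qed
  \<comment> \<open>Relabels the positions \<open>{..<k}\<close> by the elements of \<gamma>, so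
    that the event \<open>C\<close> on \<gamma> becomes an event on the first k positions.\<close>
  define r where "r y = (\<lambda>j\<in>\<gamma>. y (inv_into {..<k} a j))" for y :: "nat \<Rightarrow> 'a"
  have inv_a: "inv_into {..<k} a j < k" "a (inv_into {..<k} a j) = j" if "j \<in> \<gamma>" for j
    using bij_betw_apply[OF bij_betw_inv_into[OF a] that] bij_betw_inv_into_right[OF a that] by auto
  have r [measurable]: "r \<in> measurable (PS {..<k}) (PS \<gamma>)"
    unfolding r_def[abs_def] using inv_a by (intro measurable_restrict measurable_component_singleton) auto
  have [measurable]: "(\<lambda>y. restrict y {..<k}) \<in> measurable (PS {..<d}) (PS {..<k})"
    by (rule measurable_restrict_subset) (use kd in auto)
  note C [measurable]
  have [measurable]: "\<psi>s k \<in> borel_measurable (PS {..<k})" by (rule psis_meas[OF k])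
  have r1: "r (subset_obs X \<gamma> \<omega>) = obs \<gamma> \<omega>" for \<omega>
    using inv_a by (auto simp: r_def obs_def subset_obs_def k_def[symmetric] a_def[symmetric] fun_eq_iff)
  have r2: "r (restrict (\<lambda>i\<in>{..<d}. X (\<pi> i) \<omega>) {..<k}) = obs \<gamma> \<omega>" for \<omega>
    using inv_a less_le_trans[OF inv_a(1) kd] by (auto simp: r_def obs_def \<pi>_def fun_eq_iff)
  have r3: "restrict (first_obs X d \<omega>) {..<k} = first_obs X k \<omega>" for \<omega>
    using kd by (auto simp: first_obs_def fun_eq_iff)
  let ?C = "r -` C \<inter> space (PS {..<k})"
  have C': "?C \<in> sets (PS {..<k})" by measurable
  have ind: "indicator ?C (first_obs X k \<omega>) = (indicator C (r (first_obs X k \<omega>)) :: real)" if "\<omega> \<in> space M" for \<omega>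
    using measurable_space[OF measurable_first_obs[of k] that] kd dn by (simp add: indicator_def)
  have "expectation (\<lambda>\<omega>. indicator C (obs \<gamma> \<omega>) * T \<gamma> \<omega>)
    = expectation (\<lambda>\<omega>. indicator C (r (subset_obs X \<gamma> \<omega>)) * \<psi>s k (subset_obs X \<gamma> \<omega>))"
    by (simp add: r1 T_def k_def)
  also have "\<dots> = expectation (\<lambda>\<omega>. indicator C (r (first_obs X k \<omega>)) * \<psi>s k (first_obs X k \<omega>))"
    using subset_obs_transfer(1)[of \<gamma> "\<lambda>y. indicator C (r y) * \<psi>s k y"] \<gamma>(1) \<delta>(1)
    by (simp add: k_def[symmetric])
  also have "\<dots> = expectation (\<lambda>\<omega>. indicator ?C (first_obs X k \<omega>) * \<psi>s k (first_obs X k \<omega>))"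
    by (rule Bochner_Integration.integral_cong) (simp_all only: ind)
  also have "\<dots> = expectation (\<lambda>\<omega>. indicator ?C (first_obs X k \<omega>) * \<psi> (first_obs X d \<omega>))"
    by (rule projection_int[OF k C'])
  also have "\<dots> = expectation (\<lambda>\<omega>. indicator C (r (restrict (first_obs X d \<omega>) {..<k})) * \<psi> (first_obs X d \<omega>))"
    by (rule Bochner_Integration.integral_cong) (simp_all only: ind r3)
  also have "\<dots> = expectation (\<lambda>\<omega>. indicator C (r (restrict (\<lambda>i\<in>{..<d}. X (\<pi> i) \<omega>) {..<k})) * \<psi> (\<lambda>i\<in>{..<d}. X (\<pi> i) \<omega>))"
    by (rule reindexed_obs_transfer(1)[symmetric, OF _ _ dn, where G = "\<lambda>y. indicator C (r (restrict y {..<k})) * \<psi> y"])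
      (use \<pi> \<delta>(1) bij_betw_imp_inj_on[OF \<pi>] bij_betw_imp_surj_on[OF \<pi>] in \<open>auto\<close>)
  also have "\<dots> = expectation (\<lambda>\<omega>. indicator C (obs \<gamma> \<omega>) * \<Psi> \<delta> \<omega>)"
    by (rule Bochner_Integration.integral_cong) (simp_all only: r2 \<Psi>)
  finally show ?thesis .
qed

text \<open>By independence this is a concrete version of the conditional mean of \<open>H\<close>
  given the observations in \<gamma>, when \<open>H\<close> depends on those in \<gamma> and \<eta>.
  An explicit integral is easier to handle than an abstract conditional expectation, since Fubini
  applies to it directly.\<close>

definition section_mean :: "nat set \<Rightarrow> nat set \<Rightarrow> ((nat \<Rightarrow> 'a) \<Rightarrow> real) \<Rightarrow> (nat \<Rightarrow> 'a) \<Rightarrow> real" where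
  "section_mean \<gamma> \<eta> H x = (\<integral>y. H (merge \<gamma> \<eta> (x, y)) \<partial>distr M (PS \<eta>) (obs \<eta>))"

text \<open>\<open>H (obs \<beta>)\<close> depends on the observations in \<alpha> only through the
  common indices, and the remaining block \<open>\<beta> - \<alpha>\<close> is independent of
  \<open>obs \<alpha>\<close>; Fubini integrates that block out.\<close>

lemma section_mean_int:
  fixes G H :: "(nat \<Rightarrow> 'a) \<Rightarrow> real"
  assumes \<alpha>: "\<alpha> \<subseteq> {..<n}" and \<beta>: "\<beta> \<subseteq> {..<n}"
    and G [measurable]: "G \<in> borel_measurable (PS \<alpha>)" and H [measurable]: "H \<in> borel_measurable (PS \<beta>)"
    and int: "integrable M (\<lambda>\<omega>. G (obs \<alpha> \<omega>) * H (obs \<beta> \<omega>))"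
  shows "expectation (\<lambda>\<omega>. G (obs \<alpha> \<omega>) * H (obs \<beta> \<omega>)) =
      expectation (\<lambda>\<omega>. G (obs \<alpha> \<omega>) * section_mean (\<alpha> \<inter> \<beta>) (\<beta> - \<alpha>) H (obs (\<alpha> \<inter> \<beta>) \<omega>))"
    and "integrable M (\<lambda>\<omega>. G (obs \<alpha> \<omega>) * section_mean (\<alpha> \<inter> \<beta>) (\<beta> - \<alpha>) H (obs (\<alpha> \<inter> \<beta>) \<omega>))"
    and "section_mean (\<alpha> \<inter> \<beta>) (\<beta> - \<alpha>) H \<in> borel_measurable (PS (\<alpha> \<inter> \<beta>))"
proof -
  let ?\<gamma> = "\<alpha> \<inter> \<beta>" and ?\<eta> = "\<beta> - \<alpha>"
  let ?\<nu> = "distr M (PS \<alpha>) (obs \<alpha>)" and ?\<mu> = "distr M (PS ?\<eta>) (obs ?\<eta>)"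
  have \<eta>: "?\<eta> \<subseteq> {..<n}" using \<beta> by auto
  have m\<alpha>[measurable]: "obs \<alpha> \<in> measurable M (PS \<alpha>)" using \<alpha> by simp
  have m\<eta>[measurable]: "obs ?\<eta> \<in> measurable M (PS ?\<eta>)" using \<eta> by simp
  interpret \<nu>: prob_space ?\<nu> by (rule prob_space_distr) simp
  interpret \<mu>: prob_space ?\<mu> by (rule prob_space_distr) simp
  interpret P: pair_sigma_finite ?\<nu> ?\<mu> ..
  have "?\<gamma> \<union> ?\<eta> = \<beta>" by auto
  then have mm: "merge ?\<gamma> ?\<eta> \<in> measurable (PS ?\<gamma> \<Otimes>\<^sub>M PS ?\<eta>) (PS \<beta>)"
    using measurable_merge[of ?\<gamma> ?\<eta> "\<lambda>_. S"] by simp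
  have mH [measurable]: "(\<lambda>p. H (merge ?\<gamma> ?\<eta> p)) \<in> borel_measurable (PS ?\<gamma> \<Otimes>\<^sub>M PS ?\<eta>)"
    by (rule measurable_compose[OF mm H])
  have mH' [measurable]: "(\<lambda>p. H (merge ?\<gamma> ?\<eta> p)) \<in> borel_measurable (PS ?\<gamma> \<Otimes>\<^sub>M ?\<mu>)"
    using mH by (simp cong: measurable_cong_sets)
  show ms: "section_mean ?\<gamma> ?\<eta> H \<in> borel_measurable (PS ?\<gamma>)"
    unfolding section_mean_def[abs_def] using \<mu>.borel_measurable_lebesgue_integral[of "\<lambda>x y. H (merge ?\<gamma> ?\<eta> (x, y))"] mH'
    by (simp add: case_prod_beta')
  have [measurable]: "(\<lambda>x. restrict x ?\<gamma>) \<in> measurable (PS \<alpha>) (PS ?\<gamma>)"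
    by (rule measurable_restrict_subset) auto
  define K where "K p = G (fst p) * H (merge ?\<gamma> ?\<eta> (restrict (fst p) ?\<gamma>, snd p))" for p
  have K [measurable]: "K \<in> borel_measurable (PS \<alpha> \<Otimes>\<^sub>M PS ?\<eta>)"
    unfolding K_def[abs_def] by measurable
  have iv: "indep_var (PS \<alpha>) (obs \<alpha>) (PS ?\<eta>) (obs ?\<eta>)"
    unfolding obs_def[abs_def] by (rule indep_var_restrict[OF indep]) (use \<alpha> \<eta> in auto)
  then have pair: "?\<nu> \<Otimes>\<^sub>M ?\<mu> = distr M (PS \<alpha> \<Otimes>\<^sub>M PS ?\<eta>) (\<lambda>\<omega>. (obs \<alpha> \<omega>, obs ?\<eta> \<omega>))"
    by (simp add: indep_var_distribution_eq)
  have mg: "merge ?\<gamma> ?\<eta> (obs ?\<gamma> \<omega>, obs ?\<eta> \<omega>) = obs \<beta> \<omega>" for \<omega>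
    by (auto simp: merge_def obs_def fun_eq_iff)
  have rs: "restrict (obs \<alpha> \<omega>) ?\<gamma> = obs ?\<gamma> \<omega>" for \<omega> by (auto simp: obs_def fun_eq_iff)
  have KX: "K (obs \<alpha> \<omega>, obs ?\<eta> \<omega>) = G (obs \<alpha> \<omega>) * H (obs \<beta> \<omega>)" for \<omega>
    by (simp add: K_def rs mg)
  have mp: "(\<lambda>\<omega>. (obs \<alpha> \<omega>, obs ?\<eta> \<omega>)) \<in> measurable M (PS \<alpha> \<Otimes>\<^sub>M PS ?\<eta>)" by measurable
  have intK: "integrable (?\<nu> \<Otimes>\<^sub>M ?\<mu>) K"
    unfolding pair using int integrable_distr_eq[OF mp K] by (simp add: KX)
  let ?h = "\<lambda>a. G a * section_mean ?\<gamma> ?\<eta> H (restrict a ?\<gamma>)"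
  have h [measurable]: "?h \<in> borel_measurable (PS \<alpha>)" using ms by measurable
  have inner: "(\<integral>y. K (a, y) \<partial>?\<mu>) = ?h a" for a
    by (simp add: K_def section_mean_def)
  have "expectation (\<lambda>\<omega>. G (obs \<alpha> \<omega>) * H (obs \<beta> \<omega>)) = integral\<^sup>L (?\<nu> \<Otimes>\<^sub>M ?\<mu>) K"
    unfolding pair using integral_distr[OF mp K] by (simp add: KX)
  also have "\<dots> = integral\<^sup>L ?\<nu> ?h"
    using P.integral_fst'[OF intK] by (simp only: inner)
  also have "\<dots> = expectation (\<lambda>\<omega>. ?h (obs \<alpha> \<omega>))" by (rule integral_distr[OF m\<alpha> h])
  finally show "expectation (\<lambda>\<omega>. G (obs \<alpha> \<omega>) * H (obs \<beta> \<omega>)) =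
      expectation (\<lambda>\<omega>. G (obs \<alpha> \<omega>) * section_mean ?\<gamma> ?\<eta> H (obs ?\<gamma> \<omega>))"
    by (simp only: rs)
  have "integrable ?\<nu> ?h" using P.integrable_fst'[OF intK] by (simp only: inner)
  then show "integrable M (\<lambda>\<omega>. G (obs \<alpha> \<omega>) * section_mean ?\<gamma> ?\<eta> H (obs ?\<gamma> \<omega>))"
    using integrable_distr_eq[OF m\<alpha> h] by (simp only: rs)
qed

text \<open>Tower property. Over every event determined by \<gamma>, \<open>T \<gamma>\<close> and
  \<open>T \<beta>\<close> have the same integral, namely that of the kernel on a common d-set, and
  so does the section mean of \<open>T \<beta>\<close>; being functions of
  \<open>obs \<gamma>\<close>, \<open>T \<gamma>\<close> and the section mean agree almost
  everywhere.\<close>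

lemma T_section_mean:
  assumes \<gamma>: "\<gamma> \<subseteq> \<beta>" "\<gamma> \<noteq> {}" and \<beta>: "\<beta> \<subseteq> {..<n}" "card \<beta> \<in> {1..d}"
  shows "AE \<omega> in M. T \<gamma> \<omega> = section_mean \<gamma> (\<beta> - \<gamma>) (t \<beta>) (obs \<gamma> \<omega>)"
proof -
  have fin: "finite \<beta>" "finite \<gamma>" using \<beta>(1) \<gamma>(1) by (meson finite_lessThan finite_subset)+
  have \<gamma>n: "\<gamma> \<subseteq> {..<n}" using \<gamma>(1) \<beta>(1) by auto
  have c\<gamma>: "card \<gamma> \<in> {1..d}"
    using card_mono[OF fin(1) \<gamma>(1)] \<beta>(2) \<gamma>(2) fin(2) by (auto simp: Suc_le_eq card_gt_0_iff)
  \<comment> \<open>Such a \<delta> exists inside the sample because \<open>d \<le> n\<close>; one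
    \<delta> has to serve both \<gamma> and \<beta>.\<close>
  obtain \<delta> where \<delta>: "\<beta> \<subseteq> \<delta>" "\<delta> \<subseteq> {..<n}" "card \<delta> = d"
    using exists_subset_between[of \<beta> d "{..<n}"] \<beta> dn by auto
  let ?g = "section_mean \<gamma> (\<beta> - \<gamma>) (t \<beta>)"
  let ?\<nu> = "distr M (PS \<gamma>) (obs \<gamma>)"
  have m [measurable]: "obs \<gamma> \<in> measurable M (PS \<gamma>)" using \<gamma>n by simp
  have t\<gamma> [measurable]: "t \<gamma> \<in> borel_measurable (PS \<gamma>)" by (rule t_meas[OF fin(2) c\<gamma>])
  have t\<beta> [measurable]: "t \<beta> \<in> borel_measurable (PS \<beta>)" by (rule t_meas[OF fin(1) \<beta>(2)])
  have T\<beta>: "integrable M (T \<beta>)" and T\<gamma>: "integrable M (T \<gamma>)"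
    using T_moments \<beta> \<gamma>n c\<gamma> by auto
  have \<gamma>\<beta>: "\<gamma> \<inter> \<beta> = \<gamma>" using \<gamma>(1) by auto
  have cross: "expectation (\<lambda>\<omega>. G (obs \<gamma> \<omega>) * T \<beta> \<omega>) = expectation (\<lambda>\<omega>. G (obs \<gamma> \<omega>) * ?g (obs \<gamma> \<omega>))"
      "integrable M (\<lambda>\<omega>. G (obs \<gamma> \<omega>) * ?g (obs \<gamma> \<omega>))" "?g \<in> borel_measurable (PS \<gamma>)"
    if "G \<in> borel_measurable (PS \<gamma>)" "integrable M (\<lambda>\<omega>. G (obs \<gamma> \<omega>) * T \<beta> \<omega>)" for G :: "(nat \<Rightarrow> 'a) \<Rightarrow> real"
    using section_mean_int[OF \<gamma>n \<beta>(1) that(1) t\<beta>] that(2) unfolding \<gamma>\<beta> T_eq[OF fin(1)] by auto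
  have g [measurable]: "?g \<in> borel_measurable (PS \<gamma>)" using cross(3)[of "\<lambda>_. 1"] T\<beta> by simp
  have gi: "integrable M (\<lambda>\<omega>. ?g (obs \<gamma> \<omega>))" using cross(2)[of "\<lambda>_. 1"] T\<beta> by simp
  have "AE x in ?\<nu>. t \<gamma> x = ?g x"
  proof (rule density_unique_real)
    show "integrable ?\<nu> (t \<gamma>)"
      using T\<gamma> by (simp add: integrable_distr_eq T_eq[OF fin(2), abs_def])
    show "integrable ?\<nu> ?g" using gi by (simp add: integrable_distr_eq)
    fix C assume "C \<in> sets ?\<nu>"
    then have C [measurable]: "C \<in> sets (PS \<gamma>)" by simp
    \<comment> \<open>The event on \<gamma> seen as a cylinder over \<beta>, which makes
      \<open>T_projection_int\<close> applicable to \<beta> as well.\<close>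
    let ?C = "(\<lambda>x. restrict x \<gamma>) -` C \<inter> space (PS \<beta>)"
    have [measurable]: "(\<lambda>x. restrict x \<gamma>) \<in> measurable (PS \<beta>) (PS \<gamma>)"
      by (rule measurable_restrict_subset[OF \<gamma>(1)])
    have C': "?C \<in> sets (PS \<beta>)" by measurable
    have rs: "restrict (obs \<beta> \<omega>) \<gamma> = obs \<gamma> \<omega>" for \<omega> using \<gamma>(1) by (auto simp: obs_def fun_eq_iff)
    have ind: "indicator ?C (obs \<beta> \<omega>) = (indicator C (obs \<gamma> \<omega>) :: real)" if "\<omega> \<in> space M" for \<omega>
      using measurable_space[OF measurable_obs[OF \<beta>(1)] that] by (simp add: indicator_def rs)
    have "integrable M (\<lambda>\<omega>. indicator (obs \<gamma> -` C \<inter> space M) \<omega> *\<^sub>R T \<beta> \<omega>)"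
      by (rule integrable_mult_indicator[OF _ T\<beta>]) measurable
    then have i\<beta>: "integrable M (\<lambda>\<omega>. indicator C (obs \<gamma> \<omega>) * T \<beta> \<omega>)"
      by (rule Bochner_Integration.integrable_cong[THEN iffD1, rotated -1]) (auto simp: indicator_def)
    have "expectation (\<lambda>\<omega>. indicator C (obs \<gamma> \<omega>) * T \<gamma> \<omega>) = expectation (\<lambda>\<omega>. indicator C (obs \<gamma> \<omega>) * \<Psi> \<delta> \<omega>)"
      using \<gamma>(1) \<delta> by (intro T_projection_int c\<gamma> C) auto
    also have "\<dots> = expectation (\<lambda>\<omega>. indicator ?C (obs \<beta> \<omega>) * \<Psi> \<delta> \<omega>)"
      by (rule Bochner_Integration.integral_cong) (simp_all only: ind)
    also have "\<dots> = expectation (\<lambda>\<omega>. indicator ?C (obs \<beta> \<omega>) * T \<beta> \<omega>)"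
      by (rule T_projection_int[symmetric, OF \<delta>(1) \<beta>(2) \<delta>(2,3) C'])
    also have "\<dots> = expectation (\<lambda>\<omega>. indicator C (obs \<gamma> \<omega>) * T \<beta> \<omega>)"
      by (rule Bochner_Integration.integral_cong) (simp_all only: ind)
    also have "\<dots> = expectation (\<lambda>\<omega>. indicator C (obs \<gamma> \<omega>) * ?g (obs \<gamma> \<omega>))"
      by (rule cross(1)[OF _ i\<beta>]) measurable
    finally have eq: "expectation (\<lambda>\<omega>. indicator C (obs \<gamma> \<omega>) * t \<gamma> (obs \<gamma> \<omega>)) =
      expectation (\<lambda>\<omega>. indicator C (obs \<gamma> \<omega>) * ?g (obs \<gamma> \<omega>))" by (simp only: T_eq[OF fin(2)])
    show "(\<integral>x\<in>C. t \<gamma> x \<partial>?\<nu>) = (\<integral>x\<in>C. ?g x \<partial>?\<nu>)"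
      unfolding set_lebesgue_integral_def real_scaleR_def
      using eq integral_distr[OF m, of "\<lambda>x. indicator C x * t \<gamma> x"] integral_distr[OF m, of "\<lambda>x. indicator C x * ?g x"]
      by simp
  qed
  then show ?thesis using AE_distrD[OF m] unfolding T_eq[OF fin(2)] by blast
qed

text \<open>Against a function of \<open>obs \<alpha>\<close>, \<open>T \<beta>\<close> may be
  replaced by its conditional mean \<open>T (\<alpha> \<inter> \<beta>)\<close>; doing this once
  more with the roles exchanged leaves \<open>E T(\<alpha> \<inter> \<beta>)^2\<close>. Disjoint
  index sets give independent centred variables.\<close>

theorem T_covariance:
  assumes \<alpha>: "\<alpha> \<subseteq> {..<n}" "card \<alpha> \<in> {1..d}" and \<beta>: "\<beta> \<subseteq> {..<n}" "card \<beta> \<in> {1..d}"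
  shows "expectation (\<lambda>\<omega>. T \<alpha> \<omega> * T \<beta> \<omega>) = v (card (\<alpha> \<inter> \<beta>))"
proof (cases "\<alpha> \<inter> \<beta> = {}")
  case True
  have fin: "finite \<alpha>" "finite \<beta>" using \<alpha>(1) \<beta>(1) by (meson finite_lessThan finite_subset)+
  have "indep_var (PS \<alpha>) (obs \<alpha>) (PS \<beta>) (obs \<beta>)"
    unfolding obs_def[abs_def] by (rule indep_var_restrict[OF indep True \<alpha>(1) \<beta>(1)])
  from indep_var_compose[OF this t_meas[OF fin(1) \<alpha>(2)] t_meas[OF fin(2) \<beta>(2)]]
  have "indep_var borel (T \<alpha>) borel (T \<beta>)"
    by (simp add: comp_def T_eq[OF fin(1), abs_def] T_eq[OF fin(2), abs_def])
  from indep_var_lebesgue_integral[OF this] T_moments[OF \<alpha>] T_moments[OF \<beta>]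
  show ?thesis by (simp add: True v_def)
next
  case False
  have step: "expectation (\<lambda>\<omega>. T \<alpha> \<omega> * T \<beta> \<omega>) = expectation (\<lambda>\<omega>. T \<alpha> \<omega> * T (\<alpha> \<inter> \<beta>) \<omega>)"
    if \<alpha>: "\<alpha> \<subseteq> {..<n}" "card \<alpha> \<in> {1..d}" and \<beta>: "\<beta> \<subseteq> {..<n}" "card \<beta> \<in> {1..d}" and ne: "\<alpha> \<inter> \<beta> \<noteq> {}" for \<alpha> \<beta>
  proof -
    have fin: "finite \<alpha>" "finite \<beta>" using \<alpha>(1) \<beta>(1) by (meson finite_lessThan finite_subset)+
    let ?\<gamma> = "\<alpha> \<inter> \<beta>"
    let ?g = "section_mean ?\<gamma> (\<beta> - \<alpha>) (t \<beta>)"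
    have d: "\<beta> - ?\<gamma> = \<beta> - \<alpha>" by auto
    have AE: "AE \<omega> in M. T ?\<gamma> \<omega> = ?g (obs ?\<gamma> \<omega>)"
      using T_section_mean[of ?\<gamma> \<beta>] ne \<beta> unfolding d by auto
    note sm = section_mean_int[OF \<alpha>(1) \<beta>(1) t_meas[OF fin(1) \<alpha>(2)] t_meas[OF fin(2) \<beta>(2)],
        folded T_eq[OF fin(1)] T_eq[OF fin(2)], OF T_mult_integrable[OF \<alpha> \<beta>]]
    have c: "card ?\<gamma> \<in> {1..d}"
      using card_mono[OF fin(1), of ?\<gamma>] \<alpha>(2) ne fin by (auto simp: Suc_le_eq card_gt_0_iff)
    have "?\<gamma> \<subseteq> {..<n}" using \<alpha>(1) by auto
    then have [measurable]: "T ?\<gamma> \<in> borel_measurable M" "T \<alpha> \<in> borel_measurable M"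
      using T_meas[OF _ c] T_meas[OF \<alpha>] by auto
    have "expectation (\<lambda>\<omega>. T \<alpha> \<omega> * T \<beta> \<omega>) = expectation (\<lambda>\<omega>. T \<alpha> \<omega> * ?g (obs ?\<gamma> \<omega>))"
      by (rule sm(1))
    also have "\<dots> = expectation (\<lambda>\<omega>. T \<alpha> \<omega> * T ?\<gamma> \<omega>)"
    proof (rule integral_cong_AE)
      show "(\<lambda>\<omega>. T \<alpha> \<omega> * ?g (obs ?\<gamma> \<omega>)) \<in> borel_measurable M"
        using sm(2) by (rule borel_measurable_integrable)
      show "AE \<omega> in M. T \<alpha> \<omega> * ?g (obs ?\<gamma> \<omega>) = T \<alpha> \<omega> * T ?\<gamma> \<omega>"
        using AE by eventually_elim simp
    qed measurable
    finally show ?thesis .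
  qed
  have fin: "finite \<alpha>" "finite \<beta>" using \<alpha>(1) \<beta>(1) by (meson finite_lessThan finite_subset)+
  let ?\<gamma> = "\<alpha> \<inter> \<beta>"
  have \<gamma>: "?\<gamma> \<subseteq> {..<n}" "card ?\<gamma> \<in> {1..d}"
    using card_mono[OF fin(1), of ?\<gamma>] \<alpha> False fin by (auto simp: Suc_le_eq card_gt_0_iff)
  have "?\<gamma> \<inter> \<alpha> = ?\<gamma>" by auto
  then have "expectation (\<lambda>\<omega>. T ?\<gamma> \<omega> * T \<alpha> \<omega>) = expectation (\<lambda>\<omega>. (T ?\<gamma> \<omega>)\<^sup>2)"
    using step[OF \<gamma> \<alpha>] False by (simp add: power2_eq_square)
  then show ?thesis
    using step[OF \<alpha> \<beta> False] T_moments(6)[OF \<gamma>] by (simp add: mult.commute)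
qed

end

section \<open>Second moments of the U-statistics\<close>

text \<open>The count is \<open>(n - j) choose (k - j)\<close>. The product form avoids truncated
  subtraction and remains true when \<open>j > k\<close> or \<open>k > n\<close>, where both sides
  vanish.\<close>

lemma card_supersets:
  assumes \<gamma>: "\<gamma> \<subseteq> {..<n::nat}" "card \<gamma> = j"
  shows "card {\<alpha>. \<alpha> \<subseteq> {..<n} \<and> card \<alpha> = k \<and> \<gamma> \<subseteq> \<alpha>} * (n choose j) = (n choose k) * (k choose j)"
proof (cases "j \<le> k \<and> k \<le> n")
  case True
  have fin: "finite \<gamma>" using \<gamma>(1) by (meson finite_lessThan finite_subset)
  let ?B = "{\<eta>. \<eta> \<subseteq> {..<n} - \<gamma> \<and> card \<eta> = k - j}"
  have "{\<alpha>. \<alpha> \<subseteq> {..<n} \<and> card \<alpha> = k \<and> \<gamma> \<subseteq> \<alpha>} = (\<lambda>\<eta>. \<gamma> \<union> \<eta>) ` ?B"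
  proof (intro equalityI subsetI)
    fix \<alpha> assume \<alpha>: "\<alpha> \<in> {\<alpha>. \<alpha> \<subseteq> {..<n} \<and> card \<alpha> = k \<and> \<gamma> \<subseteq> \<alpha>}"
    then have "\<alpha> = \<gamma> \<union> (\<alpha> - \<gamma>)" by auto
    moreover have "\<alpha> - \<gamma> \<in> ?B" using \<alpha> \<gamma> fin by (auto simp: card_Diff_subset)
    ultimately show "\<alpha> \<in> (\<lambda>\<eta>. \<gamma> \<union> \<eta>) ` ?B" by blast
  next
    fix \<alpha> assume "\<alpha> \<in> (\<lambda>\<eta>. \<gamma> \<union> \<eta>) ` ?B"
    then obtain \<eta> where \<eta>: "\<alpha> = \<gamma> \<union> \<eta>" "\<eta> \<subseteq> {..<n} - \<gamma>" "card \<eta> = k - j" by auto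
    then have "finite \<eta>" by (meson finite_Diff finite_lessThan finite_subset)
    then have "card \<alpha> = k" using \<eta> \<gamma> fin True by (subst \<eta>(1), subst card_Un_disjoint) auto
    then show "\<alpha> \<in> {\<alpha>. \<alpha> \<subseteq> {..<n} \<and> card \<alpha> = k \<and> \<gamma> \<subseteq> \<alpha>}" using \<eta> \<gamma> by auto
  qed
  moreover have "inj_on (\<lambda>\<eta>. \<gamma> \<union> \<eta>) ?B" by (rule inj_onI) auto
  ultimately have "card {\<alpha>. \<alpha> \<subseteq> {..<n} \<and> card \<alpha> = k \<and> \<gamma> \<subseteq> \<alpha>} = card ?B"
    by (simp add: card_image)
  also have "\<dots> = (n - j) choose (k - j)"
    using \<gamma> fin by (subst n_subsets) (simp_all add: card_Diff_subset)
  finally show ?thesis using choose_mult[of j k n] True by (simp add: mult.commute)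
next
  case False
  have "{\<alpha>. \<alpha> \<subseteq> {..<n} \<and> card \<alpha> = k \<and> \<gamma> \<subseteq> \<alpha>} = {}"
  proof (rule ccontr)
    assume "{\<alpha>. \<alpha> \<subseteq> {..<n} \<and> card \<alpha> = k \<and> \<gamma> \<subseteq> \<alpha>} \<noteq> {}"
    then obtain \<alpha> where \<alpha>: "\<alpha> \<subseteq> {..<n}" "card \<alpha> = k" "\<gamma> \<subseteq> \<alpha>" by auto
    have "finite \<alpha>" using \<alpha>(1) by (meson finite_lessThan finite_subset)
    then have "j \<le> k" using \<alpha> \<gamma> card_mono by blast
    moreover have "k \<le> n" using card_mono[OF _ \<alpha>(1)] \<alpha>(2) by simp
    ultimately show False using False by simp
  qed
  then have "card {\<alpha>. \<alpha> \<subseteq> {..<n} \<and> card \<alpha> = k \<and> \<gamma> \<subseteq> \<alpha>} = 0" by (simp only: card.empty)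
  moreover have "(n choose k) * (k choose j) = 0" using False by (auto simp: not_le)
  ultimately show ?thesis by (simp only: mult_zero_left)
qed

text \<open>Up to normalisation these are the factorial moments of a hypergeometric variable. The
  binomial coefficient counts the j-sets contained in both \<alpha> and \<beta>; after summing over
  those first, the sums over \<alpha> and \<beta> factorise.\<close>

lemma sum_choose_card_inter:
  assumes j: "j \<le> n"
  shows "(\<Sum>\<alpha> | \<alpha> \<subseteq> {..<n::nat} \<and> card \<alpha> = k. \<Sum>\<beta> | \<beta> \<subseteq> {..<n} \<and> card \<beta> = l. real (card (\<alpha> \<inter> \<beta>) choose j))
    = real (n choose k) * real (n choose l) * (real (k choose j) * real (l choose j) / real (n choose j))"
proof -
  let ?A = "\<lambda>k. {\<alpha>. \<alpha> \<subseteq> {..<n} \<and> card \<alpha> = k}"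
  have finA: "finite (?A k)" for k by (rule finite_subset[of _ "Pow {..<n}"]) auto
  have cnj: "real (n choose j) \<noteq> 0" using j by simp
  have count: "real (card (\<alpha> \<inter> \<beta>) choose j) = (\<Sum>\<gamma>\<in>?A j. of_bool (\<gamma> \<subseteq> \<alpha>) * of_bool (\<gamma> \<subseteq> \<beta>))"
    if "\<alpha> \<in> ?A k" for \<alpha> \<beta> k
  proof -
    have fin: "finite (\<alpha> \<inter> \<beta>)" using that finite_subset[of \<alpha> "{..<n}"] by simp
    have "(\<Sum>\<gamma>\<in>?A j. of_bool (\<gamma> \<subseteq> \<alpha>) * of_bool (\<gamma> \<subseteq> \<beta>) :: real) = (\<Sum>\<gamma>\<in>?A j. of_bool (\<gamma> \<subseteq> \<alpha> \<inter> \<beta>))"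
      by (rule sum.cong) auto
    also have "\<dots> = real (card (?A j \<inter> {\<gamma>. \<gamma> \<subseteq> \<alpha> \<inter> \<beta>}))" using finA by (simp add: sum.If_cases of_bool_def)
    also have "?A j \<inter> {\<gamma>. \<gamma> \<subseteq> \<alpha> \<inter> \<beta>} = {\<gamma>. \<gamma> \<subseteq> \<alpha> \<inter> \<beta> \<and> card \<gamma> = j}" using that by auto
    also have "real (card \<dots>) = real (card (\<alpha> \<inter> \<beta>) choose j)" by (subst n_subsets[OF fin]) simp
    finally show ?thesis by simp
  qed
  have sup: "(\<Sum>\<alpha>\<in>?A k. of_bool (\<gamma> \<subseteq> \<alpha>)) = real (n choose k) * real (k choose j) / real (n choose j)"
    if "\<gamma> \<in> ?A j" for \<gamma> k
  proof -
    have "(\<Sum>\<alpha>\<in>?A k. of_bool (\<gamma> \<subseteq> \<alpha>)) = real (card (?A k \<inter> {\<alpha>. \<gamma> \<subseteq> \<alpha>}))" using finA by (simp add: sum.If_cases of_bool_def)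
    also have "?A k \<inter> {\<alpha>. \<gamma> \<subseteq> \<alpha>} = {\<alpha>. \<alpha> \<subseteq> {..<n} \<and> card \<alpha> = k \<and> \<gamma> \<subseteq> \<alpha>}" by auto
    also have "real (card \<dots>) = real (n choose k) * real (k choose j) / real (n choose j)"
    proof -
      have "card {\<alpha>. \<alpha> \<subseteq> {..<n} \<and> card \<alpha> = k \<and> \<gamma> \<subseteq> \<alpha>} * (n choose j) = (n choose k) * (k choose j)"
        using that by (intro card_supersets) auto
      from this[THEN arg_cong[where f = real]] cnj show ?thesis
        unfolding of_nat_mult by (rule eq_divide_imp[OF _ , rotated])
    qed
    finally show ?thesis .
  qed
  have "(\<Sum>\<alpha>\<in>?A k. \<Sum>\<beta>\<in>?A l. real (card (\<alpha> \<inter> \<beta>) choose j))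
    = (\<Sum>\<alpha>\<in>?A k. \<Sum>\<beta>\<in>?A l. \<Sum>\<gamma>\<in>?A j. of_bool (\<gamma> \<subseteq> \<alpha>) * of_bool (\<gamma> \<subseteq> \<beta>))"
    by (intro sum.cong refl count)
  also have "\<dots> = (\<Sum>\<alpha>\<in>?A k. \<Sum>\<gamma>\<in>?A j. \<Sum>\<beta>\<in>?A l. of_bool (\<gamma> \<subseteq> \<alpha>) * of_bool (\<gamma> \<subseteq> \<beta>))"
    by (intro sum.cong refl sum.swap)
  also have "\<dots> = (\<Sum>\<gamma>\<in>?A j. \<Sum>\<alpha>\<in>?A k. \<Sum>\<beta>\<in>?A l. of_bool (\<gamma> \<subseteq> \<alpha>) * of_bool (\<gamma> \<subseteq> \<beta>))"
    by (rule sum.swap)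
  also have "\<dots> = (\<Sum>\<gamma>\<in>?A j. (\<Sum>\<alpha>\<in>?A k. of_bool (\<gamma> \<subseteq> \<alpha>)) * (\<Sum>\<beta>\<in>?A l. of_bool (\<gamma> \<subseteq> \<beta>)))"
    by (simp only: sum_product)
  also have "\<dots> = (\<Sum>\<gamma>\<in>?A j. (real (n choose k) * real (k choose j) / real (n choose j)) *
      (real (n choose l) * real (l choose j) / real (n choose j)))"
    by (rule sum.cong[OF refl]) (simp only: sup)
  also have "\<dots> = real (n choose j) * ((real (n choose k) * real (k choose j) / real (n choose j)) *
      (real (n choose l) * real (l choose j) / real (n choose j)))"
    using n_subsets[of "{..<n}" j] by simp
  also have "\<dots> = real (n choose k) * real (n choose l) * (real (k choose j) * real (l choose j) / real (n choose j))"
    using cnj by (simp add: field_simps)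
  finally show ?thesis .
qed

lemma real_choose_two: "real (n choose 2) = real n * (real n - 1) / 2"
  by (induction n) (simp_all add: numeral_2_eq_2 field_simps)

text \<open>Turns the exact j = 2 count, with the factor n of the normalisation, into a clean power
  of d over n.\<close>

lemma choose_two_ratio_le:
  assumes "k \<le> d" "l \<le> d" "d \<le> n"
  shows "real n * (real (k choose 2) * real (l choose 2) / real (n choose 2)) \<le> real d ^ 4 / (2 * real n)"
proof (cases "n \<ge> 2 \<and> d \<ge> 1")
  case True
  then have n: "real n > 1" "real d \<ge> 1" "real d \<le> real n" using assms by simp_all
  have le: "real (k choose 2) \<le> real d * (real d - 1) / 2" if "k \<le> d" for k
    unfolding real_choose_two[symmetric] using binomial_right_mono[OF that, of 2] by simp
  have "real n * (real (k choose 2) * real (l choose 2) / real (n choose 2))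
    = real (k choose 2) * real (l choose 2) * (2 / (real n - 1))"
    using n by (simp add: real_choose_two[of n] field_simps)
  also have "\<dots> \<le> (real d * (real d - 1) / 2) * (real d * (real d - 1) / 2) * (2 / (real n - 1))"
    using n by (intro mult_right_mono mult_mono le assms) auto
  also have "\<dots> = real d ^ 2 * (real d - 1) / 2 * ((real d - 1) / (real n - 1))"
    using n by (simp add: field_simps power2_eq_square)
  also have "\<dots> \<le> real d ^ 2 * real d / 2 * (real d / real n)"
  proof (intro mult_mono)
    \<comment> \<open>Cross-multiplied, this is just \<open>d \<le> n\<close>.\<close>
    show "(real d - 1) / (real n - 1) \<le> real d / real n"
      using n by (simp add: field_simps)
  qed (use n in auto)
  also have "\<dots> = real d ^ 4 / (2 * real n)"
    using n by (simp add: field_simps power4_eq_xxxx power2_eq_square)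
  finally show ?thesis .
next
  \<comment> \<open>Includes \<open>n < 2\<close>, where the denominator \<open>n choose 2\<close>
    is 0; in all these cases \<open>d \<le> 1\<close>, so the numerator vanishes too.\<close>
  case False
  then have "d \<le> 1" using assms by auto
  then have "k < 2" using assms by simp
  then show ?thesis by (simp add: binomial_eq_0)
qed

section \<open>Covariances of the normalised statistics\<close>

context u_statistic
begin

abbreviation "w \<equiv> W_stat X n \<psi>s"

lemma w_eq: "w k \<omega> = sqrt (real n) * inverse (real (n choose k)) * (\<Sum>\<alpha> | \<alpha> \<subseteq> {..<n} \<and> card \<alpha> = k. T \<alpha> \<omega>)"
  unfolding W_stat_def U_stat_def T_def by (intro arg_cong2[where f = "(*)"] refl sum.cong) auto

lemma w_moments:
  assumes k: "k \<in> {1..d}"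
  shows "integrable M (w k)" "expectation (w k) = 0"
  unfolding w_eq[abs_def] using T_moments k by auto

lemma w_covariance:
  assumes k: "k \<in> {1..d}" and l: "l \<in> {1..d}"
  shows "integrable M (\<lambda>\<omega>. w k \<omega> * w l \<omega>)"
    "expectation (\<lambda>\<omega>. w k \<omega> * w l \<omega>) = real n / (real (n choose k) * real (n choose l)) *
      (\<Sum>\<alpha> | \<alpha> \<subseteq> {..<n} \<and> card \<alpha> = k. \<Sum>\<beta> | \<beta> \<subseteq> {..<n} \<and> card \<beta> = l. v (card (\<alpha> \<inter> \<beta>)))"
proof -
  have eq: "w k \<omega> * w l \<omega> = real n / (real (n choose k) * real (n choose l)) *
      (\<Sum>\<alpha> | \<alpha> \<subseteq> {..<n} \<and> card \<alpha> = k. \<Sum>\<beta> | \<beta> \<subseteq> {..<n} \<and> card \<beta> = l. T \<alpha> \<omega> * T \<beta> \<omega>)" for \<omega>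
  proof -
    have "w k \<omega> * w l \<omega> = (sqrt (real n) * sqrt (real n)) * inverse (real (n choose k)) * inverse (real (n choose l)) *
      ((\<Sum>\<alpha> | \<alpha> \<subseteq> {..<n} \<and> card \<alpha> = k. T \<alpha> \<omega>) * (\<Sum>\<beta> | \<beta> \<subseteq> {..<n} \<and> card \<beta> = l. T \<beta> \<omega>))"
      unfolding w_eq by (simp only: mult_ac)
    then show ?thesis unfolding sum_product by (simp add: divide_inverse mult.assoc)
  qed
  have int: "integrable M (\<lambda>\<omega>. T \<alpha> \<omega> * T \<beta> \<omega>)"
    if "\<alpha> \<in> {\<alpha>. \<alpha> \<subseteq> {..<n} \<and> card \<alpha> = k}" "\<beta> \<in> {\<alpha>. \<alpha> \<subseteq> {..<n} \<and> card \<alpha> = l}" for \<alpha> \<beta>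
    using that k l by (intro T_mult_integrable) auto
  show "integrable M (\<lambda>\<omega>. w k \<omega> * w l \<omega>)"
    unfolding eq by (intro integrable_mult_right Bochner_Integration.integrable_sum int)
  show "expectation (\<lambda>\<omega>. w k \<omega> * w l \<omega>) = real n / (real (n choose k) * real (n choose l)) *
      (\<Sum>\<alpha> | \<alpha> \<subseteq> {..<n} \<and> card \<alpha> = k. \<Sum>\<beta> | \<beta> \<subseteq> {..<n} \<and> card \<beta> = l. v (card (\<alpha> \<inter> \<beta>)))"
    unfolding eq integral_mult_right_zero
  proof (rule arg_cong[where f = "(*) _"])
    have "expectation (\<lambda>\<omega>. \<Sum>\<alpha> | \<alpha> \<subseteq> {..<n} \<and> card \<alpha> = k. \<Sum>\<beta> | \<beta> \<subseteq> {..<n} \<and> card \<beta> = l. T \<alpha> \<omega> * T \<beta> \<omega>)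
      = (\<Sum>\<alpha> | \<alpha> \<subseteq> {..<n} \<and> card \<alpha> = k. expectation (\<lambda>\<omega>. \<Sum>\<beta> | \<beta> \<subseteq> {..<n} \<and> card \<beta> = l. T \<alpha> \<omega> * T \<beta> \<omega>))"
      by (intro Bochner_Integration.integral_sum Bochner_Integration.integrable_sum int)
    also have "\<dots> = (\<Sum>\<alpha> | \<alpha> \<subseteq> {..<n} \<and> card \<alpha> = k. \<Sum>\<beta> | \<beta> \<subseteq> {..<n} \<and> card \<beta> = l. expectation (\<lambda>\<omega>. T \<alpha> \<omega> * T \<beta> \<omega>))"
      by (intro sum.cong refl Bochner_Integration.integral_sum int)
    also have "\<dots> = (\<Sum>\<alpha> | \<alpha> \<subseteq> {..<n} \<and> card \<alpha> = k. \<Sum>\<beta> | \<beta> \<subseteq> {..<n} \<and> card \<beta> = l. v (card (\<alpha> \<inter> \<beta>)))"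
      by (intro sum.cong refl T_covariance) (use k l in auto)
    finally show "expectation (\<lambda>\<omega>. \<Sum>\<alpha> | \<alpha> \<subseteq> {..<n} \<and> card \<alpha> = k. \<Sum>\<beta> | \<beta> \<subseteq> {..<n} \<and> card \<beta> = l. T \<alpha> \<omega> * T \<beta> \<omega>)
      = (\<Sum>\<alpha> | \<alpha> \<subseteq> {..<n} \<and> card \<alpha> = k. \<Sum>\<beta> | \<beta> \<subseteq> {..<n} \<and> card \<beta> = l. v (card (\<alpha> \<inter> \<beta>)))" .
  qed
qed

lemma v_bounds: "0 \<le> v k" "k \<le> d \<Longrightarrow> v k \<le> sqrt \<rho>"
proof -
  have \<rho>0: "0 \<le> \<rho>" by simp
  show "0 \<le> v k" by (simp add: v_def)
  assume kd: "k \<le> d"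
  show "v k \<le> sqrt \<rho>"
  proof (cases "k = 0")
    case True
    then show ?thesis using \<rho>0 by (simp add: v_def)
  next
    case False
    then have \<alpha>: "{..<k} \<subseteq> {..<n}" "card {..<k} \<in> {1..d}" using kd dn by auto
    note T = T_moments[OF \<alpha>]
    let ?m = "v k"
    \<comment> \<open>The right-hand side is the variance of the squared projection, so its
      nonnegativity says \<open>(E T^2)^2 \<le> E T^4 \<le> \<rho>\<close>.\<close>
    have "0 \<le> expectation (\<lambda>\<omega>. ((T {..<k} \<omega>)\<^sup>2 - ?m)\<^sup>2)" by simp
    also have "(\<lambda>\<omega>. ((T {..<k} \<omega>)\<^sup>2 - ?m)\<^sup>2) = (\<lambda>\<omega>. T {..<k} \<omega> ^ 4 - 2 * ?m * (T {..<k} \<omega>)\<^sup>2 + ?m\<^sup>2)"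
      by (simp add: power2_diff mult_ac fun_eq_iff)
    also have "expectation \<dots> = expectation (\<lambda>\<omega>. T {..<k} \<omega> ^ 4) - 2 * ?m * ?m + ?m\<^sup>2"
      using T by (simp add: prob_space)
    finally have "?m\<^sup>2 \<le> \<rho>" using T(2) by (simp add: power2_eq_square)
    then show ?thesis by (rule real_le_rsqrt)
  qed
qed

text \<open>The subtracted term is the covariance of \<open>k W_1\<close> and \<open>l W_1\<close>,
  so \<open>D\<close> is the part of the covariance that the linearization misses.\<close>

abbreviation "D k l \<equiv> expectation (\<lambda>\<omega>. w k \<omega> * w l \<omega>) - real k * real l * v 1"

text \<open>Replacing \<open>v J\<close> by \<open>J * v 1\<close>, with J the size of the overlap,
  and summing by the j = 1 count gives exactly \<open>k l v 1\<close>. The replacement error is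
  dominated by a multiple of \<open>J choose 2\<close>, which the j = 2 count sums.\<close>

lemma w_covariance_linearized:
  assumes k: "k \<in> {1..d}" and l: "l \<in> {1..d}"
  shows "\<bar>D k l\<bar> \<le> 2 * sqrt \<rho> * (real n * (real (k choose 2) * real (l choose 2) / real (n choose 2)))"
proof -
  let ?A = "\<lambda>k. {\<alpha>. \<alpha> \<subseteq> {..<n} \<and> card \<alpha> = k}"
  have pos: "0 < real (n choose k)" "0 < real (n choose l)" using k l dn by auto
  define c where "c = real n / (real (n choose k) * real (n choose l))"
  have c0: "0 \<le> c" by (simp add: c_def)
  have "c * (\<Sum>\<alpha>\<in>?A k. \<Sum>\<beta>\<in>?A l. real (card (\<alpha> \<inter> \<beta>)) * v 1)
    = v 1 * c * (\<Sum>\<alpha>\<in>?A k. \<Sum>\<beta>\<in>?A l. real (card (\<alpha> \<inter> \<beta>) choose 1))"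
    by (simp add: sum_distrib_left sum_distrib_right mult_ac)
  also have "\<dots> = real k * real l * v 1"
    unfolding sum_choose_card_inter[of 1, OF n0[unfolded Suc_le_eq[symmetric] One_nat_def[symmetric]]]
    using pos n0 by (simp add: c_def field_simps)
  finally have lin: "real k * real l * v 1 = c * (\<Sum>\<alpha>\<in>?A k. \<Sum>\<beta>\<in>?A l. real (card (\<alpha> \<inter> \<beta>)) * v 1)" by simp
  have Dkl: "D k l = c * (\<Sum>\<alpha>\<in>?A k. \<Sum>\<beta>\<in>?A l. v (card (\<alpha> \<inter> \<beta>)) - real (card (\<alpha> \<inter> \<beta>)) * v 1)"
    unfolding lin w_covariance(2)[OF k l] c_def[symmetric] by (simp add: sum_subtractf right_diff_distrib)
  have "\<bar>D k l\<bar> \<le> c * (\<Sum>\<alpha>\<in>?A k. \<Sum>\<beta>\<in>?A l. 2 * sqrt \<rho> * real (card (\<alpha> \<inter> \<beta>) choose 2))"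
  proof -
    have "\<bar>v (card (\<alpha> \<inter> \<beta>)) - real (card (\<alpha> \<inter> \<beta>)) * v 1\<bar> \<le> 2 * sqrt \<rho> * real (card (\<alpha> \<inter> \<beta>) choose 2)"
      if "\<alpha> \<in> ?A k" for \<alpha> \<beta>
    proof -
      define J where "J = card (\<alpha> \<inter> \<beta>)"
      have "finite \<alpha>" using that finite_subset[of \<alpha> "{..<n}"] by simp
      then have "J \<le> k" unfolding J_def using that card_mono[of \<alpha> "\<alpha> \<inter> \<beta>"] by auto
      then have Jd: "J \<le> d" using k by simp
      have v1: "0 \<le> v 1" "v 1 \<le> sqrt \<rho>" using v_bounds[of 1] d1 by auto
      have "\<bar>v J - real J * v 1\<bar> \<le> 2 * sqrt \<rho> * real (J choose 2)"
      \<comment> \<open>For \<open>J \<ge> 2\<close> both \<open>v J\<close> and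
        \<open>J * v 1\<close> lie between 0 and the bound, since
        \<open>1 \<le> 2 (J choose 2)\<close> and \<open>J \<le> J (J - 1)\<close>. For
        \<open>J \<le> 1\<close> the difference is zero, using \<open>v 0 = 0\<close>.\<close>
      proof (cases "J \<ge> 2")
        case True
        have "real J * v 1 \<le> real J * sqrt \<rho>" using v1 by (simp add: mult_left_mono)
        also have "\<dots> \<le> (real J * (real J - 1)) * sqrt \<rho>" using True by (intro mult_right_mono) auto
        finally have 1: "real J * v 1 \<le> 2 * sqrt \<rho> * real (J choose 2)" by (simp add: real_choose_two mult_ac)
        have "1 \<le> J choose 2" using True by (simp add: Suc_le_eq)
        then have "sqrt \<rho> * 1 \<le> sqrt \<rho> * (2 * real (J choose 2))" by (intro mult_left_mono) auto
        then have 2: "v J \<le> 2 * sqrt \<rho> * real (J choose 2)" using v_bounds(2)[OF Jd] by simp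
        have "0 \<le> real J * v 1" using v1 by simp
        then show ?thesis using 1 2 v_bounds(1)[of J] unfolding abs_le_iff by linarith
      next
        case False
        then have "J = 0 \<or> J = 1" by auto
        then show ?thesis by (auto simp: v_def)
      qed
      then show ?thesis by (simp add: J_def)
    qed
    then show ?thesis unfolding Dkl abs_mult
      using c0 by (intro mult_mono order_trans[OF sum_abs] sum_mono) auto
  qed
  also have "\<dots> = 2 * sqrt \<rho> * (c * (\<Sum>\<alpha>\<in>?A k. \<Sum>\<beta>\<in>?A l. real (card (\<alpha> \<inter> \<beta>) choose 2)))"
    by (simp only: sum_distrib_left[symmetric]) (simp only: mult_ac)
  also have "\<dots> = 2 * sqrt \<rho> * (real n * (real (k choose 2) * real (l choose 2) / real (n choose 2)))"
  proof (cases "2 \<le> n")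
    case True
    show ?thesis unfolding sum_choose_card_inter[OF True] using pos by (simp add: c_def)
  next
    case False
    have "card (\<alpha> \<inter> \<beta>) choose 2 = 0" if "\<alpha> \<in> ?A k" for \<alpha> \<beta>
    proof -
      have "card (\<alpha> \<inter> \<beta>) \<le> n" using that card_mono[of "{..<n}" "\<alpha> \<inter> \<beta>"] by auto
      then show ?thesis using False by (simp add: binomial_eq_0)
    qed
    then show ?thesis using False by (simp add: binomial_eq_0)
  qed
  finally show ?thesis .
qed

lemma w_covariance_le:
  assumes "k \<in> {1..d}" "l \<in> {1..d}"
  shows "\<bar>D k l\<bar> \<le> sqrt \<rho> * real d ^ 4 / real n"
proof -
  have "\<bar>D k l\<bar> \<le> 2 * sqrt \<rho> * (real d ^ 4 / (2 * real n))"
    using assms dn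
    by (intro order_trans[OF w_covariance_linearized[OF assms]] mult_left_mono choose_two_ratio_le) auto
  then show ?thesis by simp
qed

text \<open>Equality holds because \<open>1 choose 2 = 0\<close>: sets overlapping a singleton share
  at most one point. Thus \<open>W_k - k W_1\<close> is uncorrelated with
  \<open>W_1\<close>.\<close>

lemma w_covariance_one:
  assumes "k \<in> {1..d}"
  shows "expectation (\<lambda>\<omega>. w k \<omega> * w 1 \<omega>) = real k * v 1"
  using w_covariance_linearized[OF assms, of 1] d1 by (simp add: binomial_eq_0)

text \<open>From \<open>v J \<le> sqrt \<rho> * J\<close>, valid also at J = 0. Its purpose is to
  bound the third moments of the Gaussian summands.\<close>

lemma w_variance_le:
  assumes k: "k \<in> {1..d}"
  shows "expectation (\<lambda>\<omega>. w k \<omega> * w k \<omega>) \<le> sqrt \<rho> * (real d)\<^sup>2"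
proof -
  let ?A = "\<lambda>k. {\<alpha>. \<alpha> \<subseteq> {..<n} \<and> card \<alpha> = k}"
  have pos: "0 < real (n choose k)" using k dn by auto
  define c where "c = real n / (real (n choose k) * real (n choose k))"
  have c0: "0 \<le> c" by (simp add: c_def)
  have "v (card (\<alpha> \<inter> \<beta>)) \<le> sqrt \<rho> * real (card (\<alpha> \<inter> \<beta>) choose 1)" if "\<alpha> \<in> ?A k" for \<alpha> \<beta>
  proof -
    have "finite \<alpha>" using that finite_subset[of \<alpha> "{..<n}"] by simp
    then have "card (\<alpha> \<inter> \<beta>) \<le> d" using that k card_mono[of \<alpha> "\<alpha> \<inter> \<beta>"] by auto
    from v_bounds(2)[OF this] show ?thesis
      by (cases "card (\<alpha> \<inter> \<beta>) = 0") (auto simp: v_def intro: order_trans[OF _ mult_left_mono[of 1]])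
  qed
  then have "expectation (\<lambda>\<omega>. w k \<omega> * w k \<omega>) \<le>
      c * (\<Sum>\<alpha>\<in>?A k. \<Sum>\<beta>\<in>?A k. sqrt \<rho> * real (card (\<alpha> \<inter> \<beta>) choose 1))"
    unfolding w_covariance(2)[OF k k] c_def[symmetric] using c0 by (intro mult_left_mono sum_mono) auto
  also have "\<dots> = sqrt \<rho> * c * (\<Sum>\<alpha>\<in>?A k. \<Sum>\<beta>\<in>?A k. real (card (\<alpha> \<inter> \<beta>) choose 1))"
    by (simp only: sum_distrib_left[symmetric]) (simp only: mult_ac)
  also have "\<dots> = sqrt \<rho> * (real k)\<^sup>2"
    unfolding sum_choose_card_inter[of 1, OF n0[unfolded Suc_le_eq[symmetric] One_nat_def[symmetric]]]
    using pos n0 by (simp add: c_def field_simps power2_eq_square)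
  also have "\<dots> \<le> sqrt \<rho> * (real d)\<^sup>2"
    using k by (intro mult_left_mono power_mono) auto
  finally show ?thesis .
qed

end

section \<open>The two error terms\<close>

text \<open>The cost of exchanging one summand. The laws need not share their covariance: with d^2
  entries and the Taylor factor 1/2, an entrywise mismatch \<open>e\<close> costs
  \<open>L2 d^2 e / 2\<close>.\<close>

lemma conv_op_diff_le_moments:
  fixes h :: "real ^ 'd::finite \<Rightarrow> real" and Y :: "'a \<Rightarrow> real ^ 'd" and Y' :: "'b \<Rightarrow> real ^ 'd"
  assumes h: "times_differentiable 3 h"
    and L2: "\<And>i j x. \<bar>partial_deriv i (partial_deriv j h) x\<bar> \<le> L2"
    and L3: "\<And>i j k x. \<bar>partial_deriv i (partial_deriv j (partial_deriv k h)) x\<bar> \<le> L3"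
    and M: "prob_space M" and Ym: "Y \<in> borel_measurable M"
    and Y1: "\<And>i. integrable M (\<lambda>\<omega>. Y \<omega> $ i)" "\<And>i. integral\<^sup>L M (\<lambda>\<omega>. Y \<omega> $ i) = 0"
    and Y2: "\<And>i j. integrable M (\<lambda>\<omega>. Y \<omega> $ i * Y \<omega> $ j)"
    and Y3: "integrable M (\<lambda>\<omega>. l1 (Y \<omega>) ^ 3)"
    and M': "prob_space M'" and Ym': "Y' \<in> borel_measurable M'"
    and Y1': "\<And>i. integrable M' (\<lambda>\<omega>. Y' \<omega> $ i)" "\<And>i. integral\<^sup>L M' (\<lambda>\<omega>. Y' \<omega> $ i) = 0"
    and Y2': "\<And>i j. integrable M' (\<lambda>\<omega>. Y' \<omega> $ i * Y' \<omega> $ j)"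
    and Y3': "integrable M' (\<lambda>\<omega>. l1 (Y' \<omega>) ^ 3)"
    and e: "\<And>i j. \<bar>integral\<^sup>L M (\<lambda>\<omega>. Y \<omega> $ i * Y \<omega> $ j) - integral\<^sup>L M' (\<lambda>\<omega>. Y' \<omega> $ i * Y' \<omega> $ j)\<bar> \<le> e"
  shows "\<bar>conv_op (distr M borel Y) h x - conv_op (distr M' borel Y') h x\<bar> \<le>
    L2 * (real CARD('d))\<^sup>2 * e / 2 + L3 / 6 * (integral\<^sup>L M (\<lambda>\<omega>. l1 (Y \<omega>) ^ 3) + integral\<^sup>L M' (\<lambda>\<omega>. l1 (Y' \<omega>) ^ 3))"
proof -
  have qg: "quadratic_growth (\<lambda>y. h (x + y))"
    by (rule quadratic_growth_shift[OF quadratic_growth_bounded_deriv2[OF h L2]])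
  then have hm: "(\<lambda>y. h (x + y)) \<in> borel_measurable borel" by (simp add: quadratic_growth_def)
  have sq: "norm y ^ 2 = (\<Sum>i\<in>UNIV. y $ i * y $ i)" for y :: "real ^ 'd"
    by (simp only: power2_norm_eq_inner inner_vec_def inner_real_def)
  have "integrable M (\<lambda>\<omega>. norm (Y \<omega>) ^ 2)" unfolding sq by (intro Bochner_Integration.integrable_sum Y2)
  then have hY: "integrable M (\<lambda>\<omega>. h (x + Y \<omega>))"
    by (rule prob_space.quadratic_growth_integrable[OF M qg Ym])
  have "integrable M' (\<lambda>\<omega>. norm (Y' \<omega>) ^ 2)" unfolding sq by (intro Bochner_Integration.integrable_sum Y2')
  then have hY': "integrable M' (\<lambda>\<omega>. h (x + Y' \<omega>))"
    by (rule prob_space.quadratic_growth_integrable[OF M' qg Ym'])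
  define H where "H = (\<lambda>j k. partial_deriv j (partial_deriv k h) x)"
  define m where "m = (\<lambda>j k. integral\<^sup>L M (\<lambda>\<omega>. Y \<omega> $ j * Y \<omega> $ k))"
  define m' where "m' = (\<lambda>j k. integral\<^sup>L M' (\<lambda>\<omega>. Y' \<omega> $ j * Y' \<omega> $ k))"
  have 1: "\<bar>conv_op (distr M borel Y) h x - (h x + (\<Sum>k\<in>UNIV. \<Sum>j\<in>UNIV. H j k * m j k) / 2)\<bar>
      \<le> L3 / 6 * integral\<^sup>L M (\<lambda>\<omega>. l1 (Y \<omega>) ^ 3)"
    unfolding conv_op_def integral_distr[OF Ym hm] H_def m_def
    by (rule prob_space.taylor3_expectation[OF M h L3 Y1 Y2 Y3 hY])
  have 2: "\<bar>conv_op (distr M' borel Y') h x - (h x + (\<Sum>k\<in>UNIV. \<Sum>j\<in>UNIV. H j k * m' j k) / 2)\<bar>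
      \<le> L3 / 6 * integral\<^sup>L M' (\<lambda>\<omega>. l1 (Y' \<omega>) ^ 3)"
    unfolding conv_op_def integral_distr[OF Ym' hm] H_def m'_def
    by (rule prob_space.taylor3_expectation[OF M' h L3 Y1' Y2' Y3' hY'])
  have "\<bar>(\<Sum>k\<in>UNIV. \<Sum>j\<in>UNIV. H j k * m j k) - (\<Sum>k\<in>UNIV. \<Sum>j\<in>UNIV. H j k * m' j k)\<bar>
      = \<bar>\<Sum>k\<in>UNIV. \<Sum>j\<in>UNIV. H j k * (m j k - m' j k)\<bar>"
    by (simp add: sum_subtractf right_diff_distrib)
  also have "\<dots> \<le> (\<Sum>k\<in>(UNIV :: 'd set). \<Sum>j\<in>(UNIV :: 'd set). L2 * e)"
  proof (intro order_trans[OF sum_abs] sum_mono)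
    fix j k
    show "\<bar>H j k * (m j k - m' j k)\<bar> \<le> L2 * e"
      unfolding abs_mult H_def m_def m'_def
      using L2[of j k x] by (intro mult_mono L2 e) auto
  qed
  also have "\<dots> = L2 * (real CARD('d))\<^sup>2 * e" by (simp add: power2_eq_square)
  finally show ?thesis using 1 2 unfolding distrib_left abs_le_iff by linarith
qed

text \<open>Young's inequality, with equality at \<open>|x| = c\<close>. Taking \<open>c\<close> to
  be a fourth-moment bound to the power 1/4 recovers the constant of Hoelder,
  \<open>E |x|^3 \<le> c^3\<close>. The proof rests on
  \<open>3 u^4 - 4 c u^3 + c^4 = (u - c)^2 (3 u^2 + 2 u c + c^2)\<close>.\<close>

lemma abs_cube_le_fourth:
  assumes "0 < (c::real)"
  shows "\<bar>x\<bar> ^ 3 \<le> 3 / 4 * x ^ 4 / c + c ^ 3 / 4"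
proof -
  define u where "u = \<bar>x\<bar>"
  have "0 \<le> (u - c)\<^sup>2 * (3 * u\<^sup>2 + 2 * u * c + c\<^sup>2)"
    using assms by (auto simp: u_def intro!: mult_nonneg_nonneg add_nonneg_nonneg)
  also have "\<dots> = 3 * u ^ 4 + c ^ 4 - 4 * (c * u ^ 3)"
    by (simp add: power2_eq_square power3_eq_cube power4_eq_xxxx algebra_simps)
  finally have "4 * (c * u ^ 3) \<le> 3 * u ^ 4 + c ^ 4" by simp
  then have "u ^ 3 \<le> 3 / 4 * u ^ 4 / c + c ^ 3 / 4"
    using assms by (simp add: field_simps power4_eq_xxxx power3_eq_cube)
  moreover have "u ^ 4 = x ^ 4" by (simp add: u_def)
  ultimately show ?thesis by (simp only: u_def)
qed

text \<open>A variant for variables whose second and fourth moments are both at hand, as for a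
  Gaussian.\<close>

lemma abs_cube_le_fourth_square:
  assumes "0 < (c::real)" "0 \<le> u"
  shows "u ^ 3 \<le> (u ^ 4 / c + c * u\<^sup>2) / 2"
proof -
  have "0 \<le> u\<^sup>2 * (u - c)\<^sup>2" by simp
  also have "\<dots> = u ^ 4 + c\<^sup>2 * u\<^sup>2 - 2 * (c * u ^ 3)"
    by (simp add: power2_eq_square power3_eq_cube power4_eq_xxxx algebra_simps)
  finally have "2 * (c * u ^ 3) \<le> u ^ 4 + c\<^sup>2 * u\<^sup>2" by simp
  then show ?thesis using assms by (simp add: field_simps power2_eq_square)
qed

lemma l1_square_le: "(l1 y)\<^sup>2 \<le> real CARD('d) * (\<Sum>i\<in>UNIV. (y $ i)\<^sup>2)"
  for y :: "real ^ 'd::finite"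
  using sum_squared_le_sum_of_squares[of "\<lambda>i. \<bar>y $ i\<bar>" UNIV] by (simp add: mult.commute)

lemma l1_fourth_le: "l1 y ^ 4 \<le> real CARD('d) ^ 3 * (\<Sum>i\<in>UNIV. (y $ i) ^ 4)"
  for y :: "real ^ 'd::finite"
proof -
  let ?d = "real CARD('d)"
  have "l1 y ^ 4 = ((l1 y)\<^sup>2)\<^sup>2" by simp
  also have "\<dots> \<le> (?d * (\<Sum>i\<in>UNIV. (y $ i)\<^sup>2))\<^sup>2"
    by (intro power_mono l1_square_le) simp
  also have "\<dots> = ?d\<^sup>2 * (\<Sum>i\<in>UNIV. (y $ i)\<^sup>2)\<^sup>2" by (simp add: power_mult_distrib)
  also have "\<dots> \<le> ?d\<^sup>2 * (?d * (\<Sum>i\<in>UNIV. (y $ i) ^ 4))"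
    using sum_squared_le_sum_of_squares[of "\<lambda>i. (y $ i)\<^sup>2" UNIV]
    by (intro mult_left_mono) (simp_all add: mult.commute)
  finally show ?thesis by (simp add: power2_eq_square power3_eq_cube mult.assoc)
qed

lemma (in std_normal_vec) l1_cube_moment:
  fixes A :: "real ^ 'd ^ 'e::finite"
  assumes s: "0 < s" and var: "\<And>i. (A ** transpose A) $ i $ i \<le> s\<^sup>2"
  shows "integrable N (\<lambda>\<omega>. l1 (A *v Z \<omega>) ^ 3)"
    and "expectation (\<lambda>\<omega>. l1 (A *v Z \<omega>) ^ 3) \<le> 2 * real CARD('e) ^ 3 * s ^ 3"
proof -
  let ?d = "real CARD('e)"
  have d: "0 < ?d" by simp
  \<comment> \<open>The natural scale of the \<open>l1\<close> norm of d coordinates of size s. With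
    it the fourth-moment term contributes \<open>3 d^3 s^3 / 2\<close>, the 3 being the Gaussian
    fourth moment, and the second-moment term \<open>d^3 s^3 / 2\<close>.\<close>
  define c where "c = ?d * s"
  have c: "0 < c" using s by (simp add: c_def)
  have nn: "0 \<le> (A ** transpose A) $ i $ i" for i
    by (simp add: matrix_matrix_mult_def transpose_def sum_nonneg)
  let ?B = "\<lambda>\<omega>. (?d ^ 3 * (\<Sum>i\<in>UNIV. ((A *v Z \<omega>) $ i) ^ 4) / c + c * (?d * (\<Sum>i\<in>UNIV. ((A *v Z \<omega>) $ i)\<^sup>2))) / 2"
  have int2: "integrable N (\<lambda>\<omega>. ((A *v Z \<omega>) $ i)\<^sup>2)" for i
    using linear_moments(3)[of A i i] by (simp add: power2_eq_square)
  have B: "integrable N ?B" using linear_moments(5)[of A] int2 by simp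
  have le: "l1 (A *v Z \<omega>) ^ 3 \<le> ?B \<omega>" for \<omega>
  proof -
    have "l1 (A *v Z \<omega>) ^ 3 \<le> (l1 (A *v Z \<omega>) ^ 4 / c + c * (l1 (A *v Z \<omega>))\<^sup>2) / 2"
      by (rule abs_cube_le_fourth_square[OF c]) (simp add: sum_nonneg)
    also have "\<dots> \<le> ?B \<omega>"
      using c by (intro divide_right_mono add_mono mult_left_mono l1_fourth_le l1_square_le) auto
    finally show ?thesis .
  qed
  have m: "(\<lambda>\<omega>. (A *v Z \<omega>) $ i) \<in> borel_measurable N" for i
    using linear_moments(1)[of A i] by (rule borel_measurable_integrable)
  show int: "integrable N (\<lambda>\<omega>. l1 (A *v Z \<omega>) ^ 3)"
  proof (rule Bochner_Integration.integrable_bound[OF B])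
    show "AE \<omega> in N. norm (l1 (A *v Z \<omega>) ^ 3) \<le> norm (?B \<omega>)"
    proof (rule AE_I2)
      fix \<omega>
      have "0 \<le> l1 (A *v Z \<omega>) ^ 3" by (simp add: sum_nonneg)
      then show "norm (l1 (A *v Z \<omega>) ^ 3) \<le> norm (?B \<omega>)" using le[of \<omega>] unfolding real_norm_def by linarith
    qed
  qed (use m in measurable)
  have "expectation (\<lambda>\<omega>. l1 (A *v Z \<omega>) ^ 3) \<le> expectation ?B"
    by (rule integral_mono[OF int B le])
  also have "\<dots> = (?d ^ 3 * (\<Sum>i\<in>UNIV. 3 * ((A ** transpose A) $ i $ i)\<^sup>2) / c + c * (?d * (\<Sum>i\<in>UNIV. (A ** transpose A) $ i $ i))) / 2"
    using linear_moments(4)[of A] linear_moments(5,6)[of A] int2 by (simp add: power2_eq_square)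
  also have "\<dots> \<le> (?d ^ 3 * (\<Sum>i\<in>(UNIV :: 'e set). 3 * (s\<^sup>2)\<^sup>2) / c + c * (?d * (\<Sum>i\<in>(UNIV :: 'e set). s\<^sup>2))) / 2"
    using c by (intro divide_right_mono add_mono mult_left_mono sum_mono power_mono var nn) auto
  also have "\<dots> = 2 * ?d ^ 3 * s ^ 3"
    using s d by (simp add: c_def field_simps power2_eq_square power3_eq_cube)
  finally show "expectation (\<lambda>\<omega>. l1 (A *v Z \<omega>) ^ 3) \<le> 2 * ?d ^ 3 * s ^ 3" .
qed

section \<open>The remainder of the linearization\<close>

context u_statistic
begin

lemma w_one_eq: "w 1 \<omega> = (\<Sum>m<n. T {m} \<omega> / sqrt n)"
proof -
  have "{\<alpha>. \<alpha> \<subseteq> {..<n} \<and> card \<alpha> = 1} = (\<lambda>m. {m}) ` {..<n}"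
    by (auto simp: card_1_singleton_iff)
  then have "(\<Sum>\<alpha> | \<alpha> \<subseteq> {..<n} \<and> card \<alpha> = 1. T \<alpha> \<omega>) = (\<Sum>m<n. T {m} \<omega>)"
    by (simp add: sum.reindex)
  moreover have "sqrt (real n) * inverse (real n) = 1 / sqrt n"
    using n0 by (simp add: field_simps)
  ultimately show ?thesis unfolding w_eq by (simp add: sum_divide_distrib)
qed

text \<open>Because the covariance of \<open>W_k\<close> with \<open>W_1\<close> is exactly
  \<open>k v 1\<close>, expanding the square collapses to \<open>D k k\<close>, which is of order
  1/n.\<close>

lemma linear_remainder_moments:
  assumes k: "k \<in> {1..d}"
  shows "integrable M (\<lambda>\<omega>. w k \<omega> - real k * w 1 \<omega>)" "expectation (\<lambda>\<omega>. w k \<omega> - real k * w 1 \<omega>) = 0"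
    "integrable M (\<lambda>\<omega>. (w k \<omega> - real k * w 1 \<omega>)\<^sup>2)"
    "expectation (\<lambda>\<omega>. (w k \<omega> - real k * w 1 \<omega>)\<^sup>2) \<le> sqrt \<rho> * real d ^ 4 / real n"
proof -
  have 1: "1 \<in> {1..d}" using d1 by simp
  note wk = w_moments[OF k] and w1 = w_moments[OF 1]
  note kk = w_covariance(1)[OF k k] and k1 = w_covariance(1)[OF k 1] and 11 = w_covariance(1)[OF 1 1]
  show "integrable M (\<lambda>\<omega>. w k \<omega> - real k * w 1 \<omega>)" "expectation (\<lambda>\<omega>. w k \<omega> - real k * w 1 \<omega>) = 0"
    using wk w1 by auto
  have eq: "(w k \<omega> - real k * w 1 \<omega>)\<^sup>2 = w k \<omega> * w k \<omega> - 2 * real k * (w k \<omega> * w 1 \<omega>) + (real k)\<^sup>2 * (w 1 \<omega> * w 1 \<omega>)" for \<omega>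
    by (simp add: power2_eq_square algebra_simps)
  show "integrable M (\<lambda>\<omega>. (w k \<omega> - real k * w 1 \<omega>)\<^sup>2)"
    unfolding eq by (intro Bochner_Integration.integrable_add Bochner_Integration.integrable_diff integrable_mult_right kk k1 11)
  have "expectation (\<lambda>\<omega>. (w k \<omega> - real k * w 1 \<omega>)\<^sup>2) =
    expectation (\<lambda>\<omega>. w k \<omega> * w k \<omega>) - 2 * real k * expectation (\<lambda>\<omega>. w k \<omega> * w 1 \<omega>)
      + (real k)\<^sup>2 * expectation (\<lambda>\<omega>. w 1 \<omega> * w 1 \<omega>)"
    unfolding eq using kk k1 11 by simp
  also have "\<dots> = D k k"
    unfolding w_covariance_one[OF k] w_covariance_one[OF 1] by (simp add: power2_eq_square)
  also have "\<dots> \<le> \<bar>D k k\<bar>" by (rule abs_ge_self)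
  also have "\<dots> \<le> sqrt \<rho> * real d ^ 4 / real n" by (rule w_covariance_le[OF k k])
  finally show "expectation (\<lambda>\<omega>. (w k \<omega> - real k * w 1 \<omega>)\<^sup>2) \<le> sqrt \<rho> * real d ^ 4 / real n" .
qed

text \<open>A deliberately crude bound on \<open>1 + ... + d\<close>, giving a pure power of
  d.\<close>

lemma sum_idx_le:
  assumes idx: "bij_betw idx (UNIV :: 'd::finite set) {1..d}"
  shows "(\<Sum>i\<in>UNIV. real (idx i)) \<le> (real d)\<^sup>2"
proof -
  have "(\<Sum>i\<in>(UNIV :: 'd set). real (idx i)) \<le> (\<Sum>i\<in>(UNIV :: 'd set). real d)"
    using bij_betw_apply[OF idx] by (intro sum_mono) auto
  also have "\<dots> = (real d)\<^sup>2"
    using bij_betw_same_card[OF idx] by (simp add: power2_eq_square)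
  finally show ?thesis .
qed

text \<open>Here \<open>x = a\<close> is the linear vector and \<open>y = r\<close> the remainder in
  the first-order expansion, leaving the expectation of \<open>(l1 a + l1 r) * l1 r\<close>. The
  mixed product gives the term \<open>d^5 / sqrt n\<close>, the square of \<open>l1 r\<close> the
  term \<open>d^6 / n\<close>.\<close>

lemma linearization_error:
  fixes h :: "real ^ 'd::finite \<Rightarrow> real" and idx :: "'d \<Rightarrow> nat"
  assumes h: "times_differentiable 3 h"
    and L2: "\<And>i j x. \<bar>partial_deriv i (partial_deriv j h) x\<bar> \<le> L2"
    and idx: "bij_betw idx UNIV {1..d}"
  shows "\<bar>expectation (\<lambda>\<omega>. h (\<chi> i. w (idx i) \<omega>)) - expectation (\<lambda>\<omega>. h (\<chi> i. real (idx i) * w 1 \<omega>))\<bar>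
    \<le> L2 * sqrt \<rho> * (real d ^ 5 / sqrt n + real d ^ 6 / real n)"
proof -
  have card: "CARD('d) = d" using bij_betw_same_card[OF idx] by simp
  have idx_mem: "idx i \<in> {1..d}" for i using bij_betw_apply[OF idx] by simp
  have one: "1 \<in> {1..d}" using d1 by simp
  have L2_0: "0 \<le> L2" using L2[of undefined undefined 0] by linarith
  define a where "a \<omega> = (\<chi> i. real (idx i) * w 1 \<omega>)" for \<omega>
  define r where "r \<omega> = (\<chi> i. w (idx i) \<omega> - real (idx i) * w 1 \<omega>)" for \<omega>
  define g where "g = (\<lambda>\<omega>. \<Sum>k\<in>UNIV. partial_deriv k h 0 * r \<omega> $ k)"
  have W: "(\<chi> i. w (idx i) \<omega>) = a \<omega> + r \<omega>" for \<omega>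
    by (simp add: a_def r_def vec_eq_iff)
  have wm [measurable]: "w k \<in> borel_measurable M" if "k \<in> {1..d}" for k
    using w_moments(1)[OF that] by (rule borel_measurable_integrable)
  note w1m = wm[OF one]
  have ma: "a \<in> borel_measurable M"
    unfolding a_def[abs_def] borel_measurable_vec_iff using w1m by simp
  have mW: "(\<lambda>\<omega>. \<chi> i. w (idx i) \<omega>) \<in> borel_measurable M"
    unfolding borel_measurable_vec_iff using wm[OF idx_mem] by simp
  note qg = quadratic_growth_bounded_deriv2[OF h L2]
  have sq: "norm y ^ 2 = (\<Sum>i\<in>UNIV. y $ i * y $ i)" for y :: "real ^ 'd"
    by (simp only: power2_norm_eq_inner inner_vec_def inner_real_def)
  have w11: "integrable M (\<lambda>\<omega>. (w 1 \<omega>)\<^sup>2)" "expectation (\<lambda>\<omega>. (w 1 \<omega>)\<^sup>2) \<le> sqrt \<rho>"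
    using w_covariance(1)[OF one one] w_covariance_one[OF one] v_bounds(2)[OF d1] by (simp_all add: power2_eq_square)
  have "integrable M (\<lambda>\<omega>. norm (a \<omega>) ^ 2)"
  proof -
    have "norm (a \<omega>) ^ 2 = (\<Sum>i\<in>UNIV. (real (idx i))\<^sup>2) * (w 1 \<omega>)\<^sup>2" for \<omega>
      unfolding sq sum_distrib_right by (simp add: a_def power2_eq_square mult_ac)
    then show ?thesis using w11 by simp
  qed
  then have ha: "integrable M (\<lambda>\<omega>. h (a \<omega>))" by (rule quadratic_growth_integrable[OF qg ma])
  have "integrable M (\<lambda>\<omega>. norm (\<chi> i. w (idx i) \<omega>) ^ 2)"
    unfolding sq by (simp add: w_covariance(1)[OF idx_mem idx_mem])
  from quadratic_growth_integrable[OF qg mW this] have hW: "integrable M (\<lambda>\<omega>. h (a \<omega> + r \<omega>))"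
    unfolding W .
  note R = linear_remainder_moments[OF idx_mem]
  have gi: "integrable M g" unfolding g_def using R(1) by (simp add: r_def)
  have gE: "expectation g = 0" unfolding g_def using R(1,2) by (simp add: r_def)
  \<comment> \<open>The remainder coordinates satisfy
    \<open>E r_i^2 \<le> sqrt \<rho> * \<kappa>^2\<close> while
    \<open>E W_1^2 \<le> sqrt \<rho>\<close>. Hence this weight balances the two halves of
    \<open>|W_1| |r_i| \<le> (\<kappa> W_1^2 + r_i^2 / \<kappa>) / 2\<close>, each with expectation
    at most \<open>\<kappa> sqrt \<rho> / 2\<close>.\<close>
  define \<kappa> where "\<kappa> = (real d)\<^sup>2 / sqrt n"
  have \<kappa>: "0 < \<kappa>" using d1 n0 by (simp add: \<kappa>_def)
  define B where "B = (\<lambda>\<omega>. (real d)\<^sup>2 * (\<Sum>i\<in>UNIV. (\<kappa> * (w 1 \<omega>)\<^sup>2 + (r \<omega> $ i)\<^sup>2 / \<kappa>) / 2) + real d * (\<Sum>i\<in>UNIV. (r \<omega> $ i)\<^sup>2))"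
  have r2: "integrable M (\<lambda>\<omega>. (r \<omega> $ i)\<^sup>2)" "expectation (\<lambda>\<omega>. (r \<omega> $ i)\<^sup>2) \<le> sqrt \<rho> * real d ^ 4 / real n" for i
    using R(3,4)[of i] by (simp_all add: r_def)
  have Bi: "integrable M B" unfolding B_def using w11(1) r2(1) by simp
  have le: "\<bar>h (a \<omega> + r \<omega>) - h (a \<omega>) - g \<omega>\<bar> \<le> L2 * B \<omega>" for \<omega>
  proof -
    have "\<bar>h (a \<omega> + r \<omega>) - h (a \<omega>) - g \<omega>\<bar> \<le> L2 * ((l1 (a \<omega>) + l1 (r \<omega>)) * l1 (r \<omega>))"
      using taylor1[OF h L2, of "a \<omega>" "r \<omega>"] by (simp add: g_def mult.assoc)
    also have "(l1 (a \<omega>) + l1 (r \<omega>)) * l1 (r \<omega>) \<le> B \<omega>"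
    proof -
      have "l1 (a \<omega>) = (\<Sum>i\<in>UNIV. real (idx i)) * \<bar>w 1 \<omega>\<bar>"
        by (simp add: a_def abs_mult sum_distrib_right)
      also have "\<dots> \<le> (real d)\<^sup>2 * \<bar>w 1 \<omega>\<bar>" by (intro mult_right_mono sum_idx_le idx) auto
      finally have "l1 (a \<omega>) * l1 (r \<omega>) \<le> (real d)\<^sup>2 * \<bar>w 1 \<omega>\<bar> * l1 (r \<omega>)"
        by (rule mult_right_mono) (simp add: sum_nonneg)
      also have "\<dots> = (real d)\<^sup>2 * (\<Sum>i\<in>UNIV. \<bar>w 1 \<omega>\<bar> * \<bar>r \<omega> $ i\<bar>)"
        by (simp add: sum_distrib_left mult.assoc)
      also have "\<dots> \<le> (real d)\<^sup>2 * (\<Sum>i\<in>UNIV. (\<kappa> * (w 1 \<omega>)\<^sup>2 + (r \<omega> $ i)\<^sup>2 / \<kappa>) / 2)"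
      proof (intro mult_left_mono sum_mono)
        fix i
        have "0 \<le> (\<kappa> * \<bar>w 1 \<omega>\<bar> - \<bar>r \<omega> $ i\<bar>)\<^sup>2" by simp
        also have "\<dots> = \<kappa>\<^sup>2 * (w 1 \<omega>)\<^sup>2 + (r \<omega> $ i)\<^sup>2 - 2 * \<kappa> * (\<bar>w 1 \<omega>\<bar> * \<bar>r \<omega> $ i\<bar>)"
          by (simp add: power2_diff power_mult_distrib)
        finally show "\<bar>w 1 \<omega>\<bar> * \<bar>r \<omega> $ i\<bar> \<le> (\<kappa> * (w 1 \<omega>)\<^sup>2 + (r \<omega> $ i)\<^sup>2 / \<kappa>) / 2"
          using \<kappa> by (simp add: field_simps power2_eq_square)
      qed simp
      finally have "l1 (a \<omega>) * l1 (r \<omega>) \<le> \<dots>" .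
      moreover have "l1 (r \<omega>) * l1 (r \<omega>) \<le> real d * (\<Sum>i\<in>UNIV. (r \<omega> $ i)\<^sup>2)"
        using l1_square_le[of "r \<omega>"] by (simp add: power2_eq_square card)
      ultimately show ?thesis unfolding B_def distrib_right by linarith
    qed
    finally show ?thesis using L2_0 by (simp add: mult_left_mono)
  qed
  have EB: "expectation B \<le> sqrt \<rho> * (real d ^ 5 / sqrt n + real d ^ 6 / real n)"
  proof -
    have "expectation B = (real d)\<^sup>2 * (\<Sum>i\<in>(UNIV :: 'd set). (\<kappa> * expectation (\<lambda>\<omega>. (w 1 \<omega>)\<^sup>2) + expectation (\<lambda>\<omega>. (r \<omega> $ i)\<^sup>2) / \<kappa>) / 2)
      + real d * (\<Sum>i\<in>UNIV. expectation (\<lambda>\<omega>. (r \<omega> $ i)\<^sup>2))"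
      unfolding B_def using w11(1) r2(1) by simp
    also have "\<dots> \<le> (real d)\<^sup>2 * (\<Sum>i\<in>(UNIV :: 'd set). (\<kappa> * sqrt \<rho> + (sqrt \<rho> * real d ^ 4 / real n) / \<kappa>) / 2)
      + real d * (\<Sum>i\<in>(UNIV :: 'd set). sqrt \<rho> * real d ^ 4 / real n)"
      using \<kappa> by (intro add_mono mult_left_mono sum_mono divide_right_mono w11 r2) auto
    also have "\<dots> = (real d)\<^sup>2 * (real d * ((\<kappa> * sqrt \<rho> + (sqrt \<rho> * real d ^ 4 / real n) / \<kappa>) / 2))
      + real d * (real d * (sqrt \<rho> * real d ^ 4 / real n))"
      by (simp add: card)
    also have "(sqrt \<rho> * real d ^ 4 / real n) / \<kappa> = sqrt \<rho> * \<kappa>"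
    proof -
      have "real d ^ 4 / real n = \<kappa> * \<kappa>"
        by (simp add: \<kappa>_def power2_eq_square power4_eq_xxxx)
      then show ?thesis using \<kappa> by (simp add: times_divide_eq_right[symmetric] del: times_divide_eq_right)
    qed
    also have "(real d)\<^sup>2 * (real d * ((\<kappa> * sqrt \<rho> + sqrt \<rho> * \<kappa>) / 2)) + real d * (real d * (sqrt \<rho> * real d ^ 4 / real n))
      = sqrt \<rho> * (real d ^ 5 / sqrt n + real d ^ 6 / real n)"
      by (simp add: \<kappa>_def eval_nat_numeral field_simps)
    finally show ?thesis .
  qed
  have "expectation (\<lambda>\<omega>. h (\<chi> i. w (idx i) \<omega>)) - expectation (\<lambda>\<omega>. h (\<chi> i. real (idx i) * w 1 \<omega>))
    = expectation (\<lambda>\<omega>. h (a \<omega> + r \<omega>) - h (a \<omega>) - g \<omega>)"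
    unfolding W a_def[symmetric] using hW ha gi gE by simp
  also have "\<bar>\<dots>\<bar> \<le> expectation (\<lambda>\<omega>. \<bar>h (a \<omega> + r \<omega>) - h (a \<omega>) - g \<omega>\<bar>)" by (rule integral_abs_bound)
  also have "\<dots> \<le> expectation (\<lambda>\<omega>. L2 * B \<omega>)"
    by (rule integral_mono[OF _ _ le]) (use hW ha gi Bi in auto)
  also have "\<dots> = L2 * expectation B" by simp
  also have "\<dots> \<le> L2 * (sqrt \<rho> * (real d ^ 5 / sqrt n + real d ^ 6 / real n))"
    by (rule mult_left_mono[OF EB L2_0])
  finally show ?thesis by (simp add: mult.assoc)
qed

end

section \<open>Exchanging the linear part for the Gaussian\<close>

context u_statistic
begin

text \<open>The Gaussian keeps the covariance of the full vector \<open>W\<close>, not that of the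
  linear part it replaces, so each exchange carries a covariance mismatch \<open>D / n\<close>
  besides the third-order term. The parameter \<open>q\<close> is the fourth root of \<rho>.\<close>

lemma lindeberg_error:
  fixes h :: "real ^ 'd::finite \<Rightarrow> real" and idx :: "'d \<Rightarrow> nat" and Z :: "'v \<Rightarrow> real ^ 'd"
  assumes h: "times_differentiable 3 h"
    and L2: "\<And>i j x. \<bar>partial_deriv i (partial_deriv j h) x\<bar> \<le> L2"
    and L3: "\<And>i j k x. \<bar>partial_deriv i (partial_deriv j (partial_deriv k h)) x\<bar> \<le> L3"
    and idx: "bij_betw idx UNIV {1..d}"
    and q: "0 < q" "\<rho> = q ^ 4"
    and Z: "standard_normal_vector N Z"
    and A: "\<And>i j. (A ** transpose A) $ i $ j = expectation (\<lambda>\<omega>. w (idx i) \<omega> * w (idx j) \<omega>)"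
  shows "\<bar>expectation (\<lambda>\<omega>. h (\<chi> i. real (idx i) * w 1 \<omega>)) - integral\<^sup>L N (\<lambda>\<omega>. h (A *v Z \<omega>))\<bar>
    \<le> L2 * q\<^sup>2 * real d ^ 6 / (2 * real n) + L3 * q ^ 3 * real d ^ 6 / (2 * sqrt n)"
proof -
  interpret Z: std_normal_vec N Z by unfold_locales (rule Z)
  have card: "CARD('d) = d" using bij_betw_same_card[OF idx] by simp
  have idx_mem: "idx i \<in> {1..d}" for i using bij_betw_apply[OF idx] by simp
  have L3_0: "0 \<le> L3" using L3[of undefined undefined undefined 0] by linarith
  have L2_0: "0 \<le> L2" using L2[of undefined undefined 0] by linarith
  have sq: "sqrt \<rho> = q\<^sup>2"
  proof -
    have "\<rho> = (q\<^sup>2)\<^sup>2" using q(2) by simp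
    then show ?thesis by (simp only: real_sqrt_abs abs_power2)
  qed
  have sn: "0 < sqrt n" "sqrt n * sqrt n = real n" using n0 by simp_all
  define \<xi> where "\<xi> m \<omega> = (\<chi> i. real (idx i) * (T {m} \<omega> / sqrt n))" for m \<omega>
  have sing: "{m} \<subseteq> {..<n}" "card {m} \<in> {1..d}" if "m < n" for m using that d1 by auto
  have ind: "indep_vars (\<lambda>_. borel) \<xi> {..<n}"
  proof -
    have "indep_vars (\<lambda>m. PS {m}) (\<lambda>m \<omega>. restrict (\<lambda>i. X i \<omega>) {m}) {..<n}"
      by (rule indep_vars_restrict[OF indep]) (auto simp: disjoint_family_on_def)
    moreover have "(\<lambda>x. \<chi> i. real (idx i) * (t {m} x / sqrt n)) \<in> borel_measurable (PS {m})" if "m \<in> {..<n}" for m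
      using t_meas[of "{m}"] sing(2)[of m] that by (subst borel_measurable_vec_iff) simp
    ultimately have "indep_vars (\<lambda>_. borel) (\<lambda>m \<omega>. \<chi> i. real (idx i) * (t {m} (restrict (\<lambda>i. X i \<omega>) {m}) / sqrt n)) {..<n}"
      by (rule indep_vars_compose2)
    then show ?thesis by (simp add: \<xi>_def[abs_def] T_eq obs_def)
  qed
  define \<mu> where "\<mu> = distr M borel (\<xi> 0)"
  have distr: "distr M borel (\<xi> m) = \<mu>" if m: "m < n" for m
  proof -
    let ?f = "\<lambda>x. \<chi> i. real (idx i) * (\<psi>s 1 x / sqrt n)"
    have f: "?f \<in> borel_measurable (PS {..<1})"
      using psis_meas[of 1] d1 by (subst borel_measurable_vec_iff) simp
    have law: "distr M borel (\<xi> m) = distr (PiM {..<1} (\<lambda>_. distr M S (X 0))) borel ?f" if m: "m < n" for m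
    proof -
      have so: "subset_obs X {m} = (\<lambda>\<omega>. \<lambda>i\<in>{..<1}. X m \<omega>)"
        by (auto simp: subset_obs_def fun_eq_iff)
      have meas: "subset_obs X {m} \<in> measurable M (PS {..<1})"
        unfolding so using m by (intro measurable_restrict) auto
      have "distr M (PS {..<1}) (subset_obs X {m}) = PiM {..<1} (\<lambda>_. distr M S (X 0))"
        unfolding so by (rule distr_reindexed_obs[where \<pi> = "\<lambda>_. m"]) (use m in \<open>auto simp: inj_on_def\<close>)
      moreover have "\<xi> m = ?f \<circ> subset_obs X {m}"
        by (simp add: \<xi>_def[abs_def] T_def comp_def)
      ultimately show ?thesis using distr_distr[OF f meas] by simp
    qed
    show ?thesis unfolding \<mu>_def law[OF m] law[OF n0] ..
  qed
  note T = T_moments[OF sing[OF n0]]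
  have T0m: "T {0} \<in> borel_measurable M" by (rule T_meas[OF sing[OF n0]])
  have \<xi>m: "\<xi> 0 \<in> borel_measurable M"
    unfolding \<xi>_def[abs_def] borel_measurable_vec_iff using T0m by simp
  have \<xi>1: "integrable M (\<lambda>\<omega>. \<xi> 0 \<omega> $ i)" "expectation (\<lambda>\<omega>. \<xi> 0 \<omega> $ i) = 0" for i
    using T(3,4) by (simp_all add: \<xi>_def)
  have \<xi>prod: "\<xi> 0 \<omega> $ i * \<xi> 0 \<omega> $ j = (real (idx i) * real (idx j) / real n) * (T {0} \<omega>)\<^sup>2" for i j \<omega>
    using sn(2) by (simp add: \<xi>_def power2_eq_square mult_ac)
  have \<xi>2: "integrable M (\<lambda>\<omega>. \<xi> 0 \<omega> $ i * \<xi> 0 \<omega> $ j)" for i j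
    unfolding \<xi>prod using T(5) by simp
  have E\<xi>2: "expectation (\<lambda>\<omega>. \<xi> 0 \<omega> $ i * \<xi> 0 \<omega> $ j) = real (idx i) * real (idx j) * v 1 / real n" for i j
    unfolding \<xi>prod using T(6) by simp
  \<comment> \<open>The vector \<open>\<xi> 0\<close> is the scalar \<open>T {0}\<close> times a
    fixed vector, and \<open>c\<close> is the \<open>l1\<close> norm of the latter, at most
    \<open>d^2 / sqrt n\<close>.\<close>
  define c where "c = (\<Sum>i\<in>(UNIV :: 'd set). real (idx i)) / sqrt n"
  have c0: "0 \<le> c" by (simp add: c_def sum_nonneg)
  have l1\<xi>: "l1 (\<xi> 0 \<omega>) ^ 3 = c ^ 3 * \<bar>T {0} \<omega>\<bar> ^ 3" for \<omega>
  proof -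
    have "l1 (\<xi> 0 \<omega>) = c * \<bar>T {0} \<omega>\<bar>"
      unfolding c_def sum_divide_distrib sum_distrib_right by (simp add: \<xi>_def abs_mult)
    then show ?thesis by (simp add: power_mult_distrib)
  qed
  have T3: "integrable M (\<lambda>\<omega>. \<bar>T {0} \<omega>\<bar> ^ 3)"
  proof (rule Bochner_Integration.integrable_bound)
    show "integrable M (\<lambda>\<omega>. 3 / 4 * T {0} \<omega> ^ 4 / q + q ^ 3 / 4)" using T(1) by simp
    show "AE \<omega> in M. norm (\<bar>T {0} \<omega>\<bar> ^ 3) \<le> norm (3 / 4 * T {0} \<omega> ^ 4 / q + q ^ 3 / 4)"
    proof (rule AE_I2)
      fix \<omega>
      have "0 \<le> \<bar>T {0} \<omega>\<bar> ^ 3" by simp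
      then show "norm (\<bar>T {0} \<omega>\<bar> ^ 3) \<le> norm (3 / 4 * T {0} \<omega> ^ 4 / q + q ^ 3 / 4)"
        using abs_cube_le_fourth[OF q(1), of "T {0} \<omega>"] unfolding real_norm_def by linarith
    qed
  qed (use T0m in measurable)
  have ET3: "expectation (\<lambda>\<omega>. \<bar>T {0} \<omega>\<bar> ^ 3) \<le> q ^ 3"
  proof -
    have "expectation (\<lambda>\<omega>. \<bar>T {0} \<omega>\<bar> ^ 3) \<le> expectation (\<lambda>\<omega>. 3 / 4 * T {0} \<omega> ^ 4 / q + q ^ 3 / 4)"
      by (rule integral_mono[OF T3]) (use T(1) abs_cube_le_fourth[OF q(1)] in simp_all)
    also have "\<dots> = 3 / 4 * expectation (\<lambda>\<omega>. T {0} \<omega> ^ 4) / q + q ^ 3 / 4"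
      using T(1) by (simp add: prob_space)
    also have "\<dots> \<le> 3 / 4 * q ^ 4 / q + q ^ 3 / 4"
      using T(2) q by (intro add_mono divide_right_mono mult_left_mono) auto
    also have "\<dots> = q ^ 3" using q(1) by (simp add: field_simps eval_nat_numeral)
    finally show ?thesis .
  qed
  have \<xi>3: "integrable M (\<lambda>\<omega>. l1 (\<xi> 0 \<omega>) ^ 3)" unfolding l1\<xi> using T3 by simp
  have E\<xi>3: "expectation (\<lambda>\<omega>. l1 (\<xi> 0 \<omega>) ^ 3) \<le> real d ^ 6 * q ^ 3 / sqrt n ^ 3"
  proof -
    have "expectation (\<lambda>\<omega>. l1 (\<xi> 0 \<omega>) ^ 3) = c ^ 3 * expectation (\<lambda>\<omega>. \<bar>T {0} \<omega>\<bar> ^ 3)"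
      unfolding l1\<xi> by simp
    also have "\<dots> \<le> ((real d)\<^sup>2 / sqrt n) ^ 3 * q ^ 3"
      using c0 sum_idx_le[OF idx] sn by (intro mult_mono power_mono ET3) (auto simp: c_def divide_right_mono)
    finally show ?thesis by (simp add: power_divide flip: power_mult)
  qed
  define \<eta> where "\<eta> \<omega> = inverse (sqrt n) *\<^sub>R (A *v Z \<omega>)" for \<omega>
  define \<gamma> where "\<gamma> = distr N borel \<eta>"
  have \<eta>nth: "\<eta> \<omega> $ i = inverse (sqrt n) * (A *v Z \<omega>) $ i" for \<omega> i by (simp add: \<eta>_def)
  note L = Z.linear_moments[of A]
  have \<eta>1: "integrable N (\<lambda>\<omega>. \<eta> \<omega> $ i)" "Z.expectation (\<lambda>\<omega>. \<eta> \<omega> $ i) = 0" for i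
    unfolding \<eta>nth using L(1,2) by simp_all
  have \<eta>m: "\<eta> \<in> borel_measurable N"
    unfolding borel_measurable_vec_iff using \<eta>1(1) borel_measurable_integrable by blast
  have \<eta>prod: "\<eta> \<omega> $ i * \<eta> \<omega> $ j = inverse (real n) * ((A *v Z \<omega>) $ i * (A *v Z \<omega>) $ j)" for i j \<omega>
  proof -
    have "inverse (sqrt n) * inverse (sqrt n) = inverse (real n)"
      using sn(2) by (metis inverse_mult_distrib)
    from this[symmetric] show ?thesis unfolding \<eta>nth by (simp only: mult_ac)
  qed
  have \<eta>2: "integrable N (\<lambda>\<omega>. \<eta> \<omega> $ i * \<eta> \<omega> $ j)" for i j
    unfolding \<eta>prod using L(3) by simp
  have E\<eta>2: "Z.expectation (\<lambda>\<omega>. \<eta> \<omega> $ i * \<eta> \<omega> $ j) = expectation (\<lambda>\<omega>. w (idx i) \<omega> * w (idx j) \<omega>) / real n" for i j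
    unfolding \<eta>prod using L(4) A by (simp add: divide_inverse)
  \<comment> \<open>\<open>q * d\<close> bounds the standard deviation of every coordinate of
    \<open>A Z\<close>, by \<open>w_variance_le\<close>.\<close>
  have qd: "0 < q * real d" using q d1 by simp
  have var: "(A ** transpose A) $ i $ i \<le> (q * real d)\<^sup>2" for i
    using w_variance_le[OF idx_mem[of i]] by (simp add: A sq power_mult_distrib)
  have l1\<eta>: "l1 (\<eta> \<omega>) ^ 3 = inverse (sqrt n ^ 3) * l1 (A *v Z \<omega>) ^ 3" for \<omega>
  proof -
    have "l1 (\<eta> \<omega>) = inverse (sqrt n) * l1 (A *v Z \<omega>)"
      unfolding \<eta>nth sum_distrib_left by (simp add: abs_mult)
    then show ?thesis by (simp only: power_mult_distrib power_inverse)
  qed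
  note l1Z = Z.l1_cube_moment[OF qd var]
  have \<eta>3: "integrable N (\<lambda>\<omega>. l1 (\<eta> \<omega>) ^ 3)" unfolding l1\<eta> using l1Z(1) by simp
  have E\<eta>3: "Z.expectation (\<lambda>\<omega>. l1 (\<eta> \<omega>) ^ 3) \<le> 2 * (real d ^ 6 * q ^ 3 / sqrt n ^ 3)"
  proof -
    have "Z.expectation (\<lambda>\<omega>. l1 (\<eta> \<omega>) ^ 3) = inverse (sqrt n ^ 3) * Z.expectation (\<lambda>\<omega>. l1 (A *v Z \<omega>) ^ 3)"
      unfolding l1\<eta> by simp
    also have "\<dots> \<le> inverse (sqrt n ^ 3) * (2 * real CARD('d) ^ 3 * (q * real d) ^ 3)"
      using sn by (intro mult_left_mono l1Z(2)) auto
    finally show ?thesis by (simp add: card divide_inverse power_mult_distrib eval_nat_numeral mult_ac)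
  qed
  \<comment> \<open>One factor 1/n is the size of \<open>D\<close>, the other comes from spreading
    the covariance over n summands; after n exchanges a total of order 1/n remains.\<close>
  define e where "e = q\<^sup>2 * real d ^ 4 / real n / real n"
  have cov: "\<bar>expectation (\<lambda>\<omega>. \<xi> 0 \<omega> $ i * \<xi> 0 \<omega> $ j) - Z.expectation (\<lambda>\<omega>. \<eta> \<omega> $ i * \<eta> \<omega> $ j)\<bar> \<le> e" for i j
  proof -
    have "\<bar>expectation (\<lambda>\<omega>. \<xi> 0 \<omega> $ i * \<xi> 0 \<omega> $ j) - Z.expectation (\<lambda>\<omega>. \<eta> \<omega> $ i * \<eta> \<omega> $ j)\<bar> = \<bar>D (idx i) (idx j)\<bar> / real n"
      unfolding E\<xi>2 E\<eta>2 diff_divide_distrib[symmetric] abs_divide by (simp add: abs_minus_commute)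
    also have "\<dots> \<le> e"
      unfolding e_def using w_covariance_le[OF idx_mem idx_mem, of i j] by (intro divide_right_mono) (simp_all add: sq)
    finally show ?thesis .
  qed
  have M: "prob_space M" by unfold_locales
  have N: "prob_space N" by unfold_locales
  note qg = quadratic_growth_bounded_deriv2[OF h L2]
  \<comment> \<open>A common unit for the third moments: at most \<open>b\<close> for \<xi> and
    \<open>2 b\<close> for \<eta>. Hence \<open>n * L3 / 6 * 3 b\<close> yields the coefficient 1/2
    of the \<open>L3\<close> term.\<close>
  define b where "b = real d ^ 6 * q ^ 3 / sqrt n ^ 3"
  have step: "\<bar>conv_op \<mu> h x - conv_op \<gamma> h x\<bar> \<le> L2 * (real d)\<^sup>2 * e / 2 + L3 / 6 * (b + 2 * b)" for x
  proof -
    have "\<bar>conv_op \<mu> h x - conv_op \<gamma> h x\<bar> \<le> L2 * (real d)\<^sup>2 * e / 2 +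
      L3 / 6 * (expectation (\<lambda>\<omega>. l1 (\<xi> 0 \<omega>) ^ 3) + Z.expectation (\<lambda>\<omega>. l1 (\<eta> \<omega>) ^ 3))"
      unfolding \<mu>_def \<gamma>_def card[symmetric]
      by (rule conv_op_diff_le_moments[OF h L2 L3 M \<xi>m \<xi>1 \<xi>2 \<xi>3 N \<eta>m \<eta>1 \<eta>2 \<eta>3 cov])
    also have "\<dots> \<le> L2 * (real d)\<^sup>2 * e / 2 + L3 / 6 * (b + 2 * b)"
      using L3_0 E\<xi>3 E\<eta>3 unfolding b_def by (intro add_left_mono mult_left_mono add_mono) auto
    finally show ?thesis .
  qed
  have sqn: "norm y ^ 2 = (\<Sum>i\<in>UNIV. y $ i * y $ i)" for y :: "real ^ 'd"
    by (simp only: power2_norm_eq_inner inner_vec_def inner_real_def)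
  have mu: "square_integrable_law \<mu>"
    unfolding \<mu>_def by (rule square_integrable_law_distr[OF \<xi>m]) (simp add: sqn \<xi>2)
  have gam: "square_integrable_law \<gamma>" and EZ: "integral\<^sup>L N (\<lambda>\<omega>. h (A *v Z \<omega>)) = (conv_op \<gamma> ^^ n) h 0"
    using gaussian_conv_op_power[OF Z n0 qg, of A] unfolding \<gamma>_def \<eta>_def[abs_def] by auto
  have "(\<chi> i. real (idx i) * w 1 \<omega>) = 0 + (\<Sum>m<n. \<xi> m \<omega>)" for \<omega>
    by (simp add: vec_eq_iff w_one_eq \<xi>_def sum_distrib_left del: One_nat_def)
  then have "expectation (\<lambda>\<omega>. h (\<chi> i. real (idx i) * w 1 \<omega>)) = expectation (\<lambda>\<omega>. h (0 + (\<Sum>m<n. \<xi> m \<omega>)))"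
    by simp
  also have "\<dots> = (conv_op \<mu> ^^ n) h 0"
    by (rule sum_conv_op(1)[OF ind distr mu qg]) auto
  finally have EX: "expectation (\<lambda>\<omega>. h (\<chi> i. real (idx i) * w 1 \<omega>)) = (conv_op \<mu> ^^ n) h 0" .
  have "\<bar>(conv_op \<mu> ^^ n) h 0 - (conv_op \<gamma> ^^ n) h 0\<bar> \<le> real n * (L2 * (real d)\<^sup>2 * e / 2 + L3 / 6 * (b + 2 * b))"
    by (rule conv_op_lindeberg[OF mu gam qg step])
  also have "\<dots> = L2 * q\<^sup>2 * real d ^ 6 / (2 * real n) + L3 * q ^ 3 * real d ^ 6 / (2 * sqrt n)"
  proof -
    have "real n * e = q\<^sup>2 * real d ^ 4 / real n" using n0 by (simp add: e_def)
    moreover have "real n * b = real d ^ 6 * q ^ 3 / sqrt n"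
    proof -
      have "sqrt n ^ 3 = sqrt n * real n" using sn(2) by (simp add: power3_eq_cube mult.assoc)
      then show ?thesis using n0 by (simp add: b_def)
    qed
    moreover have "real n * (L2 * (real d)\<^sup>2 * e / 2 + L3 / 6 * (b + 2 * b)) = L2 * (real d)\<^sup>2 * (real n * e) / 2 + L3 / 2 * (real n * b)"
      by (simp add: algebra_simps)
    ultimately have "real n * (L2 * (real d)\<^sup>2 * e / 2 + L3 / 6 * (b + 2 * b)) = L2 * (real d)\<^sup>2 * (q\<^sup>2 * real d ^ 4 / real n) / 2 + L3 / 2 * (real d ^ 6 * q ^ 3 / sqrt n)"
      by simp
    also have "\<dots> = L2 * q\<^sup>2 * real d ^ 6 / (2 * real n) + L3 * q ^ 3 * real d ^ 6 / (2 * sqrt n)"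
      by (simp add: eval_nat_numeral mult_ac)
    finally show ?thesis .
  qed
  finally show ?thesis unfolding EX EZ .
qed

end

section \<open>The normal approximation\<close>

lemma sup_deriv2_bound:
  assumes "sup_deriv2 h \<noteq> \<top>"
  shows "\<bar>partial_deriv i (partial_deriv j h) x\<bar> \<le> enn2real (sup_deriv2 h)"
proof -
  have "ennreal \<bar>partial_deriv i (partial_deriv j h) x\<bar> \<le> sup_deriv2 h"
    unfolding sup_deriv2_def by (intro SUP_upper2[OF UNIV_I]) (rule order_refl)
  also have "\<dots> = ennreal (enn2real (sup_deriv2 h))" using assms by (simp add: ennreal_enn2real_if)
  finally show ?thesis by simp
qed

lemma sup_deriv3_bound:
  assumes "sup_deriv3 h \<noteq> \<top>"
  shows "\<bar>partial_deriv i (partial_deriv j (partial_deriv k h)) x\<bar> \<le> enn2real (sup_deriv3 h)"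
proof -
  have "ennreal \<bar>partial_deriv i (partial_deriv j (partial_deriv k h)) x\<bar> \<le> sup_deriv3 h"
    unfolding sup_deriv3_def by (intro SUP_upper2[OF UNIV_I]) (rule order_refl)
  also have "\<dots> = ennreal (enn2real (sup_deriv3 h))" using assms by (simp add: ennreal_enn2real_if)
  finally show ?thesis by simp
qed

lemma (in prob_space) nonneg_definite_second_moment_matrix:
  fixes W :: "'a \<Rightarrow> real ^ 'd"
  assumes "\<And>i j. integrable M (\<lambda>\<omega>. W \<omega> $ i * W \<omega> $ j)"
  shows "nonneg_definite (second_moment_matrix M W)"
  unfolding nonneg_definite_def
proof (intro conjI allI)
  show "transpose (second_moment_matrix M W) = second_moment_matrix M W"
    by (simp add: transpose_def second_moment_matrix_def vec_eq_iff mult.commute)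
  fix x :: "real ^ 'd"
  have eq: "(x \<bullet> W \<omega>)\<^sup>2 = (\<Sum>i\<in>UNIV. \<Sum>j\<in>UNIV. x $ i * x $ j * (W \<omega> $ i * W \<omega> $ j))" for \<omega>
    unfolding inner_vec_def power2_eq_square sum_product by (simp add: mult_ac)
  have "x \<bullet> (second_moment_matrix M W *v x)
    = (\<Sum>i\<in>UNIV. \<Sum>j\<in>UNIV. x $ i * x $ j * expectation (\<lambda>\<omega>. W \<omega> $ i * W \<omega> $ j))"
    by (simp add: inner_vec_def matrix_vector_mult_def second_moment_matrix_def sum_distrib_left mult_ac)
  also have "\<dots> = expectation (\<lambda>\<omega>. (x \<bullet> W \<omega>)\<^sup>2)"
    unfolding eq using assms by simp
  also have "0 \<le> \<dots>" by simp
  finally show "0 \<le> x \<bullet> (second_moment_matrix M W *v x)" .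
qed

text \<open>By Jensen, \<rho> = 0 would force the first projection to vanish almost surely,
  contradicting non-degeneracy.\<close>

lemma (in u_statistic) fourth_moment_pos:
  assumes "prob {\<omega> \<in> space M. \<psi>s 1 (first_obs X 1 \<omega>) = 0} < 1"
  shows "0 < \<rho>"
proof (rule ccontr)
  assume "\<not> 0 < \<rho>"
  have one: "1 \<in> {1..d}" using d1 by simp
  note pm = projection_moment[OF one]
  have "expectation (\<lambda>\<omega>. \<psi>s 1 (first_obs X 1 \<omega>) ^ 4) = 0"
    using pm(2) \<open>\<not> 0 < \<rho>\<close> by (intro antisym) simp_all
  then have "AE \<omega> in M. \<psi>s 1 (first_obs X 1 \<omega>) ^ 4 = 0"
    by (subst (asm) integral_nonneg_eq_0_iff_AE[OF pm(1)]) auto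
  then have "AE \<omega> in M. \<psi>s 1 (first_obs X 1 \<omega>) = 0" by simp
  moreover have "(\<lambda>\<omega>. \<psi>s 1 (first_obs X 1 \<omega>)) \<in> borel_measurable M"
    using pm(3) by (rule borel_measurable_integrable)
  then have "{\<omega> \<in> space M. \<psi>s 1 (first_obs X 1 \<omega>) = 0} \<in> sets M" by measurable
  ultimately have "prob {\<omega> \<in> space M. \<psi>s 1 (first_obs X 1 \<omega>) = 0} = 1"
    by (subst prob_Collect_eq_1) auto
  then show False using assms by simp
qed

theorem theorem4p1:
  fixes M :: "'w measure" and S :: "'a measure" and N :: "'v measure"
    and X :: "nat \<Rightarrow> 'w \<Rightarrow> 'a" and n :: nat
    and \<psi> :: "(nat \<Rightarrow> 'a) \<Rightarrow> real"
    and \<psi>s :: "nat \<Rightarrow> (nat \<Rightarrow> 'a) \<Rightarrow> real"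
    and idx :: "'d::finite \<Rightarrow> nat"
    and W :: "'w \<Rightarrow> real ^ 'd" and Z :: "'v \<Rightarrow> real ^ 'd"
    and \<Sigma> :: "real ^ 'd ^ 'd" and \<rho> :: real
    and h :: "real ^ 'd \<Rightarrow> real"
  assumes "prob_space M"
    and "CARD('d) \<le> n"
    and "prob_space.indep_vars M (\<lambda>_. S) X {..<n}"
    and "\<forall>i<n. \<forall>j<n. distr M S (X i) = distr M S (X j)"
    and "\<psi> \<in> borel_measurable (PiM {..<CARD('d)} (\<lambda>_. S))"
    and "symmetric_on S CARD('d) \<psi>"
    and "integrable M (\<lambda>\<omega>. \<psi> (first_obs X CARD('d) \<omega>))"
    and "integral\<^sup>L M (\<lambda>\<omega>. \<psi> (first_obs X CARD('d) \<omega>)) = 0"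
    and "\<forall>k\<in>{1..CARD('d)}. is_projection M S X CARD('d) \<psi> k (\<psi>s k)"
    and "measure M {\<omega> \<in> space M. \<psi>s 1 (first_obs X 1 \<omega>) = 0} < 1"
    and "bij_betw idx UNIV {1..CARD('d)}"
    and "W = (\<lambda>\<omega>. \<chi> i. W_stat X n \<psi>s (idx i) \<omega>)"
    and "\<Sigma> = second_moment_matrix M W"
    and "standard_normal_vector N Z"
    and "integrable M (\<lambda>\<omega>. \<psi> (first_obs X CARD('d) \<omega>) ^ 4)"
    and "\<rho> = integral\<^sup>L M (\<lambda>\<omega>. \<psi> (first_obs X CARD('d) \<omega>) ^ 4)"
    and "times_differentiable 3 h"
  shows "ennreal \<bar>integral\<^sup>L M (\<lambda>\<omega>. h (W \<omega>)) - integral\<^sup>L N (\<lambda>\<omega>. h (matrix_sqrt \<Sigma> *v Z \<omega>))\<bar>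
    \<le> ennreal (real n powr (-1/2)) *
        (ennreal (4 * \<rho> powr (1/2) * real CARD('d) ^ 6) * sup_deriv2 h
         + ennreal (\<rho> powr (3/4) * real CARD('d) ^ 7) * sup_deriv3 h)"
proof -
  let ?d = "CARD('d)"
  have card1: "1 \<le> ?d" by (simp add: Suc_le_eq)
  interpret U: u_statistic M S X n ?d \<psi> \<psi>s
    by (rule u_statistic.intro, fact, rule u_statistic_axioms.intro) (rule card1 | fact)+
  have idx: "bij_betw idx UNIV {1..?d}" by fact
  have idx_mem: "idx i \<in> {1..?d}" for i using bij_betw_apply[OF idx] by simp
  have h: "times_differentiable 3 h" by fact
  have n: "1 \<le> real n" "1 \<le> sqrt n" using U.n0 by simp_all
  have \<rho>: "\<rho> = U.\<rho>" by fact
  have \<rho>0: "0 < \<rho>" unfolding \<rho> by (rule U.fourth_moment_pos) fact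
  define q where "q = \<rho> powr (1/4)"
  have q: "0 < q" using \<rho>0 by (simp add: q_def)
  have q2: "\<rho> powr (1/2) = q\<^sup>2" and q3: "\<rho> powr (3/4) = q ^ 3" and q4: "\<rho> = q ^ 4"
    unfolding q_def using \<rho>0 by (simp_all add: powr_power)
  have sq: "sqrt U.\<rho> = q\<^sup>2" using q2 \<rho>0 unfolding \<rho>[symmetric] by (simp add: powr_half_sqrt)
  have np: "real n powr (-1/2) = 1 / sqrt n"
    using n by (simp add: powr_minus_divide powr_half_sqrt)
  show ?thesis
  proof (cases "sup_deriv2 h = \<top> \<or> sup_deriv3 h = \<top>")
    \<comment> \<open>Positivity of all factors matters here: since \<open>0 * \<top> = 0\<close>
      for extended nonnegative reals, the right-hand side is infinite only because
      \<open>\<rho> > 0\<close> and \<open>n > 0\<close>.\<close>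
    case True
    have "0 < 4 * \<rho> powr (1/2) * real ?d ^ 6" "0 < \<rho> powr (3/4) * real ?d ^ 7" "0 < real n powr (-1/2)"
      using \<rho>0 n by simp_all
    with True show ?thesis by (auto simp: ennreal_mult_eq_top_iff ennreal_mult_top)
  next
    case False
    define L2 where "L2 = enn2real (sup_deriv2 h)"
    define L3 where "L3 = enn2real (sup_deriv3 h)"
    have L2: "\<bar>partial_deriv i (partial_deriv j h) x\<bar> \<le> L2" for i j x
      unfolding L2_def using False by (intro sup_deriv2_bound) auto
    have L3: "\<bar>partial_deriv i (partial_deriv j (partial_deriv k h)) x\<bar> \<le> L3" for i j k x
      unfolding L3_def using False by (intro sup_deriv3_bound) auto
    have L0: "0 \<le> L2" "0 \<le> L3" by (simp_all add: L2_def L3_def)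
    have W: "W = (\<lambda>\<omega>. \<chi> i. U.w (idx i) \<omega>)" by fact
    have "nonneg_definite \<Sigma>"
      unfolding \<open>\<Sigma> = second_moment_matrix M W\<close> W
      by (rule U.nonneg_definite_second_moment_matrix) (simp add: U.w_covariance(1)[OF idx_mem idx_mem])
    note S = matrix_sqrt_works[OF this]
    let ?A = "matrix_sqrt \<Sigma>"
    have "?A ** transpose ?A = \<Sigma>" using S by (simp add: nonneg_definite_def)
    then have A: "(?A ** transpose ?A) $ i $ j = U.expectation (\<lambda>\<omega>. U.w (idx i) \<omega> * U.w (idx j) \<omega>)" for i j
      by (simp add: \<open>\<Sigma> = second_moment_matrix M W\<close> second_moment_matrix_def W)
    let ?E = "U.expectation (\<lambda>\<omega>. h (\<chi> i. real (idx i) * U.w 1 \<omega>))"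
    let ?x = "real ?d"
    have 1: "\<bar>integral\<^sup>L M (\<lambda>\<omega>. h (W \<omega>)) - ?E\<bar> \<le> L2 * q\<^sup>2 * (?x ^ 5 / sqrt n + ?x ^ 6 / real n)"
      unfolding W sq[symmetric] by (rule U.linearization_error[OF h L2 idx])
    have 2: "\<bar>?E - integral\<^sup>L N (\<lambda>\<omega>. h (?A *v Z \<omega>))\<bar>
      \<le> L2 * q\<^sup>2 * ?x ^ 6 / (2 * real n) + L3 * q ^ 3 * ?x ^ 6 / (2 * sqrt n)"
      by (rule U.lindeberg_error[OF h L2 L3 idx q _ _ A]) (use q4 \<rho> assms in auto)
    have x5: "?x ^ 5 \<le> ?x ^ 6" and x6: "?x ^ 6 \<le> ?x ^ 7" using card1 by (auto intro!: power_increasing)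
    have nn: "1 / real n \<le> 1 / sqrt n"
      using n by (intro divide_left_mono) (auto simp: real_sqrt_le_iff intro: order_trans[OF real_sqrt_le_mono[of _ "real n * real n"]])
    \<comment> \<open>The three contributions of \<open>L2\<close> have coefficients 1, 1 and 1/2;
      both \<open>d^5 / sqrt n\<close> and \<open>d^6 / n\<close> are at most
      \<open>d^6 / sqrt n\<close>, so their total of 5/2 fits under 4.\<close>
    have B2: "L2 * q\<^sup>2 * (?x ^ 5 / sqrt n + ?x ^ 6 / real n) + L2 * q\<^sup>2 * ?x ^ 6 / (2 * real n)
      \<le> 1 / sqrt n * (4 * q\<^sup>2 * ?x ^ 6 * L2)"
    proof -
      have combine: "a + b + b / 2 \<le> 4 * p" if "a \<le> p" "b \<le> p" "0 \<le> p" for a b p :: real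
        using that by linarith
      have n5: "?x ^ 5 / sqrt n \<le> ?x ^ 6 * (1 / sqrt n)" using x5 by (simp add: divide_right_mono)
      have n6: "?x ^ 6 / real n \<le> ?x ^ 6 * (1 / sqrt n)"
        using mult_left_mono[OF nn, of "?x ^ 6"] by simp
      have "?x ^ 5 / sqrt n + ?x ^ 6 / real n + ?x ^ 6 / real n / 2 \<le> 4 * (?x ^ 6 * (1 / sqrt n))"
        by (rule combine[OF n5 n6]) simp
      then have "L2 * q\<^sup>2 * (?x ^ 5 / sqrt n + ?x ^ 6 / real n + ?x ^ 6 / real n / 2) \<le> L2 * q\<^sup>2 * (4 * (?x ^ 6 * (1 / sqrt n)))"
        using L0 by (intro mult_left_mono) auto
      then show ?thesis by (simp add: distrib_left mult_ac)
    qed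
    have B3: "L3 * q ^ 3 * ?x ^ 6 / (2 * sqrt n) \<le> 1 / sqrt n * (q ^ 3 * ?x ^ 7 * L3)"
    proof -
      \<comment> \<open>The exchange gives the coefficient \<open>d^6 / 2\<close>, which
        \<open>d \<ge> 1\<close> places below the stated \<open>d^7\<close>.\<close>
      have "?x ^ 6 / 2 \<le> ?x ^ 7" using x6 zero_le_power[of ?x 6] by linarith
      then have "(L3 * q ^ 3 / sqrt n) * (?x ^ 6 / 2) \<le> (L3 * q ^ 3 / sqrt n) * ?x ^ 7"
        using L0 q n by (intro mult_left_mono) auto
      then show ?thesis by (simp add: mult_ac)
    qed
    have "\<bar>integral\<^sup>L M (\<lambda>\<omega>. h (W \<omega>)) - integral\<^sup>L N (\<lambda>\<omega>. h (?A *v Z \<omega>))\<bar>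
      \<le> 1 / sqrt n * (4 * q\<^sup>2 * ?x ^ 6 * L2) + 1 / sqrt n * (q ^ 3 * ?x ^ 7 * L3)"
      using 1 2 B2 B3 by linarith
    also have "\<dots> = real n powr (-1/2) * (4 * \<rho> powr (1/2) * ?x ^ 6 * L2 + \<rho> powr (3/4) * ?x ^ 7 * L3)"
      unfolding np q2 q3 by (simp only: distrib_left)
    finally have "ennreal \<bar>integral\<^sup>L M (\<lambda>\<omega>. h (W \<omega>)) - integral\<^sup>L N (\<lambda>\<omega>. h (?A *v Z \<omega>))\<bar>
      \<le> ennreal (real n powr (-1/2) * (4 * \<rho> powr (1/2) * ?x ^ 6 * L2 + \<rho> powr (3/4) * ?x ^ 7 * L3))"
      by (rule ennreal_leI)
    also have "\<dots> = ennreal (real n powr (-1/2)) *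
        (ennreal (4 * \<rho> powr (1/2) * ?x ^ 6) * ennreal L2 + ennreal (\<rho> powr (3/4) * ?x ^ 7) * ennreal L3)"
      using L0 \<rho>0 by (simp add: ennreal_mult ennreal_plus)
    also have "ennreal L2 = sup_deriv2 h" using False by (simp add: L2_def ennreal_enn2real_if)
    also have "ennreal L3 = sup_deriv3 h" using False by (simp add: L3_def ennreal_enn2real_if)
    finally show ?thesis .
  qed
qed

end
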